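(* Let $(c_n)_{n\ge1}$ be positive constants such that $c=\lim_{n\to\infty}\frac1n\log c_n$ exists, and for each $n$ let $\phi_n\in\mathcal T_n$ be a Neyman–Pearson type test with threshold $c_n$: for $\omega\in\Gamma=[\omega_0,\dots,\omega_n]$, $\phi_n(\omega)=1$ if $\mu_1(\Gamma)>c_n\mu_0(\Gamma)$, $\phi_n(\omega)=0$ if $\mu_1(\Gamma)<c_n\mu_0(\Gamma)$, and $\phi_n(\omega)=\chi_n\in[0,1]$ if equality holds. 1. (Type 1 errors.) If $c=f_0'(t)$ for some $t>0$ (i.e. $c\in(f_0'(0),A_0)$), then $\lim_{n\to\infty}\frac1n\log\int\phi_n\,d\mu_0=f_0(t)-tf_0'(t)$. If $c>A_0$, this limit equals $-\infty$. If $c<f_0'(0)$, this limit equals $0$. 2. (Type 2 errors.) If $c=-f_1'(s)$ for some $s>0$ (i.e. $c\in(-A_1,-f_1'(0))$), then $\lim_{n\to\infty}\frac1n\log\int(1-\phi_n)\,d\mu_1=f_1(s)-sf_1'(s)$. If $c<-A_1$, this limit equals $-\infty$. If $c>-f_1'(0)$, this limit equals $0$.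
   Context: Let $d\ge2$, $\Omega=\{1,\dots,d\}^{\mathbb Z_+}$, $T$ the left shift, $S_ng=\sum_{k=0}^{n}g\circ T^k$. Pressure: $P(g)=\sup\{h_m(T)+\int g\,dm: m\ T\text{-invariant Borel probability}\}$; for Hölder $g$ there is a unique maximizing (equilibrium) measure. A Jacobian is a Hölder continuous $J:\Omega\to(0,\infty)$ with $\sum_{Ty=\omega}J(y)=1$ for all $\omega$; its Gibbs measure is the equilibrium measure of $\log J$. Let $\mu_0\ne\mu_1$ be the Gibbs measures of Jacobians $J_0,J_1$; for $i\in\{0,1\}$ put $i'=1-i$. $\mathcal T_n$ is the set of measurable $\phi:\Omega\to[0,1]$ depending only on $\omega_0,\dots,\omega_n$. Define $f_i(t)=P(\log J_i+t(\log J_{i'}-\log J_i))$ (which equals $\lim_n\frac1n\log\int (\mu_{i'}([\omega_0..\omega_n])/\mu_i([\omega_0..\omega_n]))^t\,\mu_i(d\omega)$), so $f_i'(t)=\int(\log J_{i'}-\log J_i)\,dm_{i,t}$ with $m_{i,t}$ the equilibrium measure of $\log J_i+t(\log J_{i'}-\log J_i)$. Define $A_i=\lim_{n\to\infty}\operatorname{ess\,sup}_{\mu_i}\frac1nS_n(\log J_{i'}-\log J_i)$ (the range of $f_i'$ on $(0,\infty)$ is $(f_i'(0),A_i)$). *)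

theory Defs
  imports "HOL-Probability.Probability"
begin

text \<open>One-sided full shift over a finite alphabet 'a (the alphabet 1..d is modelled by
a finite type with CARD('a) = d). The sigma-algebra is the product sigma-algebra,
which is the Borel sigma-algebra of the product of discrete topologies.\<close>

definition shift_space :: "(nat \<Rightarrow> 'a) measure" where
  "shift_space = Pi\<^sub>M UNIV (\<lambda>_. count_space UNIV)"

definition shift :: "(nat \<Rightarrow> 'a) \<Rightarrow> (nat \<Rightarrow> 'a)" where
  "shift \<omega> = (\<lambda>k. \<omega> (Suc k))"

definition Sn :: "((nat \<Rightarrow> 'a) \<Rightarrow> real) \<Rightarrow> nat \<Rightarrow> (nat \<Rightarrow> 'a) \<Rightarrow> real" where
  "Sn g n \<omega> = (\<Sum>k=0..n. g ((shift ^^ k) \<omega>))"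

definition cyl :: "nat \<Rightarrow> (nat \<Rightarrow> 'a) \<Rightarrow> (nat \<Rightarrow> 'a) set" where
  "cyl n \<omega> = {\<omega>'. \<forall>k\<le>n. \<omega>' k = \<omega> k}"

text \<open>Hoelder continuity w.r.t. the standard metric 2^(-min{k. omega k ~= omega' k})\<close>
definition holder :: "((nat \<Rightarrow> 'a) \<Rightarrow> real) \<Rightarrow> bool" where
  "holder g \<longleftrightarrow> (\<exists>C \<theta>::real. 0 < \<theta> \<and> \<theta> < 1 \<and>
     (\<forall>n \<omega> \<omega>'. (\<forall>k<n. \<omega> k = \<omega>' k) \<longrightarrow> \<bar>g \<omega> - g \<omega>'\<bar> \<le> C * \<theta> ^ n))"

definition invariant_prob :: "(nat \<Rightarrow> 'a) measure \<Rightarrow> bool" where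
  "invariant_prob m \<longleftrightarrow> sets m = sets shift_space \<and> prob_space m \<and>
     (\<forall>A\<in>sets shift_space. measure m (shift -` A) = measure m A)"

definition part_entropy :: "'b measure \<Rightarrow> ('b \<Rightarrow> 'c) \<Rightarrow> real" where
  "part_entropy m X = - (\<Sum>v\<in>X ` space m.
      measure m (X -` {v} \<inter> space m) * ln (measure m (X -` {v} \<inter> space m)))"

text \<open>Kolmogorov-Sinai entropy h_m(T): supremum over finite measurable partitions
(given as finite-valued measurable maps xi) of lim (1/n) H(join_{k<n} T^-k xi)\<close>
definition ks_entropy :: "(nat \<Rightarrow> 'a) measure \<Rightarrow> real" where
  "ks_entropy m = (SUP \<xi>\<in>{\<xi>::(nat \<Rightarrow> 'a) \<Rightarrow> nat. \<xi> \<in> measurable shift_space (count_space UNIV)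
        \<and> finite (range \<xi>)}.
      lim (\<lambda>n. part_entropy m (\<lambda>\<omega>. map (\<lambda>k. \<xi> ((shift ^^ k) \<omega>)) [0..<n]) / real n))"

definition pressure :: "((nat \<Rightarrow> 'a) \<Rightarrow> real) \<Rightarrow> real" where
  "pressure g = (SUP m\<in>{m. invariant_prob m}. ks_entropy m + integral\<^sup>L m g)"

definition equilibrium :: "((nat \<Rightarrow> 'a) \<Rightarrow> real) \<Rightarrow> (nat \<Rightarrow> 'a) measure \<Rightarrow> bool" where
  "equilibrium g m \<longleftrightarrow> invariant_prob m \<and> ks_entropy m + integral\<^sup>L m g = pressure g"

definition jacobian :: "((nat \<Rightarrow> 'a) \<Rightarrow> real) \<Rightarrow> bool" where
  "jacobian J \<longleftrightarrow> holder J \<and> (\<forall>\<omega>. 0 < J \<omega>) \<and> (\<forall>\<omega>. (\<Sum>y | shift y = \<omega>. J y) = 1)"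

definition gibbs :: "((nat \<Rightarrow> 'a) \<Rightarrow> real) \<Rightarrow> (nat \<Rightarrow> 'a) measure \<Rightarrow> bool" where
  "gibbs J m \<longleftrightarrow> equilibrium (\<lambda>\<omega>. ln (J \<omega>)) m"

definition tests :: "nat \<Rightarrow> ((nat \<Rightarrow> 'a) \<Rightarrow> real) set" where
  "tests n = {\<phi>. \<phi> \<in> borel_measurable shift_space \<and> (\<forall>\<omega>. 0 \<le> \<phi> \<omega> \<and> \<phi> \<omega> \<le> 1) \<and>
      (\<forall>\<omega> \<omega>'. (\<forall>k\<le>n. \<omega> k = \<omega>' k) \<longrightarrow> \<phi> \<omega> = \<phi> \<omega>')}"

definition fP :: "((nat \<Rightarrow> 'a) \<Rightarrow> real) \<Rightarrow> ((nat \<Rightarrow> 'a) \<Rightarrow> real) \<Rightarrow> real \<Rightarrow> real" where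
  "fP J J' t = pressure (\<lambda>\<omega>. ln (J \<omega>) + t * (ln (J' \<omega>) - ln (J \<omega>)))"

definition Aval :: "(nat \<Rightarrow> 'a) measure \<Rightarrow> ((nat \<Rightarrow> 'a) \<Rightarrow> real) \<Rightarrow> ((nat \<Rightarrow> 'a) \<Rightarrow> real) \<Rightarrow> real" where
  "Aval \<mu> J J' = lim (\<lambda>n. real_of_ereal
      (esssup \<mu> (\<lambda>\<omega>. ereal (Sn (\<lambda>x. ln (J' x) - ln (J x)) n \<omega> / real n))))"

definition elog :: "real \<Rightarrow> ereal" where
  "elog x = (if 0 < x then ereal (ln x) else -\<infinity>)"

end

theory Submission
  imports Defs
begin

text \<open>
Put \<open>g = ln J\<^sub>0\<close> and \<open>D = ln J\<^sub>1 - ln J\<^sub>0\<close>. By the Gibbs property the log-likelihood ratio of a cylinder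
is, up to a bounded error, a Birkhoff sum of \<open>D\<close>, so the errors are large deviation
probabilities governed by \<open>P(t)\<close>, the growth rate of the partition function of \<open>g + t D\<close>:
Chernoff's inequality gives the upper bounds, exponential tilting the lower bounds. Tilting needs \<open>P\<close> to be
differentiable with strictly increasing derivative. The second \<open>t\<close>-derivative of the logarithm of
the \<open>n\<close>-th partition function is the variance of the Birkhoff sum of \<open>D\<close> under finite-volume Gibbs weights.
Conditioning on blocks of letters is a contraction on Hoelder functions, which keeps
conditional means within bounded oscillation of each other; hence the variance is at most linear in
\<open>n\<close>, and at least linear unless the Birkhoff sums of \<open>D\<close> are bounded up to constants, in which
case both Gibbs measures coincide.

The measures enter only through the variational principle. Its upper half is Gibbs' inequality
against a product of conditional weights, its lower half uses shift averages of independent blocks.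
An equilibrium measure is tangent to the pressure functional, and
differentiability of the pressure then determines its values on cylinders.
\<close>

section \<open>Words and Birkhoff sums\<close>

text \<open>The measures are given only as maximisers in \<open>pressure\<close>, so even their
  values on cylinders must be derived from that. Spectral theory of the transfer operator is
  avoided: everything is computed for words of length \<open>n\<close> in front of a boundary point,
  with constants independent of \<open>n\<close> and of the boundary, and what survives the limit is
  a pair of quadratic bounds on the pressure. The upper one makes the slope unique, the lower one
  makes the slope strictly increasing. Strictness matters because in the first case of each part the
  threshold sits exactly at the slope for \<open>t\<close>, whereas the lower bound by tilting needs
  it strictly below; the tilt is therefore taken at a slightly larger parameter. Since
  \<open>ks_entropy\<close> ranges over all finite measurable partitions, the upper half of the
  variational principle must first predict an arbitrary partition from finitely many letters with
  small loss. Errors of the second type are errors of the first type with the measures exchanged and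
  the threshold inverted.\<close>

definition pref :: "nat \<Rightarrow> (nat \<Rightarrow> 'a) \<Rightarrow> 'a list" where
  "pref n x = map x [0..<n]"

definition conc :: "'a list \<Rightarrow> (nat \<Rightarrow> 'a) \<Rightarrow> (nat \<Rightarrow> 'a)" (infixr "\<frown>" 65) where
  "w \<frown> x = (\<lambda>k. if k < length w then w ! k else x (k - length w))"

definition words :: "nat \<Rightarrow> 'a list set" where
  "words n = {w. length w = n}"

definition birk :: "((nat \<Rightarrow> 'a) \<Rightarrow> real) \<Rightarrow> nat \<Rightarrow> (nat \<Rightarrow> 'a) \<Rightarrow> real" where
  "birk g n x = (\<Sum>k<n. g ((shift ^^ k) x))"

definition agree :: "nat \<Rightarrow> (nat \<Rightarrow> 'a) \<Rightarrow> (nat \<Rightarrow> 'a) \<Rightarrow> bool" where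
  "agree n x y \<longleftrightarrow> (\<forall>k<n. x k = y k)"

text \<open>\<open>holder\<close> with its constants exposed: later bounds have to be uniform over
  families \<open>g + t D\<close>, so the dependence on \<open>C\<close> and \<open>\<theta>\<close>
  is tracked.\<close>

definition holder_with :: "real \<Rightarrow> real \<Rightarrow> ((nat \<Rightarrow> 'a) \<Rightarrow> real) \<Rightarrow> bool" where
  "holder_with C \<theta> g \<longleftrightarrow> 0 < \<theta> \<and> \<theta> < 1 \<and> (\<forall>n x y. agree n x y \<longrightarrow> \<bar>g x - g y\<bar> \<le> C * \<theta> ^ n)"

text \<open>The \<open>n\<close>-th iterate of the transfer operator of \<open>g\<close> on the
  constant \<open>1\<close>: the preimages of \<open>y\<close> under \<open>n\<close> shifts are the
  points \<open>w \<frown> y\<close>. The boundary \<open>y\<close> stays explicit because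
  conditioning on the last letters merely changes it.\<close>

definition Z :: "((nat \<Rightarrow> 'a::finite) \<Rightarrow> real) \<Rightarrow> nat \<Rightarrow> (nat \<Rightarrow> 'a) \<Rightarrow> real" where
  "Z g n y = (\<Sum>w\<in>words n. exp (birk g n (w \<frown> y)))"

lemma shift_funpow: "(shift ^^ k) x = (\<lambda>i. x (i + k))"
  by (induction k) (auto simp: shift_def)

lemma conc_append: "(u @ w) \<frown> y = u \<frown> w \<frown> y"
  by (auto simp: conc_def nth_append fun_eq_iff)

lemma conc_Nil [simp]: "[] \<frown> y = y"
  by (simp add: conc_def)

lemma shift_conc: "(shift ^^ length w) (w \<frown> y) = y"
  by (simp add: shift_funpow conc_def)

lemma length_pref [simp]: "length (pref n x) = n"
  by (simp add: pref_def)

lemma nth_pref [simp]: "k < n \<Longrightarrow> pref n x ! k = x k"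
  by (simp add: pref_def)

lemma pref_conc: "length w = n \<Longrightarrow> pref n (w \<frown> y) = w"
  by (auto simp: list_eq_iff_nth_eq conc_def)

lemma pref_conc_shift: "pref n x \<frown> (shift ^^ n) x = x"
  by (auto simp: conc_def shift_funpow)

lemma pref_eq_iff: "pref n x = pref n y \<longleftrightarrow> agree n x y"
  by (auto simp: list_eq_iff_nth_eq agree_def)

lemma pref_in_words [simp]: "pref n x \<in> words n"
  by (simp add: words_def)

lemma finite_words [simp]: "finite (words n :: 'a::finite list set)"
  using finite_lists_length_eq[of "UNIV :: 'a set" n] by (simp add: words_def)

lemma words_nonempty [simp]: "words n \<noteq> {}"
  using pref_in_words by blast

lemma card_words: "card (words n :: 'a::finite list set) = CARD('a) ^ n"
  using card_lists_length_eq[of "UNIV :: 'a set" n] by (simp add: words_def)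

lemma words_0 [simp]: "words 0 = {[]}"
  by (auto simp: words_def)

text \<open>The suffix \<open>w\<close> is the outer index because later decompositions condition on
  the block next to the boundary, which leaves a sum with boundary \<open>w \<frown> y\<close>
  inside.\<close>

lemma sum_words_add:
  fixes F :: "'a::finite list \<Rightarrow> 'b::comm_monoid_add"
  shows "(\<Sum>x\<in>words (n + m). F x) = (\<Sum>w\<in>words m. \<Sum>u\<in>words n. F (u @ w))"
proof -
  have "(\<Sum>w\<in>words m. \<Sum>u\<in>words n. F (u @ w)) = (\<Sum>(w, u)\<in>words m \<times> words n. F (u @ w))"
    by (simp add: sum.cartesian_product)
  also have "\<dots> = (\<Sum>x\<in>words (n + m). F x)"
    by (rule sum.reindex_bij_witness[where i = "\<lambda>x. (drop n x, take n x)" and j = "\<lambda>(w, u). u @ w"])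
      (auto simp: words_def)
  finally show ?thesis by simp
qed

lemma birk_add: "birk g (n + m) x = birk g n x + birk g m ((shift ^^ n) x)"
  by (induction m) (simp_all add: birk_def shift_funpow add.commute add.left_commute)

lemma birk_0 [simp]: "birk g 0 x = 0"
  by (simp add: birk_def)

lemma birk_append:
  assumes "length u = n"
  shows "birk g (n + m) ((u @ w) \<frown> y) = birk g n (u \<frown> w \<frown> y) + birk g m (w \<frown> y)"
  using assms shift_conc[of u "w \<frown> y"] by (simp add: conc_append birk_add)

lemma Sn_eq_birk: "Sn g n x = birk g (Suc n) x"
  by (simp add: Sn_def birk_def atLeast0AtMost lessThan_Suc_atMost)

lemma birk_lin: "birk (\<lambda>x. g x + t * h x) n x = birk g n x + t * birk h n x"
  by (simp add: birk_def sum.distrib sum_distrib_left)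

lemma birk_diff: "birk (\<lambda>x. g x - h x) n x = birk g n x - birk h n x"
  by (simp add: birk_def sum_subtractf)

lemma birk_bound:
  assumes "\<And>x. \<bar>g x\<bar> \<le> b"
  shows "\<bar>birk g n x\<bar> \<le> real n * b"
proof -
  have "\<bar>birk g n x\<bar> \<le> (\<Sum>k<n. \<bar>g ((shift ^^ k) x)\<bar>)"
    unfolding birk_def by (rule sum_abs)
  also have "\<dots> \<le> (\<Sum>k<n. b)" by (intro sum_mono assms)
  finally show ?thesis by simp
qed

lemma Z_pos [simp]: "0 < Z g n y"
  unfolding Z_def by (intro sum_pos) auto

lemma Z_nonzero [simp]: "Z g n y \<noteq> 0"
  using Z_pos[of g n y] by linarith

lemma Z_0 [simp]: "Z g 0 y = 1"
  by (simp add: Z_def)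

lemma Z_add: "Z g (n + m) y = (\<Sum>w\<in>words m. exp (birk g m (w \<frown> y)) * Z g n (w \<frown> y))"
  unfolding Z_def sum_words_add sum_distrib_left
  by (intro sum.cong refl) (auto simp: birk_append words_def exp_add)

section \<open>Hoelder moduli and bounded distortion\<close>

lemma holder_withD:
  assumes "holder_with C \<theta> g"
  shows "0 < \<theta>" "\<theta> < 1" "0 \<le> C" "agree n x y \<Longrightarrow> \<bar>g x - g y\<bar> \<le> C * \<theta> ^ n"
proof -
  show "0 < \<theta>" "\<theta> < 1" "agree n x y \<Longrightarrow> \<bar>g x - g y\<bar> \<le> C * \<theta> ^ n"
    using assms by (auto simp: holder_with_def)
  have "\<bar>g x - g x\<bar> \<le> C * \<theta> ^ 0"
    using assms unfolding holder_with_def agree_def by blast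
  then show "0 \<le> C" by simp
qed

lemma holder_iff: "holder g \<longleftrightarrow> (\<exists>C \<theta>. holder_with C \<theta> g)"
  by (auto simp: holder_def holder_with_def agree_def)

lemma holder_with_mono:
  assumes "holder_with C \<theta> g" "C \<le> C'" "\<theta> \<le> \<theta>'" "\<theta>' < 1"
  shows "holder_with C' \<theta>' g"
proof -
  note h = holder_withD[OF assms(1)]
  have "C * \<theta> ^ n \<le> C' * \<theta>' ^ n" for n
    using h assms by (intro mult_mono power_mono) auto
  then show ?thesis
    using h assms unfolding holder_with_def by (meson order_trans less_le_trans)
qed

lemma holder_with_lin:
  assumes "holder_with C \<theta> g" "holder_with C' \<theta> h" "\<bar>t\<bar> \<le> s"
  shows "holder_with (C + s * C') \<theta> (\<lambda>x. g x + t * h x)"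
  unfolding holder_with_def
proof (intro conjI allI impI)
  show "0 < \<theta>" "\<theta> < 1" using holder_withD[OF assms(1)] by auto
  fix n x y assume a: "agree n x (y :: nat \<Rightarrow> 'a)"
  have "\<bar>t * (h x - h y)\<bar> \<le> s * (C' * \<theta> ^ n)"
    unfolding abs_mult using holder_withD[OF assms(2)] a assms(3) by (intro mult_mono) auto
  moreover have "\<bar>g x - g y\<bar> \<le> C * \<theta> ^ n"
    using holder_withD[OF assms(1)] a by auto
  ultimately show "\<bar>(g x + t * h x) - (g y + t * h y)\<bar> \<le> (C + s * C') * \<theta> ^ n"
    by (simp add: algebra_simps abs_le_iff)
qed

lemma holder_common:
  assumes "holder g" "holder h"
  obtains C \<theta> where "holder_with C \<theta> g" "holder_with C \<theta> h"
proof -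
  obtain C \<theta> C' \<theta>' where *: "holder_with C \<theta> g" "holder_with C' \<theta>' h"
    using assms unfolding holder_iff by auto
  show ?thesis
    using that holder_with_mono[OF *(1), of "max C C'" "max \<theta> \<theta>'"]
      holder_with_mono[OF *(2), of "max C C'" "max \<theta> \<theta>'"] holder_withD[OF *(1)] holder_withD[OF *(2)]
    by auto
qed

lemma holder_lin: "holder g \<Longrightarrow> holder h \<Longrightarrow> holder (\<lambda>x. g x + t * h x)"
  by (metis holder_common holder_with_lin holder_iff order_refl)

lemma holder_bounded:
  assumes "holder g" obtains b where "0 \<le> b" "\<And>x. \<bar>g x\<bar> \<le> b"
proof -
  obtain C \<theta> where *: "holder_with C \<theta> g" using assms unfolding holder_iff by auto
  have "\<bar>g x\<bar> \<le> C + \<bar>g undefined\<bar>" for x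
    using holder_withD(4)[OF *, of 0 x undefined] by (simp add: agree_def)
  then show ?thesis using that[of "C + \<bar>g undefined\<bar>"] holder_withD(3)[OF *] by auto
qed

lemma agree_conc: "agree k x y \<Longrightarrow> agree (length w + k) (w \<frown> x) (w \<frown> y)"
  by (auto simp: agree_def conc_def)

lemma agree_shift: "agree (j + k) x y \<Longrightarrow> agree k ((shift ^^ j) x) ((shift ^^ j) y)"
  by (auto simp: agree_def shift_funpow)

lemma agree_0 [simp]: "agree 0 x y"
  by (simp add: agree_def)

text \<open>After \<open>j\<close> shifts the points still agree on \<open>n + k - j\<close>
  letters, so the errors form a geometric series dominated by its last term. The bound does not grow
  with \<open>n\<close>, which is the source of the uniform constants below.\<close>

lemma birk_distortion_agree:
  assumes h: "holder_with C \<theta> g" and a: "agree (n + k) x y"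
  shows "\<bar>birk g n x - birk g n y\<bar> \<le> C / (1 - \<theta>) * \<theta> ^ k"
proof -
  note D = holder_withD[OF h]
  have "\<bar>birk g n x - birk g n y\<bar> \<le> (\<Sum>j<n. \<bar>g ((shift ^^ j) x) - g ((shift ^^ j) y)\<bar>)"
    unfolding birk_def sum_subtractf[symmetric] by (rule sum_abs)
  also have "\<dots> \<le> (\<Sum>j<n. C * \<theta> ^ (n + k - j))"
    using a by (intro sum_mono D(4) agree_shift) auto
  also have "\<dots> = (\<Sum>j<n. C * \<theta> ^ (k + 1) * \<theta> ^ j)"
  proof (rule sum.reindex_bij_witness[where i = "\<lambda>j. n - 1 - j" and j = "\<lambda>j. n - 1 - j"])
    fix j assume "j \<in> {..<n}"
    then have "n + k - j = (k + 1) + (n - 1 - j)" by auto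
    then show "C * \<theta> ^ (k + 1) * \<theta> ^ (n - 1 - j) = C * \<theta> ^ (n + k - j)"
      by (simp only: power_add mult.assoc)
  qed auto
  also have "\<dots> = C * \<theta> ^ (k + 1) * ((1 - \<theta> ^ n) / (1 - \<theta>))"
    using D by (simp add: sum_distrib_left[symmetric] sum_gp_strict)
  also have "\<dots> \<le> C * \<theta> ^ k * (1 / (1 - \<theta>))"
    using D by (intro mult_mono mult_left_mono power_decreasing divide_right_mono) (auto simp: power_le_one)
  finally show ?thesis by (simp add: field_simps)
qed

lemma birk_distortion:
  assumes "holder_with C \<theta> g" "agree k x y" "length w = n"
  shows "\<bar>birk g n (w \<frown> x) - birk g n (w \<frown> y)\<bar> \<le> C / (1 - \<theta>) * \<theta> ^ k"
  using birk_distortion_agree[OF assms(1)] agree_conc[OF assms(2), of w] assms(3) by auto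

lemma birk_distortion_pref:
  assumes "holder_with C \<theta> g"
  shows "\<bar>birk g n (pref n x \<frown> y) - birk g n x\<bar> \<le> C / (1 - \<theta>)"
  using birk_distortion[OF assms agree_0, of "pref n x" n y "(shift ^^ n) x"]
  by (simp add: pref_conc_shift)

text \<open>Both sums run over the same words, so a termwise factor passes to the sums.\<close>

lemma ln_Z_distortion:
  assumes h: "holder_with C \<theta> g" and a: "agree k x y"
  shows "\<bar>ln (Z g n x) - ln (Z g n y)\<bar> \<le> C / (1 - \<theta>) * \<theta> ^ k"
proof -
  define K where "K = C / (1 - \<theta>) * \<theta> ^ k"
  have *: "ln (Z g n x) \<le> K + ln (Z g n y)" if a: "agree k x y" for x y
  proof -
    have "Z g n x \<le> (\<Sum>w\<in>words n. exp K * exp (birk g n (w \<frown> y)))"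
      unfolding Z_def exp_add[symmetric]
    proof (rule sum_mono)
      fix w :: "'a list" assume "w \<in> words n"
      then show "exp (birk g n (w \<frown> x)) \<le> exp (K + birk g n (w \<frown> y))"
        using birk_distortion[OF h a, of w n] by (simp add: K_def words_def abs_le_iff)
    qed
    then have "Z g n x \<le> exp K * Z g n y"
      by (simp add: Z_def sum_distrib_left)
    then have "ln (Z g n x) \<le> ln (exp K * Z g n y)"
      by (subst ln_le_cancel_iff) auto
    then show ?thesis by (simp add: ln_mult)
  qed
  have "agree k y x" using a by (auto simp: agree_def)
  then show ?thesis using *[OF a] *[of y x] by (simp add: K_def abs_le_iff)
qed

text \<open>Fekete's lemma; the limit is the infimum \<open>l\<close>. Dividing \<open>n\<close> by
  a nearly optimal \<open>m\<close> leaves a remainder whose cost is bounded.\<close>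

lemma subadditive_LIMSEQ:
  fixes a :: "nat \<Rightarrow> real"
  assumes sub: "\<And>m n. a (m + n) \<le> a m + a n" and low: "\<And>n. b * real n \<le> a n"
  shows "convergent (\<lambda>n. a n / real n)"
proof -
  define l where "l = (INF n\<in>{1..}. a n / real n)"
  have bdd: "bdd_below ((\<lambda>n. a n / real n) ` {1..})"
    using low by (intro bdd_belowI2[where m = b]) (auto simp: field_simps)
  have mult: "a (q * m) \<le> real q * a m" if "q \<ge> 1" for q m
    using that
  proof (induction q rule: nat_induct_at_least)
    case (Suc n)
    then show ?case using sub[of m "n * m"] by (simp add: algebra_simps)
  qed auto
  have "(\<lambda>n. a n / real n) \<longlonglongrightarrow> l"
  proof (rule LIMSEQ_I)
    fix e :: real assume e: "0 < e"
    have "\<exists>m\<in>{1..}. a m / real m < l + e / 2"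
      using cINF_less_iff[OF _ bdd, of "l + e/2"] e by (auto simp: l_def)
    then obtain m where m: "m \<ge> 1" "a m / real m < l + e / 2" by auto
    \<comment> \<open>Bounds \<open>a r - (l + e/2) * r\<close> for every remainder
      \<open>r < m\<close>, whatever the signs.\<close>
    define B where "B = (\<Sum>r<m. \<bar>a r\<bar>) + real m * \<bar>l + e/2\<bar>"
    have ub: "a n \<le> (l + e / 2) * real n + B" for n
    proof -
      define q r where "q = n div m" and "r = n mod m"
      have n: "n = q * m + r" and r: "r < m" using m by (auto simp: q_def r_def)
      have ar: "a r \<le> (\<Sum>r<m. \<bar>a r\<bar>)"
        using member_le_sum[of r "{..<m}" "\<lambda>r. \<bar>a r\<bar>"] r by auto
      have am: "a m \<le> (l + e/2) * real m" using m by (simp add: field_simps)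
      have "(l + e/2) * real r \<ge> - (real m * \<bar>l + e/2\<bar>)"
      proof -
        have "\<bar>(l + e/2) * real r\<bar> \<le> real m * \<bar>l + e/2\<bar>"
          using r by (auto simp: abs_mult mult.commute intro!: mult_right_mono)
        then show ?thesis by linarith
      qed
      moreover have "a n \<le> real q * ((l + e/2) * real m) + a r"
      proof (cases "q = 0")
        case False
        then have "a (q * m) \<le> real q * a m" by (intro mult) auto
        also have "\<dots> \<le> real q * ((l + e/2) * real m)" using am by (intro mult_left_mono) auto
        finally show ?thesis using sub[of "q * m" r] n by simp
      qed (use n in simp)
      ultimately show ?thesis using ar unfolding B_def n by (simp add: algebra_simps)
    qed
    obtain n0 where n0: "real n0 > 2 * \<bar>B\<bar> / e" using reals_Archimedean2 by blast
    show "\<exists>n0. \<forall>n\<ge>n0. norm (a n / real n - l) < e"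
    proof (intro exI allI impI)
      fix n assume n: "n \<ge> max 1 n0"
      have 1: "l \<le> a n / real n" unfolding l_def using n bdd by (intro cINF_lower) auto
      have "2 * \<bar>B\<bar> < e * real n0" using n0 e by (simp add: field_simps)
      also have "\<dots> \<le> e * real n" using n e by (intro mult_left_mono) auto
      finally have "2 * \<bar>B\<bar> < e * real n" .
      then have "a n < (l + e) * real n" using ub[of n] by (simp add: algebra_simps)
      then have "a n / real n < l + e" using n by (simp add: field_simps)
      with 1 e show "norm (a n / real n - l) < e" by auto
    qed
  qed
  then show ?thesis by (auto simp: convergent_def)
qed

definition top_pressure :: "((nat \<Rightarrow> 'a::finite) \<Rightarrow> real) \<Rightarrow> real" where
  "top_pressure g = lim (\<lambda>n. ln (Z g n undefined) / real n)"

text \<open>\<open>ln Z\<close> is subadditive up to the distortion constant, which also bounds the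
  effect of the boundary; hence one limit serves all \<open>y\<close>.\<close>

lemma top_pressure_LIMSEQ:
  assumes "holder g"
  shows "(\<lambda>n. ln (Z g n y) / real n) \<longlonglongrightarrow> top_pressure g"
proof -
  obtain C \<theta> where h: "holder_with C \<theta> g" using assms unfolding holder_iff by auto
  obtain b where b: "0 \<le> b" "\<And>x. \<bar>g x\<bar> \<le> b" using holder_bounded[OF assms] by metis
  define K where "K = C / (1 - \<theta>)"
  have K: "0 \<le> K" using holder_withD[OF h] by (simp add: K_def)
  have dist: "\<bar>ln (Z g n x) - ln (Z g n y)\<bar> \<le> K" for n x y
    using ln_Z_distortion[OF h agree_0, of n x y] by (simp add: K_def)
  \<comment> \<open>Splitting a word replaces one boundary by another and costs one
    \<open>K\<close>; adding \<open>K\<close> to every term makes the sequence exactly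
    subadditive.\<close>
  have "convergent (\<lambda>n. (ln (Z g n undefined) + K) / real n)"
  proof (rule subadditive_LIMSEQ)
    fix m n
    have "Z g (m + n) undefined \<le> (\<Sum>w\<in>words n. exp (birk g n (w \<frown> undefined)) * (exp K * Z g m undefined))"
      unfolding Z_add
    proof (intro sum_mono mult_left_mono)
      fix w :: "'a list"
      have "ln (Z g m (w \<frown> undefined)) \<le> ln (exp K * Z g m undefined)"
        using dist[of m "w \<frown> undefined" undefined] by (simp add: ln_mult)
      then show "Z g m (w \<frown> undefined) \<le> exp K * Z g m undefined"
        by (subst (asm) ln_le_cancel_iff) auto
    qed auto
    also have "\<dots> = exp K * (Z g m undefined * Z g n undefined)"
      by (simp add: Z_def[of g n] sum_distrib_left sum_distrib_right mult_ac)
    finally have "ln (Z g (m + n) undefined) \<le> ln (exp K * (Z g m undefined * Z g n undefined))"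
      by (subst ln_le_cancel_iff) auto
    then show "ln (Z g (m + n) undefined) + K \<le> ln (Z g m undefined) + K + (ln (Z g n undefined) + K)"
      by (simp add: ln_mult)
  next
    fix n
    have "exp (- b * real n) \<le> exp (birk g n (pref n undefined \<frown> undefined))"
      using birk_bound[of g b, OF b(2), of n "pref n undefined \<frown> undefined"]
      by (simp add: abs_le_iff mult.commute)
    also have "\<dots> \<le> Z g n undefined"
      unfolding Z_def by (rule member_le_sum) auto
    finally have "- b * real n \<le> ln (Z g n undefined)"
      by (subst ln_ge_iff) auto
    then show "- b * real n \<le> ln (Z g n undefined) + K" using K by simp
  qed
  then obtain l where l: "(\<lambda>n. (ln (Z g n undefined) + K) / real n) \<longlonglongrightarrow> l"
    by (auto simp: convergent_def)
  have near: "(\<lambda>n. ln (Z g n y) / real n) \<longlonglongrightarrow> l" for y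
  proof -
    have "(\<lambda>n. (ln (Z g n y) - (ln (Z g n undefined) + K)) / real n) \<longlonglongrightarrow> 0"
    proof (rule Lim_null_comparison)
      show "\<forall>\<^sub>F n in sequentially. norm ((ln (Z g n y) - (ln (Z g n undefined) + K)) / real n) \<le> (2 * K) / real n"
      proof (intro always_eventually allI)
        fix n
        have "\<bar>ln (Z g n y) - (ln (Z g n undefined) + K)\<bar> \<le> 2 * K"
          using dist[of n y undefined] K by linarith
        then show "norm ((ln (Z g n y) - (ln (Z g n undefined) + K)) / real n) \<le> (2 * K) / real n"
          by (simp add: divide_right_mono)
      qed
      show "(\<lambda>n. (2 * K) / real n) \<longlonglongrightarrow> 0" by (rule lim_const_over_n)
    qed
    from tendsto_add[OF this l] show ?thesis by (simp add: diff_divide_distrib add_divide_distrib)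
  qed
  then have "top_pressure g = l" unfolding top_pressure_def by (intro limI)
  with near show ?thesis by simp
qed

section \<open>Finite-volume Gibbs weights\<close>

text \<open>The law of the \<open>m\<close> letters next to the boundary under the Gibbs weights on
  \<open>n + m\<close> letters. It is a Doob transform in which the finite-volume
  \<open>Z g n\<close> stands in for an eigenfunction of the transfer operator.\<close>

definition tr :: "((nat \<Rightarrow> 'a::finite) \<Rightarrow> real) \<Rightarrow> nat \<Rightarrow> nat \<Rightarrow> (nat \<Rightarrow> 'a) \<Rightarrow> 'a list \<Rightarrow> real" where
  "tr g n m y w = exp (birk g m (w \<frown> y)) * Z g n (w \<frown> y) / Z g (n + m) y"

definition mean :: "((nat \<Rightarrow> 'a::finite) \<Rightarrow> real) \<Rightarrow> ((nat \<Rightarrow> 'a) \<Rightarrow> real) \<Rightarrow> nat \<Rightarrow> (nat \<Rightarrow> 'a) \<Rightarrow> real" where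
  "mean g D n y = (\<Sum>w\<in>words n. exp (birk g n (w \<frown> y)) * birk D n (w \<frown> y)) / Z g n y"

definition var :: "((nat \<Rightarrow> 'a::finite) \<Rightarrow> real) \<Rightarrow> ((nat \<Rightarrow> 'a) \<Rightarrow> real) \<Rightarrow> nat \<Rightarrow> (nat \<Rightarrow> 'a) \<Rightarrow> real" where
  "var g D n y = (\<Sum>w\<in>words n. exp (birk g n (w \<frown> y)) * (birk D n (w \<frown> y) - mean g D n y)\<^sup>2) / Z g n y"

section \<open>Conditioning identities for mean and variance\<close>

lemma tr_pos: "0 < tr g n m y w"
  by (simp add: tr_def)

lemma sum_tr: "(\<Sum>w\<in>words m. tr g n m y w) = 1"
  unfolding tr_def sum_divide_distrib[symmetric] Z_add[symmetric] by simp

lemma sum_abs_tr: "(\<Sum>w\<in>words m. \<bar>tr g n m y w\<bar>) = 1"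
  using sum_tr[of g n m y] tr_pos[of g n m y] by (simp add: abs_of_pos)

lemma sum_tr_const: "(\<Sum>w\<in>words m. tr g n m y w * (F w - c)) = (\<Sum>w\<in>words m. tr g n m y w * F w) - c"
  by (simp add: right_diff_distrib sum_subtractf sum_distrib_right[symmetric] sum_tr)

lemma mean_0 [simp]: "mean g D 0 y = 0"
  by (simp add: mean_def)

lemma var_0 [simp]: "var g D 0 y = 0"
  by (simp add: var_def)

lemma sum_mean:
  "(\<Sum>u\<in>words n. exp (birk g n (u \<frown> y)) * birk D n (u \<frown> y)) = Z g n y * mean g D n y"
  by (simp add: mean_def)

text \<open>Tower property: average first over the \<open>n\<close> far letters with boundary
  \<open>w \<frown> y\<close>, then over \<open>w\<close>.\<close>

lemma mean_add:
  "mean g D (n + m) y = (\<Sum>w\<in>words m. tr g n m y w * (birk D m (w \<frown> y) + mean g D n (w \<frown> y)))"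
proof -
  have "(\<Sum>x\<in>words (n + m). exp (birk g (n + m) (x \<frown> y)) * birk D (n + m) (x \<frown> y)) =
     (\<Sum>w\<in>words m. \<Sum>u\<in>words n. exp (birk g m (w \<frown> y)) *
        (exp (birk g n (u \<frown> w \<frown> y)) * (birk D n (u \<frown> w \<frown> y) + birk D m (w \<frown> y))))"
    unfolding sum_words_add by (intro sum.cong refl) (auto simp: words_def birk_append exp_add)
  also have "\<dots> = (\<Sum>w\<in>words m. exp (birk g m (w \<frown> y)) *
      (Z g n (w \<frown> y) * (birk D m (w \<frown> y) + mean g D n (w \<frown> y))))"
    unfolding sum_distrib_left[symmetric] distrib_left sum.distrib sum_mean sum_distrib_right[symmetric]
    by (simp add: Z_def add.commute)
  finally show ?thesis
    unfolding mean_def[of g D "n + m"] tr_def by (simp add: sum_divide_distrib mult.assoc)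
qed

text \<open>Law of total variance: averaged conditional variance plus variance of the conditional
  mean. Iterating it gives both linear bounds on the variance.\<close>

lemma var_add:
  "var g D (n + m) y = (\<Sum>w\<in>words m. tr g n m y w * var g D n (w \<frown> y)) +
     (\<Sum>w\<in>words m. tr g n m y w * (birk D m (w \<frown> y) + mean g D n (w \<frown> y) - mean g D (n + m) y)\<^sup>2)"
proof -
  define M where "M = mean g D (n + m) y"
  have inner: "(\<Sum>u\<in>words n. exp (birk g n (u \<frown> z)) * (birk D n (u \<frown> z) + b - M)\<^sup>2) =
     Z g n z * (var g D n z + (b + mean g D n z - M)\<^sup>2)" for z b
  proof -
    define c where "c = b + mean g D n z - M"
    have "(\<Sum>u\<in>words n. exp (birk g n (u \<frown> z)) * (birk D n (u \<frown> z) + b - M)\<^sup>2) =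
      (\<Sum>u\<in>words n. exp (birk g n (u \<frown> z)) * (birk D n (u \<frown> z) - mean g D n z)\<^sup>2 +
         2 * c * (exp (birk g n (u \<frown> z)) * birk D n (u \<frown> z)) +
         (c\<^sup>2 - 2 * c * mean g D n z) * exp (birk g n (u \<frown> z)))"
      by (intro sum.cong refl) (simp add: c_def power2_eq_square algebra_simps)
    also have "\<dots> = Z g n z * var g D n z + 2 * c * (Z g n z * mean g D n z) +
        (c\<^sup>2 - 2 * c * mean g D n z) * Z g n z"
      by (simp add: sum.distrib sum_distrib_left[symmetric] sum_mean var_def Z_def[symmetric])
    also have "\<dots> = Z g n z * (var g D n z + c\<^sup>2)" by (simp add: algebra_simps)
    finally show ?thesis by (simp add: c_def)
  qed
  have "(\<Sum>x\<in>words (n + m). exp (birk g (n + m) (x \<frown> y)) * (birk D (n + m) (x \<frown> y) - M)\<^sup>2) =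
     (\<Sum>w\<in>words m. exp (birk g m (w \<frown> y)) * (\<Sum>u\<in>words n.
        exp (birk g n (u \<frown> w \<frown> y)) * (birk D n (u \<frown> w \<frown> y) + birk D m (w \<frown> y) - M)\<^sup>2))"
    unfolding sum_words_add sum_distrib_left
    by (intro sum.cong refl) (auto simp: words_def birk_append exp_add)
  also have "\<dots> = (\<Sum>w\<in>words m. exp (birk g m (w \<frown> y)) * (Z g n (w \<frown> y) *
      (var g D n (w \<frown> y) + (birk D m (w \<frown> y) + mean g D n (w \<frown> y) - M)\<^sup>2)))"
    unfolding inner ..
  finally show ?thesis
    unfolding var_def[of g D "n + m"] tr_def M_def[symmetric]
    by (simp add: sum_divide_distrib distrib_left sum.distrib[symmetric] add_divide_distrib mult.assoc)
qed

text \<open>One distortion factor for each ingredient of \<open>tr\<close>, namely the exponential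
  and the two partition functions; hence the \<open>3\<close>.\<close>

lemma tr_distortion:
  assumes h: "holder_with C \<theta> g" and a: "agree k x y" and w: "w \<in> words m"
  shows "tr g n m x w \<le> exp (3 * (C / (1 - \<theta>)) * \<theta> ^ k) * tr g n m y w"
proof -
  define K where "K = C / (1 - \<theta>)"
  have K: "0 \<le> K" "0 < \<theta>" "\<theta> < 1" using holder_withD[OF h] by (auto simp: K_def)
  have 1: "\<bar>birk g m (w \<frown> x) - birk g m (w \<frown> y)\<bar> \<le> K * \<theta> ^ k"
    using birk_distortion[OF h a] w by (auto simp: K_def words_def)
  have 2: "\<bar>ln (Z g n (w \<frown> x)) - ln (Z g n (w \<frown> y))\<bar> \<le> K * \<theta> ^ k"
  proof -
    have "K * \<theta> ^ (m + k) \<le> K * \<theta> ^ k" using K by (intro mult_left_mono power_decreasing) auto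
    then show ?thesis
      using ln_Z_distortion[OF h agree_conc[OF a, of w], of n] w by (simp add: K_def words_def)
  qed
  have 3: "\<bar>ln (Z g (n + m) x) - ln (Z g (n + m) y)\<bar> \<le> K * \<theta> ^ k"
    using ln_Z_distortion[OF h a] by (auto simp: K_def)
  have tr: "tr g n m z w = exp (birk g m (w \<frown> z) + ln (Z g n (w \<frown> z)) - ln (Z g (n + m) z))" for z
    by (simp add: tr_def exp_add exp_diff)
  show ?thesis
    unfolding tr exp_add[symmetric] K_def[symmetric] using 1 2 3 by (simp add: abs_le_iff)
qed

lemma exp_minus_one_le: "0 \<le> s \<Longrightarrow> s \<le> 1 \<Longrightarrow> 0 \<le> (a::real) \<Longrightarrow> exp (a * s) - 1 \<le> a * exp a * s"
proof -
  assume s: "0 \<le> s" "s \<le> 1" "0 \<le> a"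
  have "1 - exp (- (a * s)) \<le> a * s" using exp_ge_add_one_self[of "- (a * s)"] by linarith
  then have "exp (a * s) * (1 - exp (- (a * s))) \<le> exp (a * s) * (a * s)" by (intro mult_left_mono) auto
  also have "\<dots> \<le> exp a * (a * s)" using s by (intro mult_right_mono) (auto simp: mult_left_le)
  finally show ?thesis by (simp add: algebra_simps exp_minus)
qed

text \<open>From a ratio bound to total variation: each sign of the difference is at most
  \<open>e\<close> times one of the two laws, and both have mass one; hence the factor
  \<open>2\<close>. Linearising the exponential keeps the decay in
  \<open>\<theta> ^ k\<close>.\<close>

lemma sum_tr_diff:
  assumes h: "holder_with C \<theta> g" and a: "agree k x y"
  defines "K \<equiv> 3 * (C / (1 - \<theta>))"
  shows "(\<Sum>w\<in>words m. \<bar>tr g n m x w - tr g n m y w\<bar>) \<le> 2 * (K * exp K * \<theta> ^ k)"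
proof -
  have K: "0 \<le> K" and t: "0 < \<theta>" "\<theta> < 1" using holder_withD[OF h] by (auto simp: K_def)
  define e where "e = K * exp K * \<theta> ^ k"
  have e: "exp (K * \<theta> ^ k) - 1 \<le> e"
    using exp_minus_one_le[of "\<theta> ^ k" K] K t by (auto simp: e_def power_le_one)
  have one: "tr g n m x w - tr g n m y w \<le> e * tr g n m y w"
    if a: "agree k x y" and w: "w \<in> words m" for x y w
  proof -
    have "tr g n m x w - tr g n m y w \<le> (exp (K * \<theta> ^ k) - 1) * tr g n m y w"
      using tr_distortion[OF h a w, of n] by (simp add: K_def algebra_simps)
    also have "\<dots> \<le> e * tr g n m y w" using e tr_pos[of g n m y w] by (intro mult_right_mono) auto
    finally show ?thesis .
  qed
  have a': "agree k y x" using a by (auto simp: agree_def)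
  have e0: "0 \<le> e" using K t by (auto simp: e_def)
  have "(\<Sum>w\<in>words m. \<bar>tr g n m x w - tr g n m y w\<bar>)
      \<le> (\<Sum>w\<in>words m. e * tr g n m y w + e * tr g n m x w)"
  proof (rule sum_mono)
    fix w :: "'a list" assume w: "w \<in> words m"
    show "\<bar>tr g n m x w - tr g n m y w\<bar> \<le> e * tr g n m y w + e * tr g n m x w"
      using one[OF a w] one[OF a' w] e0 tr_pos[of g n m x w] tr_pos[of g n m y w]
      by (smt (verit) mult_nonneg_nonneg)
  qed
  also have "\<dots> = 2 * e" by (simp add: sum.distrib sum_distrib_left[symmetric] sum_tr)
  finally show ?thesis by (simp add: e_def)
qed

text \<open>
Truncating the Hoelder modulus at \<open>1\<close> makes conditioning a contraction for a single seminorm: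
pairs of points that agree on few letters gain from the common part of the two laws of the
prepended block, all other pairs from the factor \<open>\<theta> ^ m\<close>.
\<close>
definition osc_le :: "real \<Rightarrow> real \<Rightarrow> real \<Rightarrow> ((nat \<Rightarrow> 'a) \<Rightarrow> real) \<Rightarrow> bool" where
  "osc_le L \<theta> A F \<longleftrightarrow> (\<forall>k x y. agree k x y \<longrightarrow> \<bar>F x - F y\<bar> \<le> A * min 1 (L * \<theta> ^ k))"

lemma sum_weighted_bound:
  fixes p F :: "'b \<Rightarrow> real"
  assumes "\<And>w. w \<in> S \<Longrightarrow> \<bar>F w\<bar> \<le> A"
  shows "\<bar>\<Sum>w\<in>S. p w * F w\<bar> \<le> A * (\<Sum>w\<in>S. \<bar>p w\<bar>)"
proof -
  have "\<bar>\<Sum>w\<in>S. p w * F w\<bar> \<le> (\<Sum>w\<in>S. \<bar>p w * F w\<bar>)" by (rule sum_abs)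
  also have "\<dots> \<le> (\<Sum>w\<in>S. A * \<bar>p w\<bar>)"
    using assms by (intro sum_mono) (simp add: abs_mult mult.commute mult_right_mono)
  finally show ?thesis by (simp add: sum_distrib_left)
qed

text \<open>The constants balance two estimates. For points that agree on many letters, the change
  of law costs at most a quarter of \<open>L * \<theta> ^ k\<close> by the choice of
  \<open>L\<close>, and after prepending \<open>m\<close> letters the oscillation of
  \<open>F\<close> is at most another quarter. For all other points, the two laws share mass
  \<open>exp (- K)\<close>, on which the oscillation is at most halved.\<close>

lemma tr_contraction:
  assumes h: "holder_with C \<theta> g" and F: "osc_le L \<theta> A F" and A: "0 \<le> A"
  defines "K \<equiv> 3 * (C / (1 - \<theta>))"
  assumes L: "L = 8 * (K * exp K) + 2" and m: "L * \<theta> ^ m \<le> 1 / 2"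
  shows "osc_le L \<theta> ((1 - exp (- K) / 2) * A) (\<lambda>y. \<Sum>w\<in>words m. tr g n m y w * F (w \<frown> y))"
  unfolding osc_le_def
proof (intro allI impI)
  fix k x y assume a: "agree k x (y :: nat \<Rightarrow> 'a)"
  have K: "0 \<le> K" and t: "0 < \<theta>" "\<theta> < 1" using holder_withD[OF h] by (auto simp: K_def)
  have L1: "1 \<le> L" using K L by auto
  let ?P = "\<lambda>y. \<Sum>w\<in>words m. tr g n m y w * F (w \<frown> y)"
  let ?k = "exp (- K)"
  have kle: "0 < ?k" "?k \<le> 1" using K by auto
  have osc1: "\<bar>F z - F z'\<bar> \<le> A" for z z'
  proof -
    have "\<bar>F z - F z'\<bar> \<le> A * min 1 (L * \<theta> ^ 0)"
      using F unfolding osc_le_def by (meson agree_0)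
    then show ?thesis using L1 by simp
  qed
  have osck: "\<bar>F (w \<frown> x) - F (w \<frown> y)\<bar> \<le> A * (L * \<theta> ^ (m + k))"
    if "w \<in> words m" "agree k x y" for w k x y
  proof -
    have "\<bar>F (w \<frown> x) - F (w \<frown> y)\<bar> \<le> A * min 1 (L * \<theta> ^ (m + k))"
      using F agree_conc[OF that(2), of w] that(1) unfolding osc_le_def words_def by auto
    also have "\<dots> \<le> A * (L * \<theta> ^ (m + k))" using A by (intro mult_left_mono) auto
    finally show ?thesis .
  qed
  \<comment> \<open>Both laws have mass one, so the constant \<open>F x\<close> can be subtracted;
    the difference of the laws then meets only the oscillation of \<open>F\<close>.\<close>
  have near: "\<bar>?P x - ?P y\<bar> \<le> (1 - ?k / 2) * A * (L * \<theta> ^ k)"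
  proof -
    have eq: "?P x - ?P y = (\<Sum>w\<in>words m. tr g n m x w * (F (w \<frown> x) - F (w \<frown> y))) +
       (\<Sum>w\<in>words m. (tr g n m x w - tr g n m y w) * (F (w \<frown> y) - F x))"
    proof -
      have "(\<Sum>w\<in>words m. (tr g n m x w - tr g n m y w) * (F (w \<frown> y) - F x)) =
          (\<Sum>w\<in>words m. tr g n m x w * (F (w \<frown> y) - F x)) - (\<Sum>w\<in>words m. tr g n m y w * (F (w \<frown> y) - F x))"
        by (simp only: left_diff_distrib[symmetric] sum_subtractf[symmetric])
      moreover have "(\<Sum>w\<in>words m. tr g n m x w * (F (w \<frown> y) - F x)) = (\<Sum>w\<in>words m. tr g n m x w * F (w \<frown> y)) - F x"
        "(\<Sum>w\<in>words m. tr g n m y w * (F (w \<frown> y) - F x)) = ?P y - F x"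
        by (rule sum_tr_const)+
      moreover have "(\<Sum>w\<in>words m. tr g n m x w * (F (w \<frown> x) - F (w \<frown> y))) =
          ?P x - (\<Sum>w\<in>words m. tr g n m x w * F (w \<frown> y))"
        by (simp only: right_diff_distrib sum_subtractf)
      ultimately show ?thesis by linarith
    qed
    have "\<bar>?P x - ?P y\<bar> \<le> A * (L * \<theta> ^ (m + k)) * (\<Sum>w\<in>words m. \<bar>tr g n m x w\<bar>)
        + A * (\<Sum>w\<in>words m. \<bar>tr g n m x w - tr g n m y w\<bar>)"
      unfolding eq by (rule order_trans[OF abs_triangle_ineq], rule add_mono; rule sum_weighted_bound)
        (use osck[OF _ a] osc1 in auto)
    moreover have "A * (\<Sum>w\<in>words m. \<bar>tr g n m x w - tr g n m y w\<bar>) \<le> A * (2 * (K * exp K * \<theta> ^ k))"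
      using A sum_tr_diff[OF h a, of n m] by (intro mult_left_mono) (auto simp: K_def)
    ultimately have "\<bar>?P x - ?P y\<bar> \<le> A * (L * \<theta> ^ (m + k)) + A * (2 * (K * exp K * \<theta> ^ k))"
      by (simp add: sum_abs_tr)
    also have "A * (L * \<theta> ^ (m + k)) + A * (2 * (K * exp K * \<theta> ^ k)) =
        A * \<theta> ^ k * (L * \<theta> ^ m + 2 * (K * exp K))"
      by (simp add: algebra_simps power_add)
    also have "\<dots> \<le> A * \<theta> ^ k * (L * (1 / 2))"
    proof (rule mult_left_mono)
      have "L * \<theta> ^ m \<le> L * (1/4)"
        using m L mult_nonneg_nonneg[OF K exp_ge_zero, of K] by linarith
      then show "L * \<theta> ^ m + 2 * (K * exp K) \<le> L * (1 / 2)" using L by simp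
    qed (use A t in auto)
    also have "\<dots> = (1 / 2) * (A * (L * \<theta> ^ k))" by simp
    also have "\<dots> \<le> (1 - ?k / 2) * (A * (L * \<theta> ^ k))"
      using A L1 t kle by (intro mult_right_mono) auto
    finally show ?thesis by (simp add: mult.assoc)
  qed
  \<comment> \<open>Coupling: the law seen from \<open>x\<close> dominates \<open>exp (- K)\<close>
    times the law seen from \<open>y\<close>. On this common part the same word is prepended to both
    points.\<close>
  have far: "\<bar>?P x - ?P y\<bar> \<le> (1 - ?k / 2) * A"
  proof -
    let ?r = "\<lambda>w. tr g n m x w - ?k * tr g n m y w"
    have r: "0 \<le> ?r w" if "w \<in> words m" for w
    proof -
      have "tr g n m y w \<le> exp K * tr g n m x w"
        using tr_distortion[OF h agree_0 that, of n y x] by (simp add: K_def)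
      then show ?thesis by (simp add: exp_minus field_simps)
    qed
    have sr: "(\<Sum>w\<in>words m. ?r w) = 1 - ?k"
      unfolding sum_subtractf sum_distrib_left[symmetric] sum_tr by simp
    \<comment> \<open>Centring at the second average removes the contribution of that average, so
      the unmatched mass \<open>1 - exp (- K)\<close> is weighed against an oscillation of at most
      \<open>A\<close>.\<close>
    define c where "c = ?P y"
    have Fc: "\<bar>F z - c\<bar> \<le> A" for z
    proof -
      have eq: "F z - c = (\<Sum>w\<in>words m. tr g n m y w * (F z - F (w \<frown> y)))"
        using sum_tr_const[where F = "\<lambda>w. F (w \<frown> y)" and c = "F z", of g n m y]
        by (simp add: c_def right_diff_distrib sum_subtractf)
      have "\<bar>F z - c\<bar> \<le> A * (\<Sum>w\<in>words m. \<bar>tr g n m y w\<bar>)"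
        unfolding eq by (rule sum_weighted_bound) (rule osc1)
      then show ?thesis by (simp add: sum_abs_tr)
    qed
    have "?P x - ?P y = (\<Sum>w\<in>words m. tr g n m x w * (F (w \<frown> x) - c))"
      using sum_tr_const[where F = "\<lambda>w. F (w \<frown> x)" and c = c, of g n m x] by (simp add: c_def)
    also have "\<dots> = (\<Sum>w\<in>words m. ?r w * (F (w \<frown> x) - c)) +
         (\<Sum>w\<in>words m. (?k * tr g n m y w) * (F (w \<frown> x) - F (w \<frown> y)))"
    proof -
      have "(\<Sum>w\<in>words m. tr g n m x w * (F (w \<frown> x) - c)) =
        (\<Sum>w\<in>words m. ?r w * (F (w \<frown> x) - c) + (?k * tr g n m y w) * (F (w \<frown> x) - F (w \<frown> y))
          + ?k * (tr g n m y w * (F (w \<frown> y) - c)))"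
        by (intro sum.cong refl) (simp add: algebra_simps)
      also have "\<dots> = (\<Sum>w\<in>words m. ?r w * (F (w \<frown> x) - c)) +
         (\<Sum>w\<in>words m. (?k * tr g n m y w) * (F (w \<frown> x) - F (w \<frown> y))) + ?k * (?P y - c)"
        by (simp only: sum.distrib sum_distrib_left[symmetric, of ?k "\<lambda>w. tr g n m y w * (F (w \<frown> y) - c)"]
          sum_tr_const[where F = "\<lambda>w. F (w \<frown> y)"])
      finally show ?thesis by (simp add: c_def)
    qed
    finally have eq: "?P x - ?P y = (\<Sum>w\<in>words m. ?r w * (F (w \<frown> x) - c)) +
         (\<Sum>w\<in>words m. (?k * tr g n m y w) * (F (w \<frown> x) - F (w \<frown> y)))" .
    have "\<bar>?P x - ?P y\<bar> \<le> A * (\<Sum>w\<in>words m. \<bar>?r w\<bar>) + A * (L * \<theta> ^ (m + 0)) * (\<Sum>w\<in>words m. \<bar>?k * tr g n m y w\<bar>)"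
      unfolding eq by (rule order_trans[OF abs_triangle_ineq], rule add_mono; rule sum_weighted_bound)
        (use osck[OF _ agree_0] Fc in auto)
    moreover have "(\<Sum>w\<in>words m. \<bar>?r w\<bar>) = 1 - ?k" using r sr by simp
    moreover have "(\<Sum>w\<in>words m. \<bar>?k * tr g n m y w\<bar>) = ?k"
      by (simp add: abs_mult sum_distrib_left[symmetric] sum_abs_tr)
    ultimately have "\<bar>?P x - ?P y\<bar> \<le> A * (1 - ?k) + A * (L * \<theta> ^ (m + 0)) * ?k" by (simp only:)
    also have "A * (1 - ?k) + A * (L * \<theta> ^ (m + 0)) * ?k \<le> A * (1 - ?k) + A * (1 / 2) * ?k"
      using m A kle by (intro add_left_mono mult_right_mono mult_left_mono) auto
    also have "\<dots> = (1 - ?k / 2) * A" by (simp add: algebra_simps)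
    finally show ?thesis .
  qed
  have "0 \<le> (1 - ?k / 2) * A" by (intro mult_nonneg_nonneg) (use A kle in linarith)+
  then have "(1 - ?k / 2) * A * min 1 (L * \<theta> ^ k) = min ((1 - ?k / 2) * A) ((1 - ?k / 2) * A * (L * \<theta> ^ k))"
    by (simp add: min_mult_distrib_left)
  then show "\<bar>?P x - ?P y\<bar> \<le> (1 - ?k / 2) * A * min 1 (L * \<theta> ^ k)"
    using near far by simp
qed

text \<open>The inhomogeneous term of the recursion \<open>mean_add\<close>. A bound in terms of
  \<open>m\<close> instead of \<open>j\<close> lets short words share the constant of full
  blocks.\<close>

lemma osc_le_birk:
  assumes h: "holder_with C \<theta> g" and hD: "holder_with C' \<theta> D" and b: "\<And>x. \<bar>D x\<bar> \<le> b"
    and L: "1 \<le> L" and jm: "j \<le> m"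
  defines "K \<equiv> 3 * (C / (1 - \<theta>))"
  shows "osc_le L \<theta> (C' / (1 - \<theta>) + real m * b * (2 * (K * exp K)))
           (\<lambda>y. \<Sum>w\<in>words j. tr g n j y w * birk D j (w \<frown> y))"
  unfolding osc_le_def
proof (intro allI impI)
  fix k x y assume a: "agree k x (y :: nat \<Rightarrow> 'a)"
  have K: "0 \<le> K" and t: "0 < \<theta>" "\<theta> < 1" using holder_withD[OF h] by (auto simp: K_def)
  have C': "0 \<le> C' / (1 - \<theta>)" using holder_withD[OF hD] by auto
  have b0: "0 \<le> b" using b[of undefined] by linarith
  define A where "A = C' / (1 - \<theta>) + real m * b * (2 * (K * exp K))"
  have A: "0 \<le> A" using b0 K C' by (simp add: A_def)
  let ?F = "\<lambda>y. \<Sum>w\<in>words j. tr g n j y w * birk D j (w \<frown> y)"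
  have eq: "?F x - ?F y = (\<Sum>w\<in>words j. tr g n j x w * (birk D j (w \<frown> x) - birk D j (w \<frown> y))) +
     (\<Sum>w\<in>words j. (tr g n j x w - tr g n j y w) * birk D j (w \<frown> y))"
    by (simp add: sum.distrib[symmetric] sum_subtractf[symmetric] algebra_simps)
  have "\<bar>?F x - ?F y\<bar> \<le> (C' / (1 - \<theta>) * \<theta> ^ k) * (\<Sum>w\<in>words j. \<bar>tr g n j x w\<bar>)
      + (real m * b) * (\<Sum>w\<in>words j. \<bar>tr g n j x w - tr g n j y w\<bar>)"
    unfolding eq
  proof (rule order_trans[OF abs_triangle_ineq], rule add_mono; rule sum_weighted_bound)
    fix w :: "'a list" assume w: "w \<in> words j"
    show "\<bar>birk D j (w \<frown> x) - birk D j (w \<frown> y)\<bar> \<le> C' / (1 - \<theta>) * \<theta> ^ k"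
      using birk_distortion[OF hD a, of w j] w by (simp add: words_def)
    have "\<bar>birk D j (w \<frown> y)\<bar> \<le> real j * b" by (rule birk_bound) (rule b)
    also have "\<dots> \<le> real m * b" using jm b0 by (intro mult_right_mono) auto
    finally show "\<bar>birk D j (w \<frown> y)\<bar> \<le> real m * b" .
  qed
  also have "\<dots> \<le> (C' / (1 - \<theta>) * \<theta> ^ k) * 1 + (real m * b) * (2 * (K * exp K * \<theta> ^ k))"
    using sum_tr_diff[OF h a, of n j] b0 unfolding sum_abs_tr by (intro add_left_mono mult_left_mono) (auto simp: K_def)
  also have "\<dots> = A * \<theta> ^ k" by (simp add: A_def algebra_simps)
  also have "\<dots> \<le> A * min 1 (L * \<theta> ^ k)"
    using A L t mult_right_mono[OF L, of "\<theta> ^ k"] by (intro mult_left_mono) (auto simp: power_le_one)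
  finally show "\<bar>?F x - ?F y\<bar> \<le> (C' / (1 - \<theta>) + real m * b * (2 * (K * exp K))) * min 1 (L * \<theta> ^ k)"
    by (simp add: A_def)
qed

lemma osc_le_mono: "osc_le L \<theta> A F \<Longrightarrow> A \<le> A' \<Longrightarrow> 0 < \<theta> \<Longrightarrow> 0 \<le> L \<Longrightarrow> osc_le L \<theta> A' F"
  unfolding osc_le_def by (meson mult_right_mono order_trans min.boundedI zero_le_one mult_nonneg_nonneg zero_le_power less_imp_le)

lemma osc_le_add:
  assumes "osc_le L \<theta> A F" "osc_le L \<theta> B G"
  shows "osc_le L \<theta> (A + B) (\<lambda>x. F x + G x)"
  unfolding osc_le_def
proof (intro allI impI)
  fix k x y assume "agree k x (y :: nat \<Rightarrow> 'a)"
  then have "\<bar>F x - F y\<bar> \<le> A * min 1 (L * \<theta> ^ k)" "\<bar>G x - G y\<bar> \<le> B * min 1 (L * \<theta> ^ k)"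
    using assms unfolding osc_le_def by blast+
  then show "\<bar>F x + G x - (F y + G y)\<bar> \<le> (A + B) * min 1 (L * \<theta> ^ k)"
    unfolding distrib_right by linarith
qed

text \<open>Conditioning on a block turns an oscillation bound \<open>A\<close> into
  \<open>A1 + r * A\<close> with \<open>r < 1\<close>, so the fixed point \<open>A0\<close> bounds
  all lengths. It depends on the potential \<open>g\<close> only through \<open>C\<close> and
  \<open>\<theta>\<close> and therefore serves all tilts at once.\<close>

lemma mean_oscillation:
  fixes D :: "(nat \<Rightarrow> 'a::finite) \<Rightarrow> real"
  assumes hD: "holder_with C' \<theta> D" and b: "\<And>x. \<bar>D x\<bar> \<le> b" and C0: "0 \<le> C"
  obtains M where "0 \<le> M"
    "\<And>g n x y. holder_with C \<theta> g \<Longrightarrow> \<bar>mean g D n x - mean g D n y\<bar> \<le> M"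
proof -
  have t: "0 < \<theta>" "\<theta> < 1" "0 \<le> C'" using holder_withD[OF hD] by auto
  define K where "K = 3 * (C / (1 - \<theta>))"
  define L where "L = 8 * (K * exp K) + 2"
  have K: "0 \<le> K" using C0 t by (simp add: K_def)
  have L: "1 \<le> L" using K by (auto simp: L_def)
  have b0: "0 \<le> b" using b[of undefined] by linarith
  obtain m0 where m0: "\<theta> ^ m0 < 1 / (2 * L)"
    using real_arch_pow_inv[of "1 / (2 * L)" \<theta>] t L by auto
  \<comment> \<open>\<open>Suc\<close> ensures a nonempty block, so that the induction on the length
    descends.\<close>
  define m where "m = Suc m0"
  have "\<theta> ^ m \<le> \<theta> ^ m0" unfolding m_def using t by (intro power_decreasing) auto
  then have "\<theta> ^ m \<le> 1 / (2 * L)" using m0 by linarith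
  then have m: "L * \<theta> ^ m \<le> 1 / 2" "m \<ge> 1" using L by (auto simp: field_simps m_def)
  define A1 where "A1 = C' / (1 - \<theta>) + real m * b * (2 * (K * exp K))"
  define r where "r = 1 - exp (- K) / 2"
  have "exp (- K) \<le> 1" using K by simp
  then have r: "0 \<le> r" "r < 1" by (simp_all add: r_def del: exp_le_one_iff)
  define A0 where "A0 = A1 / (1 - r)"
  have A1: "0 \<le> A1" using b0 K t by (simp add: A1_def)
  have A0: "A1 \<le> A0" "0 \<le> A0" "A1 + r * A0 = A0"
    using A1 r by (auto simp: A0_def field_simps mult_left_le)
  have main: "osc_le L \<theta> A0 (mean g D n)" if h: "holder_with C \<theta> g" for g n
  proof (induction n rule: less_induct)
    case (less n)
    show ?case
    proof (cases "n < m")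
      case True
      have "osc_le L \<theta> A1 (\<lambda>y. \<Sum>w\<in>words n. tr g 0 n y w * birk D n (w \<frown> y))"
        using osc_le_birk[OF h hD b L, of n m 0] True by (simp add: A1_def K_def)
      also have "(\<lambda>y. \<Sum>w\<in>words n. tr g 0 n y w * birk D n (w \<frown> y)) = mean g D n"
        using mean_add[of g D 0 n] by (auto simp: fun_eq_iff)
      finally show ?thesis using osc_le_mono A0 t L by fastforce
    next
      case False
      then obtain k where n: "n = k + m" by (metis le_add_diff_inverse2 not_less)
      have 1: "osc_le L \<theta> A1 (\<lambda>y. \<Sum>w\<in>words m. tr g k m y w * birk D m (w \<frown> y))"
        using osc_le_birk[OF h hD b L, of m m k] by (simp add: A1_def K_def)
      have IH: "osc_le L \<theta> A0 (mean g D k)" using less[of k] n m by auto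
      have 2: "osc_le L \<theta> (r * A0) (\<lambda>y. \<Sum>w\<in>words m. tr g k m y w * mean g D k (w \<frown> y))"
        using tr_contraction[OF h IH A0(2), where m = m and n = k] m(1) by (simp add: K_def L_def r_def)
      have "osc_le L \<theta> (A1 + r * A0) (\<lambda>y. (\<Sum>w\<in>words m. tr g k m y w * birk D m (w \<frown> y)) +
          (\<Sum>w\<in>words m. tr g k m y w * mean g D k (w \<frown> y)))"
        by (rule osc_le_add[OF 1 2])
      also have "(\<lambda>y. (\<Sum>w\<in>words m. tr g k m y w * birk D m (w \<frown> y)) +
          (\<Sum>w\<in>words m. tr g k m y w * mean g D k (w \<frown> y))) = mean g D n"
        by (simp add: n mean_add fun_eq_iff sum.distrib[symmetric] distrib_left)
      finally show ?thesis using A0(3) by simp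
    qed
  qed
  show thesis
  proof (rule that[OF A0(2)])
    fix g :: "(nat \<Rightarrow> 'a) \<Rightarrow> real" and n x y assume "holder_with C \<theta> g"
    from main[OF this, of n] have "\<bar>mean g D n x - mean g D n y\<bar> \<le> A0 * min 1 (L * \<theta> ^ 0)"
      unfolding osc_le_def using agree_0 by blast
    then show "\<bar>mean g D n x - mean g D n y\<bar> \<le> A0" using L by simp
  qed
qed

section \<open>Linear bounds on the variance\<close>

lemma mean_bound:
  assumes b: "\<And>x. \<bar>D x\<bar> \<le> b"
  shows "\<bar>mean g D n y\<bar> \<le> real n * b"
proof -
  have "mean g D n y = (\<Sum>w\<in>words n. tr g 0 n y w * birk D n (w \<frown> y))"
    using mean_add[of g D 0 n] by simp
  also have "\<bar>\<dots>\<bar> \<le> real n * b * (\<Sum>w\<in>words n. \<bar>tr g 0 n y w\<bar>)"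
    by (intro sum_weighted_bound birk_bound b)
  finally show ?thesis by (simp add: sum_abs_tr)
qed

lemma var_nonneg: "0 \<le> var g D n y"
  unfolding var_def by (intro divide_nonneg_pos sum_nonneg) auto

text \<open>Reveal the letters one at a time from the boundary. Changing the revealed letter moves
  its own term by at most \<open>2 * b\<close> and the conditional mean of the rest by at most
  \<open>M\<close>.\<close>

lemma var_upper:
  assumes b: "\<And>x. \<bar>D x\<bar> \<le> b" and M: "\<And>n x y. \<bar>mean g D n x - mean g D n y\<bar> \<le> M"
  shows "var g D n y \<le> real n * (2 * b + M)\<^sup>2"
proof (induction n arbitrary: y)
  case (Suc n)
  let ?X = "\<lambda>w. birk D 1 (w \<frown> y) + mean g D n (w \<frown> y)"
  have 1: "(\<Sum>w\<in>words 1. tr g n 1 y w * var g D n (w \<frown> y)) \<le> (\<Sum>w\<in>words 1. tr g n 1 y w * (real n * (2 * b + M)\<^sup>2))"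
    using Suc tr_pos[of g n 1 y] by (intro sum_mono mult_left_mono) (auto intro: less_imp_le)
  have X: "\<bar>?X w - mean g D (n + 1) y\<bar> \<le> 2 * b + M" for w
  proof -
    have eq: "?X w - mean g D (n + 1) y = (\<Sum>w'\<in>words 1. tr g n 1 y w' * (?X w - ?X w'))"
      unfolding mean_add using sum_tr_const[of g n 1 y ?X "?X w"]
      by (simp add: right_diff_distrib sum_subtractf)
    have "\<bar>?X w - ?X w'\<bar> \<le> 2 * b + M" for w'
      using b[of "w \<frown> y"] b[of "w' \<frown> y"] M[of n "w \<frown> y" "w' \<frown> y"] by (simp add: birk_def)
    then have "\<bar>?X w - mean g D (n + 1) y\<bar> \<le> (2 * b + M) * (\<Sum>w\<in>words 1. \<bar>tr g n 1 y w\<bar>)"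
      unfolding eq by (rule sum_weighted_bound)
    then show ?thesis unfolding sum_abs_tr by simp
  qed
  have 2: "(\<Sum>w\<in>words 1. tr g n 1 y w * (?X w - mean g D (n + 1) y)\<^sup>2) \<le> (\<Sum>w\<in>words 1. tr g n 1 y w * (2 * b + M)\<^sup>2)"
  proof (intro sum_mono mult_left_mono)
    fix w :: "'a list"
    show "(?X w - mean g D (n + 1) y)\<^sup>2 \<le> (2 * b + M)\<^sup>2"
      using power_mono[OF X[of w] abs_ge_zero, of 2] by simp
  qed (simp add: tr_pos less_imp_le)
  have "var g D (n + 1) y \<le> real n * (2 * b + M)\<^sup>2 + (2 * b + M)\<^sup>2"
    unfolding var_add using 1 2 by (simp add: sum_distrib_right[symmetric] sum_tr[of g n 1, simplified])
  then show ?case by (simp add: algebra_simps)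
qed simp

text \<open>Finite energy: boundary effects on \<open>Z\<close> are bounded by distortion, so no
  word of length \<open>l\<close> can have conditional probability tending to zero as
  \<open>n\<close> grows.\<close>

lemma tr_lower:
  fixes g :: "(nat \<Rightarrow> 'a::finite) \<Rightarrow> real"
  assumes h: "holder_with C \<theta> g" and b: "\<And>x. \<bar>g x\<bar> \<le> b" and w: "w \<in> words l"
  shows "exp (- (2 * real l * b + C / (1 - \<theta>))) / CARD('a) ^ l \<le> tr g n l y w"
proof -
  define K where "K = C / (1 - \<theta>)"
  have bl: "\<bar>birk g l x\<bar> \<le> real l * b" for x by (intro birk_bound b)
  have "Z g (n + l) y \<le> (\<Sum>w'\<in>(words l :: 'a list set). exp (real l * b) * (exp K * Z g n (w \<frown> y)))"
    unfolding Z_add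
  proof (intro sum_mono mult_mono)
    fix w' :: "'a list"
    show "exp (birk g l (w' \<frown> y)) \<le> exp (real l * b)" using bl[of "w' \<frown> y"] by (simp add: abs_le_iff)
    have "ln (Z g n (w' \<frown> y)) \<le> ln (exp K * Z g n (w \<frown> y))"
      using ln_Z_distortion[OF h agree_0, of n "w' \<frown> y" "w \<frown> y"] by (simp add: ln_mult K_def abs_le_iff)
    then show "Z g n (w' \<frown> y) \<le> exp K * Z g n (w \<frown> y)"
      by (subst (asm) ln_le_cancel_iff) auto
  qed (auto intro: less_imp_le)
  also have "\<dots> = CARD('a) ^ l * (exp (real l * b) * exp K) * Z g n (w \<frown> y)"
    by (simp add: card_words)
  finally have Z: "Z g (n + l) y \<le> CARD('a) ^ l * (exp (real l * b) * exp K) * Z g n (w \<frown> y)" .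
  have "exp (- (2 * real l * b + K)) / CARD('a) ^ l * Z g (n + l) y
      \<le> exp (- (2 * real l * b + K)) / CARD('a) ^ l * (CARD('a) ^ l * (exp (real l * b) * exp K) * Z g n (w \<frown> y))"
    using Z by (intro mult_left_mono) auto
  also have "\<dots> = exp (- (real l * b)) * Z g n (w \<frown> y)"
    by (simp add: exp_add[symmetric] mult.assoc[symmetric])
  also have "\<dots> \<le> exp (birk g l (w \<frown> y)) * Z g n (w \<frown> y)"
    using bl[of "w \<frown> y"] by (intro mult_right_mono) (auto simp: abs_le_iff intro: less_imp_le)
  finally show ?thesis unfolding tr_def K_def by (simp add: le_divide_eq)
qed

text \<open>The gap \<open>M + 1\<close> between the two words survives the change of the
  conditional mean, which offsets at most \<open>M\<close>. Two values at distance one, each of mass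
  at least \<open>\<delta>\<close>, contribute variance \<open>\<delta> / 2\<close> in every
  block.\<close>

lemma var_lower:
  assumes M: "\<And>n x y. \<bar>mean g D n x - mean g D n y\<bar> \<le> M"
    and tr: "\<And>n y w. w \<in> words l \<Longrightarrow> \<delta> \<le> tr g n l y w" and \<delta>: "0 \<le> \<delta>"
    and uv: "u \<in> words l" "v \<in> words l" "\<And>y. birk D l (u \<frown> y) - birk D l (v \<frown> y) \<ge> M + 1"
  shows "real k * (\<delta> / 2) \<le> var g D (k * l) y"
proof (induction k arbitrary: y)
  case 0
  show ?case by simp
next
  case (Suc k)
  let ?n = "k * l"
  let ?X = "\<lambda>w. birk D l (w \<frown> y) + mean g D ?n (w \<frown> y)"
  define c where "c = mean g D (?n + l) y"
  have M0: "0 \<le> M" using M[of 0 undefined undefined] by linarith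
  have uv': "u \<noteq> v" using uv(3)[of undefined] M0 by auto
  have "(\<Sum>w\<in>words l. tr g ?n l y w * (real k * (\<delta> / 2))) \<le> (\<Sum>w\<in>words l. tr g ?n l y w * var g D ?n (w \<frown> y))"
    using Suc tr_pos[of g ?n l y] by (intro sum_mono mult_left_mono) (auto intro: less_imp_le)
  then have 1: "real k * (\<delta> / 2) \<le> (\<Sum>w\<in>words l. tr g ?n l y w * var g D ?n (w \<frown> y))"
    unfolding sum_distrib_right[symmetric] sum_tr by simp
  have d: "1 \<le> ?X u - ?X v" using uv(3)[of y] M[of ?n "u \<frown> y" "v \<frown> y"] by (simp add: abs_le_iff)
  have "\<delta> / 2 \<le> \<delta> * ((?X u - c)\<^sup>2 + (?X v - c)\<^sup>2)"
  proof -
    have "1 \<le> (?X u - ?X v)\<^sup>2" using d by (simp add: one_le_power)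
    also have "\<dots> \<le> 2 * ((?X u - c)\<^sup>2 + (?X v - c)\<^sup>2)"
      using zero_le_power2[of "(?X u - c) + (?X v - c)"] by (simp add: power2_eq_square algebra_simps)
    finally have "1 / 2 \<le> (?X u - c)\<^sup>2 + (?X v - c)\<^sup>2" by simp
    from mult_left_mono[OF this \<delta>] show ?thesis by simp
  qed
  also have "\<dots> = (\<Sum>w\<in>{u, v}. \<delta> * (?X w - c)\<^sup>2)" using uv' by (simp add: distrib_left)
  also have "\<dots> \<le> (\<Sum>w\<in>{u, v}. tr g ?n l y w * (?X w - c)\<^sup>2)"
    using tr uv by (intro sum_mono mult_right_mono) auto
  also have "\<dots> \<le> (\<Sum>w\<in>words l. tr g ?n l y w * (?X w - c)\<^sup>2)"
    using uv by (intro sum_mono2) (auto simp: tr_pos less_imp_le)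
  finally have 2: "\<delta> / 2 \<le> (\<Sum>w\<in>words l. tr g ?n l y w * (?X w - c)\<^sup>2)" .
  have "real k * (\<delta> / 2) + \<delta> / 2 \<le> var g D (?n + l) y"
    unfolding var_add using 1 2 by (simp add: c_def)
  then show ?case by (simp add: algebra_simps)
qed

section \<open>Smoothness of the topological pressure\<close>

lemma Z_has_derivative:
  "((\<lambda>t. Z (\<lambda>x. g x + t * D x) n y) has_real_derivative
     Z (\<lambda>x. g x + t * D x) n y * mean (\<lambda>x. g x + t * D x) D n y) (at t)"
  unfolding sum_mean[symmetric] unfolding Z_def birk_lin
  by (rule DERIV_cong[OF DERIV_sum]) (auto intro!: derivative_eq_intros simp: mult.commute)

lemma ln_Z_has_derivative:
  "((\<lambda>t. ln (Z (\<lambda>x. g x + t * D x) n y)) has_real_derivative mean (\<lambda>x. g x + t * D x) D n y) (at t)"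
  using DERIV_chain2[OF DERIV_ln_divide[OF Z_pos] Z_has_derivative[of g D n y t]] by simp

lemma mean_has_derivative:
  "((\<lambda>t. mean (\<lambda>x. g x + t * D x) D n y) has_real_derivative var (\<lambda>x. g x + t * D x) D n y) (at t)"
proof -
  let ?g = "\<lambda>t x. g x + t * D x"
  define z where "z = Z (?g t) n y"
  define m where "m = mean (?g t) D n y"
  define s2 where "s2 = (\<Sum>w\<in>words n. exp (birk (?g t) n (w \<frown> y)) * (birk D n (w \<frown> y))\<^sup>2)"
  have z: "z \<noteq> 0" by (simp add: z_def)
  have sm: "(\<Sum>w\<in>words n. exp (birk (?g t) n (w \<frown> y)) * birk D n (w \<frown> y)) = z * m"
    unfolding sum_mean z_def m_def ..
  have 1: "((\<lambda>t. \<Sum>w\<in>words n. exp (birk (?g t) n (w \<frown> y)) * birk D n (w \<frown> y)) has_real_derivative s2) (at t)"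
    unfolding birk_lin s2_def
    by (rule DERIV_cong[OF DERIV_sum]) (auto intro!: derivative_eq_intros simp: power2_eq_square mult_ac)
  have "((\<lambda>t. mean (?g t) D n y) has_real_derivative (s2 * z - z * m * (z * m)) / (z * z)) (at t)"
    unfolding mean_def
    using DERIV_divide[OF 1 Z_has_derivative[of g D n y t]] sm z by (simp add: z_def m_def)
  moreover have "(s2 * z - z * m * (z * m)) / (z * z) = s2 / z - m\<^sup>2"
    using z by (simp add: field_simps power2_eq_square)
  moreover have "var (?g t) D n y = s2 / z - m\<^sup>2"
  proof -
    have "(\<Sum>w\<in>words n. exp (birk (?g t) n (w \<frown> y)) * (birk D n (w \<frown> y) - m)\<^sup>2) =
        (\<Sum>w\<in>words n. exp (birk (?g t) n (w \<frown> y)) * (birk D n (w \<frown> y))\<^sup>2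
          - 2 * m * (exp (birk (?g t) n (w \<frown> y)) * birk D n (w \<frown> y)) + m\<^sup>2 * exp (birk (?g t) n (w \<frown> y)))"
      by (intro sum.cong refl) (simp add: power2_eq_square algebra_simps)
    also have "\<dots> = s2 - 2 * m * (z * m) + m\<^sup>2 * z"
      unfolding sm[symmetric] by (simp add: sum.distrib sum_subtractf sum_distrib_left[symmetric] s2_def z_def Z_def)
    finally show ?thesis
      using z unfolding var_def m_def[symmetric] z_def[symmetric] by (simp add: field_simps power2_eq_square)
  qed
  ultimately show ?thesis by simp
qed

text \<open>The intermediate point \<open>r\<close> lies between the two parameters, hence in every
  window on which the variance bounds hold uniformly.\<close>

lemma ln_Z_taylor:
  assumes "s \<noteq> t"
  obtains r where "min s t < r" "r < max s t"
    "ln (Z (\<lambda>x. g x + s * D x) n y) = ln (Z (\<lambda>x. g x + t * D x) n y)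
       + (s - t) * mean (\<lambda>x. g x + t * D x) D n y + (s - t)\<^sup>2 / 2 * var (\<lambda>x. g x + r * D x) D n y"
proof -
  define diff where "diff = (\<lambda>k::nat. if k = 0 then (\<lambda>t. ln (Z (\<lambda>x. g x + t * D x) n y))
     else if k = 1 then (\<lambda>t. mean (\<lambda>x. g x + t * D x) D n y) else (\<lambda>t. var (\<lambda>x. g x + t * D x) D n y))"
  have "\<exists>r. (if s < t then s < r \<and> r < t else t < r \<and> r < s) \<and>
      diff 0 s = (\<Sum>m<2::nat. diff m t / fact m * (s - t) ^ m) + diff 2 r / fact 2 * (s - t) ^ 2"
  proof (rule Taylor[where a = "min s t" and b = "max s t"])
    show "\<forall>m u. m < 2 \<and> min s t \<le> u \<and> u \<le> max s t \<longrightarrow> (diff m has_real_derivative diff (Suc m) u) (at u)"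
      by (auto simp: diff_def less_Suc_eq numeral_2_eq_2 intro: ln_Z_has_derivative mean_has_derivative)
  qed (use assms in auto)
  then obtain r where "(if s < t then s < r \<and> r < t else t < r \<and> r < s)"
     "diff 0 s = (\<Sum>m<2::nat. diff m t / fact m * (s - t) ^ m) + diff 2 r / fact 2 * (s - t) ^ 2" by blast
  then show ?thesis
    by (intro that[of r]) (auto split: if_splits simp: diff_def numeral_2_eq_2 mult_ac)
qed

text \<open>The gap is required for every continuation \<open>y\<close> because
  \<open>var_lower\<close> uses it under all boundaries. By bounded distortion, its failure bounds
  all differences of Birkhoff sums.\<close>

definition oscillates :: "((nat \<Rightarrow> 'a) \<Rightarrow> real) \<Rightarrow> bool" where
  "oscillates D \<longleftrightarrow> (\<forall>M. \<exists>l u v. length u = l \<and> length v = l \<and> (\<forall>y. birk D l (u \<frown> y) - birk D l (v \<frown> y) \<ge> M))"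

text \<open>Taylor's formula with variance bounds uniform in \<open>n\<close>, divided by
  \<open>n\<close>. The window \<open>T\<close> keeps the Hoelder constants of
  \<open>g + t D\<close> bounded. The finite-volume inequality is exported as well, because the
  cylinder estimate for Gibbs measures starts from explicit means.\<close>

lemma top_pressure_second_order:
  fixes g D :: "(nat \<Rightarrow> 'a::finite) \<Rightarrow> real"
  assumes g: "holder g" and D: "holder D"
  obtains B \<delta> where "0 \<le> B" "0 \<le> \<delta>" "oscillates D \<Longrightarrow> 0 < \<delta>"
    "\<And>n y s t. \<bar>s\<bar> \<le> T \<Longrightarrow> \<bar>t\<bar> \<le> T \<Longrightarrow> ln (Z (\<lambda>x. g x + s * D x) n y)
        \<le> ln (Z (\<lambda>x. g x + t * D x) n y) + (s - t) * mean (\<lambda>x. g x + t * D x) D n y + real n * (B * (s - t)\<^sup>2)"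
    "\<And>t. \<bar>t\<bar> \<le> T \<Longrightarrow> \<exists>v. \<forall>s. \<bar>s\<bar> \<le> T \<longrightarrow>
        \<delta> * (s - t)\<^sup>2 \<le> top_pressure (\<lambda>x. g x + s * D x) - top_pressure (\<lambda>x. g x + t * D x) - (s - t) * v \<and>
        top_pressure (\<lambda>x. g x + s * D x) - top_pressure (\<lambda>x. g x + t * D x) - (s - t) * v \<le> B * (s - t)\<^sup>2"
proof -
  let ?g = "\<lambda>t x. g x + t * D x"
  obtain C \<theta> where C: "holder_with C \<theta> g" "holder_with C \<theta> D" using holder_common[OF g D] .
  obtain bg where bg: "0 \<le> bg" "\<And>x. \<bar>g x\<bar> \<le> bg" using holder_bounded[OF g] by metis
  obtain b where b: "0 \<le> b" "\<And>x. \<bar>D x\<bar> \<le> b" using holder_bounded[OF D] by metis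
  have C0: "0 \<le> C + \<bar>T\<bar> * C" using holder_withD[OF C(1)] by simp
  have hol: "holder_with (C + \<bar>T\<bar> * C) \<theta> (?g t)" if "\<bar>t\<bar> \<le> T" for t
    using that by (intro holder_with_lin C) auto
  have bound: "\<bar>?g t x\<bar> \<le> bg + \<bar>T\<bar> * b" if "\<bar>t\<bar> \<le> T" for t x
  proof -
    have "\<bar>t * D x\<bar> \<le> \<bar>T\<bar> * b" unfolding abs_mult using that b(2)[of x] by (intro mult_mono) auto
    then show ?thesis using bg(2)[of x] abs_triangle_ineq[of "g x" "t * D x"] by linarith
  qed
  obtain M where M: "0 \<le> M"
    "\<And>(g :: (nat \<Rightarrow> 'a) \<Rightarrow> real) n x y. holder_with (C + \<bar>T\<bar> * C) \<theta> g \<Longrightarrow> \<bar>mean g D n x - mean g D n y\<bar> \<le> M"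
    by (rule mean_oscillation[OF C(2) b(2) C0]) blast+
  define B where "B = (2 * b + M)\<^sup>2 / 2"
  have B: "0 \<le> B" by (simp add: B_def)
  have "\<exists>\<delta> l. 0 \<le> \<delta> \<and> 1 \<le> l \<and> (oscillates D \<longrightarrow> 0 < \<delta>) \<and>
     (\<forall>t k y. \<bar>t\<bar> \<le> T \<longrightarrow> real (k * l) * (2 * \<delta>) \<le> var (?g t) D (k * l) y)"
  proof (cases "oscillates D")
    case False
    then show ?thesis by (intro exI[of _ 0] exI[of _ 1]) (auto simp: var_nonneg)
  next
    case True
    then obtain l u v where uv: "length u = l" "length v = l"
      "\<And>y. birk D l (u \<frown> y) - birk D l (v \<frown> y) \<ge> M + 1"
      unfolding oscillates_def by metis
    have "l \<noteq> 0" using uv M by fastforce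
    then have l: "1 \<le> l" by simp
    define \<delta> where "\<delta> = exp (- (2 * real l * (bg + \<bar>T\<bar> * b) + (C + \<bar>T\<bar> * C) / (1 - \<theta>))) / CARD('a) ^ l"
    have \<delta>: "0 < \<delta>" by (simp add: \<delta>_def)
    \<comment> \<open>Rescales the gain \<open>\<delta> / 2\<close> per block of \<open>l\<close>
      letters to a gain per letter.\<close>
    have "real (k * l) * (2 * (\<delta> / (4 * real l))) \<le> var (?g t) D (k * l) y" if t: "\<bar>t\<bar> \<le> T" for t k y
    proof -
      have "real k * (\<delta> / 2) \<le> var (?g t) D (k * l) y"
      proof (rule var_lower[where u = u and v = v])
        show "\<And>n y w. w \<in> words l \<Longrightarrow> \<delta> \<le> tr (?g t) n l y w"
          unfolding \<delta>_def by (rule tr_lower[OF hol[OF t] bound[OF t]])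
      qed (use M(2)[OF hol[OF t]] uv \<delta> in \<open>auto simp: words_def\<close>)
      then show ?thesis using l by simp
    qed
    then show ?thesis using \<delta> l by (intro exI[of _ "\<delta> / (4 * real l)"] exI[of _ l]) auto
  qed
  then obtain \<delta> l where \<delta>: "0 \<le> \<delta>" "oscillates D \<Longrightarrow> 0 < \<delta>" and l: "1 \<le> l"
    and lower: "\<And>t k y. \<bar>t\<bar> \<le> T \<Longrightarrow> real (k * l) * (2 * \<delta>) \<le> var (?g t) D (k * l) y"
    by blast
  have upper: "var (?g t) D n y \<le> real n * (2 * B)" if "\<bar>t\<bar> \<le> T" for t n y
    using var_upper[OF b(2) M(2)[OF hol[OF that]]] by (simp add: B_def)
  have taylor_le: "ln (Z (?g s) n y) \<le> ln (Z (?g t) n y) + (s - t) * mean (?g t) D n y + real n * (B * (s - t)\<^sup>2)"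
    if st: "\<bar>s\<bar> \<le> T" "\<bar>t\<bar> \<le> T" for s t n y
  proof (cases "s = t")
    case False
    then obtain r where r: "min s t < r" "r < max s t" and
      eq: "ln (Z (?g s) n y) = ln (Z (?g t) n y) + (s - t) * mean (?g t) D n y + (s - t)\<^sup>2 / 2 * var (?g r) D n y"
      by (rule ln_Z_taylor)
    have "(s - t)\<^sup>2 / 2 * var (?g r) D n y \<le> (s - t)\<^sup>2 / 2 * (real n * (2 * B))"
      using r st by (intro mult_left_mono upper) (auto simp: abs_le_iff)
    then show ?thesis unfolding eq by (simp add: mult_ac)
  qed (use B in simp)
  have taylor_ge: "ln (Z (?g t) (k * l) y) + (s - t) * mean (?g t) D (k * l) y + real (k * l) * (\<delta> * (s - t)\<^sup>2) \<le> ln (Z (?g s) (k * l) y)"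
    if st: "\<bar>s\<bar> \<le> T" "\<bar>t\<bar> \<le> T" for s t k y
  proof (cases "s = t")
    case False
    then obtain r where r: "min s t < r" "r < max s t" and
      eq: "ln (Z (?g s) (k * l) y) = ln (Z (?g t) (k * l) y) + (s - t) * mean (?g t) D (k * l) y + (s - t)\<^sup>2 / 2 * var (?g r) D (k * l) y"
      by (rule ln_Z_taylor)
    have "(s - t)\<^sup>2 / 2 * (real (k * l) * (2 * \<delta>)) \<le> (s - t)\<^sup>2 / 2 * var (?g r) D (k * l) y"
      using r st by (intro mult_left_mono lower) (auto simp: abs_le_iff)
    then show ?thesis unfolding eq by (simp add: mult_ac)
  qed simp
  show thesis
  proof (rule that[OF B \<delta>(1) \<delta>(2) taylor_le])
    fix t assume t: "\<bar>t\<bar> \<le> T"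
    define y where "y = (undefined :: nat \<Rightarrow> 'a)"
    \<comment> \<open>The lower variance bound is available at multiples of \<open>l\<close> only,
      and \<open>Suc\<close> keeps the length positive. A limit point of the normalised means
      suffices: the quadratic bounds later identify it as the derivative.\<close>
    define v where "v = (\<lambda>k. mean (?g t) D (Suc k * l) y / real (Suc k * l))"
    have "\<bar>v k\<bar> \<le> b" for k
    proof -
      have pos: "0 < real (Suc k * l)" using l by (subst of_nat_0_less_iff) simp
      show ?thesis
        using mean_bound[of D b "?g t" "Suc k * l" y, OF b(2)]
        unfolding v_def abs_divide abs_of_nat pos_divide_le_eq[OF pos] by (simp only: mult.commute)
    qed
    then have "bounded (range v)" by (auto simp: bounded_iff intro!: exI[of _ b])
    then obtain v0 r where r: "strict_mono r" and v0: "(v \<circ> r) \<longlonglongrightarrow> v0"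
      using bounded_imp_convergent_subsequence by blast
    have sub: "strict_mono (\<lambda>k. Suc (r k) * l)"
      using r l by (auto simp: strict_mono_def)
    have P: "(\<lambda>k. ln (Z (?g s) (Suc (r k) * l) y) / real (Suc (r k) * l)) \<longlonglongrightarrow> top_pressure (?g s)" for s
      using LIMSEQ_subseq_LIMSEQ[OF top_pressure_LIMSEQ[OF holder_lin[OF g D], of s y] sub] by (simp add: o_def)
    have lim: "(\<lambda>k. ln (Z (?g s) (Suc (r k) * l) y) / real (Suc (r k) * l) - ln (Z (?g t) (Suc (r k) * l) y) / real (Suc (r k) * l)
         - (s - t) * (v \<circ> r) k) \<longlonglongrightarrow> top_pressure (?g s) - top_pressure (?g t) - (s - t) * v0" for s
      by (intro tendsto_diff P tendsto_mult_left v0)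
    show "\<exists>v. \<forall>s. \<bar>s\<bar> \<le> T \<longrightarrow>
        \<delta> * (s - t)\<^sup>2 \<le> top_pressure (?g s) - top_pressure (?g t) - (s - t) * v \<and>
        top_pressure (?g s) - top_pressure (?g t) - (s - t) * v \<le> B * (s - t)\<^sup>2"
    proof (intro exI allI impI conjI)
      fix s assume s: "\<bar>s\<bar> \<le> T"
      have eq: "ln (Z (?g s) (Suc (r k) * l) y) / real (Suc (r k) * l) - ln (Z (?g t) (Suc (r k) * l) y) / real (Suc (r k) * l)
         - (s - t) * (v \<circ> r) k =
         (ln (Z (?g s) (Suc (r k) * l) y) - ln (Z (?g t) (Suc (r k) * l) y) - (s - t) * mean (?g t) D (Suc (r k) * l) y) / real (Suc (r k) * l)" for k
        by (simp only: v_def o_def diff_divide_distrib times_divide_eq_right)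
      have pos: "0 < real (Suc (r k) * l)" for k using l by (subst of_nat_0_less_iff) simp
      show "\<delta> * (s - t)\<^sup>2 \<le> top_pressure (?g s) - top_pressure (?g t) - (s - t) * v0"
      proof (rule LIMSEQ_le_const[OF lim], intro exI allI impI)
        fix k
        show "\<delta> * (s - t)\<^sup>2 \<le> ln (Z (?g s) (Suc (r k) * l) y) / real (Suc (r k) * l) - ln (Z (?g t) (Suc (r k) * l) y) / real (Suc (r k) * l)
         - (s - t) * (v \<circ> r) k"
          unfolding eq pos_le_divide_eq[OF pos] using taylor_ge[OF s t, of "Suc (r k)" y] by (simp only: mult.commute; linarith)
      qed
      show "top_pressure (?g s) - top_pressure (?g t) - (s - t) * v0 \<le> B * (s - t)\<^sup>2"
      proof (rule LIMSEQ_le_const2[OF lim], intro exI allI impI)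
        fix k
        show "ln (Z (?g s) (Suc (r k) * l) y) / real (Suc (r k) * l) - ln (Z (?g t) (Suc (r k) * l) y) / real (Suc (r k) * l)
         - (s - t) * (v \<circ> r) k \<le> B * (s - t)\<^sup>2"
          unfolding eq pos_divide_le_eq[OF pos] using taylor_le[OF s t, of "Suc (r k) * l" y] by (simp only: mult.commute; linarith)
      qed
    qed
  qed
qed

section \<open>Entropy of invariant measures\<close>

lemma space_shift_space [simp]: "space shift_space = UNIV"
  by (simp add: shift_space_def space_PiM)

lemma invariant_probD:
  assumes "invariant_prob M"
  shows "sets M = sets shift_space" "prob_space M" "space M = UNIV"
    "A \<in> sets shift_space \<Longrightarrow> measure M (shift -` A) = measure M A"
  using assms sets_eq_imp_space_eq[of M shift_space] by (auto simp: invariant_prob_def)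

lemma measurable_coordinate [measurable]: "(\<lambda>x. x k) \<in> measurable shift_space (count_space UNIV)"
  unfolding shift_space_def by (rule measurable_component_singleton) simp

lemma measurable_shift [measurable]: "shift \<in> measurable shift_space shift_space"
proof -
  have "(\<lambda>x. shift x k) \<in> measurable shift_space (count_space UNIV)" for k
    unfolding shift_def by (rule measurable_coordinate)
  then show ?thesis
    by (subst (2) shift_space_def) (rule measurable_PiM_single', auto)
qed

lemma measurable_shift_funpow [measurable]: "(shift ^^ k) \<in> measurable shift_space shift_space"
  by (induction k) auto

lemma UNIV_in_shift_space [simp]: "UNIV \<in> sets shift_space"
  using sets.top[of shift_space] by simp

lemma sets_pref: "{x. pref n x = (w :: 'a::finite list)} \<in> sets shift_space"
proof (cases "length w = n")
  case True
  then have "{x. pref n x = w} = (\<Inter>k\<in>{..<n}. (\<lambda>x. x k) -` {w ! k} \<inter> space shift_space) \<inter> space shift_space"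
    by (auto simp: list_eq_iff_nth_eq)
  also have "\<dots> \<in> sets shift_space"
    using measurable_sets[OF measurable_coordinate] by (intro sets.Int sets.countable_INT'') auto
  finally show ?thesis .
next
  case False
  then have "{x. pref n x = w} = {}" by auto
  then show ?thesis by simp
qed

lemma measurable_pref [measurable]: "pref n \<in> measurable shift_space (count_space (UNIV :: 'a::finite list set))"
  by (rule measurable_compose_countable') (auto simp: sets_pref measurable_count_space_eq_countable vimage_def)

lemma borel_measurable_pref: "(\<lambda>x. F (pref n x) :: real) \<in> borel_measurable (shift_space :: (nat \<Rightarrow> 'a::finite) measure)"
  by (rule measurable_compose[OF measurable_pref]) simp

text \<open>A pointwise limit of functions of finitely many letters, with the tail frozen at
  \<open>undefined\<close>.\<close>

lemma holder_measurable:
  fixes g :: "(nat \<Rightarrow> 'a::finite) \<Rightarrow> real"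
  assumes "holder g" shows "g \<in> borel_measurable shift_space"
proof -
  obtain C \<theta> where h: "holder_with C \<theta> g" using assms unfolding holder_iff by auto
  note D = holder_withD[OF h]
  show ?thesis
  proof (rule borel_measurable_LIMSEQ_real)
    fix x :: "nat \<Rightarrow> 'a"
    have "(\<lambda>n. g (pref n x \<frown> undefined) - g x) \<longlonglongrightarrow> 0"
    proof (rule Lim_null_comparison)
      have "agree n (pref n x \<frown> undefined) x" for n by (auto simp: agree_def conc_def)
      then show "\<forall>\<^sub>F n in sequentially. norm (g (pref n x \<frown> undefined) - g x) \<le> C * \<theta> ^ n"
        using D(4) by auto
      show "(\<lambda>n. C * \<theta> ^ n) \<longlonglongrightarrow> 0"
        using D by (intro tendsto_mult_right_zero LIMSEQ_realpow_zero) auto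
    qed
    then show "(\<lambda>n. g (pref n x \<frown> undefined)) \<longlonglongrightarrow> g x" by (simp add: LIM_zero_iff)
  qed (rule borel_measurable_pref)
qed

lemma integrable_bounded:
  assumes "invariant_prob M" "F \<in> borel_measurable shift_space" "\<And>x. \<bar>F x\<bar> \<le> (b::real)"
  shows "integrable M F"
proof -
  interpret prob_space M using invariant_probD[OF assms(1)] by simp
  show ?thesis
    using assms invariant_probD(1)[OF assms(1)]
    by (intro integrable_const_bound[where B = b]) (auto cong: measurable_cong_sets)
qed

lemma integrable_holder:
  fixes g :: "(nat \<Rightarrow> 'a::finite) \<Rightarrow> real"
  assumes "invariant_prob M" "holder g" shows "integrable M g"
proof -
  obtain b where "\<And>x. \<bar>g x\<bar> \<le> b" using holder_bounded[OF assms(2)] by metis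
  then show ?thesis by (intro integrable_bounded[OF assms(1) holder_measurable[OF assms(2)]])
qed

lemma distr_shift:
  assumes "invariant_prob M" shows "distr M shift_space shift = M"
proof (rule measure_eqI)
  note I = invariant_probD[OF assms]
  interpret prob_space M by (rule I)
  have sh: "shift \<in> measurable M shift_space"
    using measurable_shift I(1) by (simp cong: measurable_cong_sets)
  show "sets (distr M shift_space shift) = sets M" using I by simp
  fix A assume A: "A \<in> sets (distr M shift_space shift)"
  then have "emeasure (distr M shift_space shift) A = emeasure M (shift -` A)"
    using sh I(3) by (subst emeasure_distr) auto
  then show "emeasure (distr M shift_space shift) A = emeasure M A"
    using A I(4)[of A] by (simp add: emeasure_eq_measure)
qed

lemma integral_shift:
  assumes "invariant_prob M" "F \<in> borel_measurable shift_space"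
  shows "(\<integral>x. F ((shift ^^ k) x) \<partial>M) = (\<integral>x. (F x :: real) \<partial>M)"
proof (induction k)
  case (Suc k)
  have sh: "shift \<in> measurable M shift_space"
    using measurable_shift invariant_probD(1)[OF assms(1)] by (simp cong: measurable_cong_sets)
  have "(\<integral>x. F ((shift ^^ Suc k) x) \<partial>M) = (\<integral>x. F ((shift ^^ k) (shift x)) \<partial>M)"
    by (simp add: funpow_swap1)
  also have "\<dots> = (\<integral>x. F ((shift ^^ k) x) \<partial>distr M shift_space shift)"
    by (subst integral_distr[OF sh]) (use assms(2) in measurable)
  finally show ?case using Suc distr_shift[OF assms(1)] by simp
qed simp

lemma integrable_birk:
  fixes g :: "(nat \<Rightarrow> 'a::finite) \<Rightarrow> real"
  assumes "invariant_prob M" "holder g"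
  shows "integrable M (birk g n)"
proof -
  obtain b where b: "\<And>x. \<bar>g x\<bar> \<le> b" using holder_bounded[OF assms(2)] by metis
  have "integrable M (\<lambda>x. g ((shift ^^ k) x))" for k
    using b by (intro integrable_bounded[OF assms(1)] measurable_compose[OF measurable_shift_funpow] holder_measurable assms) auto
  then show ?thesis unfolding birk_def[abs_def] by (intro Bochner_Integration.integrable_sum)
qed

lemma integral_birk:
  fixes g :: "(nat \<Rightarrow> 'a::finite) \<Rightarrow> real"
  assumes "invariant_prob M" "holder g"
  shows "(\<integral>x. birk g n x \<partial>M) = real n * (\<integral>x. g x \<partial>M)"
proof -
  obtain b where b: "\<And>x. \<bar>g x\<bar> \<le> b" using holder_bounded[OF assms(2)] by metis
  have "integrable M (\<lambda>x. g ((shift ^^ k) x))" for k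
    using b by (intro integrable_bounded[OF assms(1)] measurable_compose[OF measurable_shift_funpow] holder_measurable assms) auto
  then have "(\<integral>x. birk g n x \<partial>M) = (\<Sum>k<n. \<integral>x. g ((shift ^^ k) x) \<partial>M)"
    unfolding birk_def by (rule Bochner_Integration.integral_sum)
  then show ?thesis by (simp add: integral_shift[OF assms(1) holder_measurable[OF assms(2)]])
qed

text \<open>Turns the sums in \<open>part_entropy\<close> into integrals, where invariance applies
  and where the same quantity can be read off a finer map.\<close>

lemma integral_finite_range:
  fixes F :: "'v \<Rightarrow> real"
  assumes M: "prob_space M" "space M = UNIV" and X: "X \<in> measurable M (count_space UNIV)" "finite (range X)"
  shows "(\<integral>x. F (X x) \<partial>M) = (\<Sum>v\<in>range X. measure M (X -` {v}) * F v)"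
proof -
  interpret prob_space M by fact
  have s: "X -` {v} \<in> sets M" for v using measurable_sets[OF X(1), of "{v}"] M(2) by simp
  have "(\<lambda>x. F (X x)) = (\<lambda>x. \<Sum>v\<in>range X. indicator (X -` {v}) x * F v)"
  proof
    fix x
    have "(\<Sum>v\<in>range X. indicator (X -` {v}) x * F v) = (\<Sum>v\<in>range X. if v = X x then F v else 0)"
      by (intro sum.cong) (auto simp: indicator_def)
    then show "F (X x) = (\<Sum>v\<in>range X. indicator (X -` {v}) x * F v)" using X(2) by (simp add: sum.delta)
  qed
  moreover have "(\<integral>x. (\<Sum>v\<in>range X. indicator (X -` {v}) x * F v) \<partial>M) = (\<Sum>v\<in>range X. \<integral>x. indicator (X -` {v}) x * F v \<partial>M)"
    using s by (intro Bochner_Integration.integral_sum integrable_mult_left integrable_real_indicator) (auto simp: emeasure_eq_measure)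
  ultimately show ?thesis using s by simp
qed

section \<open>Entropy of finite-valued maps and Gibbs' inequality\<close>

lemma part_entropy_UNIV:
  "space M = UNIV \<Longrightarrow> part_entropy M X = - (\<Sum>v\<in>range X. measure M (X -` {v}) * ln (measure M (X -` {v})))"
  by (simp add: part_entropy_def)

lemma part_entropy_nonneg:
  assumes "prob_space M" "space M = UNIV" "finite (range X)"
  shows "0 \<le> part_entropy M X"
proof -
  interpret prob_space M by fact
  have "0 \<le> - (p * ln p)" if "0 \<le> p" "p \<le> 1" for p :: real
    using that by (cases "p = 0") (auto simp: mult_le_0_iff)
  then have "0 \<le> (\<Sum>v\<in>range X. - (measure M (X -` {v}) * ln (measure M (X -` {v}))))"
    by (intro sum_nonneg) auto
  then show ?thesis using assms by (simp add: part_entropy_UNIV sum_negf)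
qed

text \<open>Gibbs' inequality, from \<open>ln x \<le> x - 1\<close>. A subprobability
  \<open>q\<close> is enough, so reference weights may also charge symbols that \<open>X\<close>
  never takes.\<close>

lemma part_entropy_le_cross:
  assumes M: "prob_space M" "space M = UNIV" and X: "X \<in> measurable M (count_space UNIV)" "finite (range X)"
    and q: "\<And>v. 0 \<le> q v" "\<And>v. 0 < measure M (X -` {v}) \<Longrightarrow> 0 < q v" "(\<Sum>v\<in>range X. q v) \<le> 1"
  shows "part_entropy M X \<le> - (\<Sum>v\<in>range X. measure M (X -` {v}) * ln (q v))"
proof -
  interpret prob_space M by fact
  let ?p = "\<lambda>v. measure M (X -` {v})"
  have "?p v * ln (q v) - ?p v * ln (?p v) \<le> q v - ?p v" for v
  proof (cases "?p v = 0")
    case False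
    then have p: "0 < ?p v" by (simp add: zero_less_measure_iff)
    have "ln (q v / ?p v) \<le> q v / ?p v - 1" using p q(2)[OF p] by (intro ln_le_minus_one) auto
    then have "?p v * ln (q v / ?p v) \<le> ?p v * (q v / ?p v - 1)" using p by (intro mult_left_mono) auto
    then show ?thesis using p q(2)[OF p] by (simp add: ln_div algebra_simps)
  qed (use q in simp)
  then have "(\<Sum>v\<in>range X. ?p v * ln (q v) - ?p v * ln (?p v)) \<le> (\<Sum>v\<in>range X. q v - ?p v)"
    by (rule sum_mono)
  moreover have "(\<Sum>v\<in>range X. ?p v) = 1"
    using integral_finite_range[OF M X, of "\<lambda>_. 1"] by (simp add: prob_space M(2)[symmetric])
  ultimately show ?thesis using q(3) M(2) by (simp add: part_entropy_UNIV sum_subtractf)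
qed

text \<open>Each joint cell lies in a cell of \<open>X\<close>, so its logarithm is smaller.\<close>

lemma part_entropy_pair_mono:
  fixes X :: "'x \<Rightarrow> 'v" and W :: "'x \<Rightarrow> 'w"
  assumes M: "prob_space M" "space M = UNIV" and X: "X \<in> measurable M (count_space UNIV)" "finite (range X)"
    and XW: "(\<lambda>x. (X x, W x)) \<in> measurable M (count_space UNIV)" "finite (range (\<lambda>x. (X x, W x)))"
  shows "part_entropy M X \<le> part_entropy M (\<lambda>x. (X x, W x))"
proof -
  interpret prob_space M by fact
  let ?Y = "\<lambda>x. (X x, W x)"
  have "(\<Sum>v\<in>range X. measure M (X -` {v}) * ln (measure M (X -` {v}))) =
      (\<Sum>v\<in>range ?Y. measure M (?Y -` {v}) * ln (measure M (X -` {fst v})))"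
    using integral_finite_range[OF M X, of "\<lambda>v. ln (measure M (X -` {v}))"]
      integral_finite_range[OF M XW, of "\<lambda>v. ln (measure M (X -` {fst v}))"] by simp
  also have "\<dots> \<ge> (\<Sum>v\<in>range ?Y. measure M (?Y -` {v}) * ln (measure M (?Y -` {v})))"
  proof (rule sum_mono)
    fix v :: "'v \<times> 'w"
    have s: "X -` {fst v} \<in> sets M" using measurable_sets[OF X(1), of "{fst v}"] M(2) by simp
    have "measure M (?Y -` {v}) \<le> measure M (X -` {fst v})"
      by (rule finite_measure_mono[OF _ s]) auto
    then show "measure M (?Y -` {v}) * ln (measure M (?Y -` {v})) \<le> measure M (?Y -` {v}) * ln (measure M (X -` {fst v}))"
      by (cases "measure M (?Y -` {v}) = 0") (auto intro!: mult_left_mono simp: zero_less_measure_iff ln_mono)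
  qed
  finally show ?thesis using M(2) by (simp add: part_entropy_UNIV)
qed

section \<open>Approximation of measurable sets by cylinder events\<close>

lemma sets_shift_space:
  "sets (shift_space :: (nat \<Rightarrow> 'a) measure) = sigma_sets UNIV (\<Union>k. range (\<lambda>B. (\<lambda>x. x k) -` B))"
proof -
  have "sets (shift_space :: (nat \<Rightarrow> 'a) measure) = sigma_sets UNIV {{f\<in>UNIV. f i \<in> A} | i A. i \<in> UNIV \<and> A \<in> UNIV}"
    unfolding shift_space_def by (subst sets_PiM_single) simp
  also have "{{f\<in>UNIV. f i \<in> A} | i A. i \<in> UNIV \<and> A \<in> UNIV} = (\<Union>k. range (\<lambda>B. (\<lambda>x :: nat \<Rightarrow> 'a. x k) -` B))"
    by (auto simp: vimage_def)
  finally show ?thesis .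
qed

text \<open>The sets approximable by finitely many letters form a sigma-algebra containing the
  generators. For countable unions, continuity of the measure cuts the union to \<open>n\<close>
  members, among which the remaining error is split.\<close>

lemma approx_by_cylinders:
  fixes A :: "(nat \<Rightarrow> 'a::finite) set"
  assumes M: "invariant_prob M" and A: "A \<in> sets shift_space" and e: "0 < e"
  shows "\<exists>N Q. measure M {x. (x \<in> A) \<noteq> Q (pref N x)} < e"
proof -
  note I = invariant_probD[OF M]
  interpret prob_space M by (rule I)
  have Qs [measurable]: "{x. Q (pref N x)} \<in> sets shift_space" for Q :: "'a list \<Rightarrow> bool" and N
    using measurable_sets[OF measurable_pref, of "Collect Q" N] by (simp add: vimage_def)
  have dm: "{x. (x \<in> A) \<noteq> Q (pref N x)} \<in> sets M" if "A \<in> sets shift_space" for A and Q :: "'a list \<Rightarrow> bool" and N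
  proof -
    have "{x. (x \<in> A) \<noteq> Q (pref N x)} = (A - {x. Q (pref N x)}) \<union> ({x. Q (pref N x)} - A)" by auto
    then show ?thesis using that Qs[of Q N] I(1) by auto
  qed
  have pref_take: "pref N x = take N (pref N' x)" if "N \<le> N'" for N N' and x :: "nat \<Rightarrow> 'a"
    using that by (simp add: list_eq_iff_nth_eq)
  define G where "G = (\<Union>k. range (\<lambda>B. (\<lambda>x :: nat \<Rightarrow> 'a. x k) -` B))"
  note gen = sets_shift_space[where 'a = 'a, folded G_def]
  have "A \<in> sigma_sets UNIV G" using A gen by simp
  then have "\<forall>e>0. \<exists>N Q. measure M {x. (x \<in> A) \<noteq> Q (pref N x)} < e"
  proof (induction rule: sigma_sets.induct)
    case (Basic A)
    then obtain k B where A: "A = (\<lambda>x. x k) -` B" by (auto simp: G_def)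
    have "{x. (x \<in> A) \<noteq> (pref (Suc k) x ! k \<in> B)} = {}" by (auto simp: A)
    then have "measure M {x. (x \<in> A) \<noteq> (pref (Suc k) x ! k \<in> B)} = 0" by (metis measure_empty)
    then show ?case by (intro allI impI exI[of _ "Suc k"] exI[of _ "\<lambda>w. w ! k \<in> B"]) auto
  next
    case Empty
    show ?case by (intro allI impI exI[of _ 0] exI[of _ "\<lambda>_. False"]) auto
  next
    case (Compl A)
    show ?case
    proof (intro allI impI)
      fix e :: real assume "0 < e"
      then obtain N Q where "measure M {x. (x \<in> A) \<noteq> Q (pref N x)} < e" using Compl by blast
      moreover have "{x. (x \<in> UNIV - A) \<noteq> (\<not> Q (pref N x))} = {x. (x \<in> A) \<noteq> Q (pref N x)}" by auto
      ultimately show "\<exists>N Q. measure M {x. (x \<in> UNIV - A) \<noteq> Q (pref N x)} < e"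
        by (intro exI[of _ N] exI[of _ "\<lambda>w. \<not> Q w"]) simp
    qed
  next
    case (Union A)
    then have As: "A i \<in> sets shift_space" for i using gen by blast
    show ?case
    proof (intro allI impI)
      fix e :: real assume e: "0 < e"
      define U where "U = (\<lambda>n. \<Union>i<n. A i)"
      have Us: "U n \<in> sets shift_space" for n using As by (auto simp: U_def)
      have "(\<lambda>n. measure M (U n)) \<longlonglongrightarrow> measure M (\<Union>n. U n)"
      proof (rule finite_Lim_measure_incseq)
        show "range U \<subseteq> sets M" using Us I(1) by auto
        show "incseq U" by (rule incseq_SucI) (auto simp: U_def intro: less_SucI)
      qed
      moreover have UU: "(\<Union>n. U n) = (\<Union>i. A i)" by (auto simp: U_def)
      ultimately obtain n where "\<bar>measure M (U n) - measure M (\<Union>i. A i)\<bar> < e / 2"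
        using LIMSEQ_D[of "\<lambda>n. measure M (U n)" "measure M (\<Union>i. A i)" "e/2"] e by auto
      moreover have "measure M ((\<Union>i. A i) - U n) = measure M (\<Union>i. A i) - measure M (U n)"
        using As Us I(1) by (intro finite_measure_Diff) (auto simp: U_def)
      ultimately have n: "measure M ((\<Union>i. A i) - U n) < e / 2" unfolding abs_less_iff by linarith
      \<comment> \<open>\<open>Suc n\<close> in place of \<open>n\<close> avoids division by
        zero.\<close>
      have "\<forall>i. \<exists>N Q. measure M {x. (x \<in> A i) \<noteq> Q (pref N x)} < e / (2 * real (Suc n))"
        using Union e by (simp add: divide_pos_pos)
      then obtain N Q where NQ: "\<And>i. measure M {x. (x \<in> A i) \<noteq> Q i (pref (N i) x)} < e / (2 * real (Suc n))"
        by metis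
      define N' where "N' = (\<Sum>i<n. N i)"
      have NN: "N i \<le> N'" if "i < n" for i using that by (auto simp: N'_def intro: member_le_sum)
      define Q' where "Q' = (\<lambda>w. \<exists>i<n. Q i (take (N i) w))"
      let ?E = "\<lambda>i. {x. (x \<in> A i) \<noteq> Q i (pref (N i) x)}"
      have Es: "?E i \<in> sets M" for i by (rule dm[OF As])
      have "{x. (x \<in> (\<Union>i. A i)) \<noteq> Q' (pref N' x)} \<subseteq> ((\<Union>i. A i) - U n) \<union> (\<Union>i<n. ?E i)"
      proof
        fix x assume x: "x \<in> {x. (x \<in> (\<Union>i. A i)) \<noteq> Q' (pref N' x)}"
        have "Q' (pref N' x) \<longleftrightarrow> (\<exists>i<n. Q i (pref (N i) x))"
          unfolding Q'_def using NN pref_take[of _ N' x] by (metis)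
        then show "x \<in> ((\<Union>i. A i) - U n) \<union> (\<Union>i<n. ?E i)" using x by (auto simp: U_def)
      qed
      then have "measure M {x. (x \<in> (\<Union>i. A i)) \<noteq> Q' (pref N' x)} \<le> measure M (((\<Union>i. A i) - U n) \<union> (\<Union>i<n. ?E i))"
        using As Us Es I(1) by (intro finite_measure_mono) auto
      also have "\<dots> \<le> measure M ((\<Union>i. A i) - U n) + measure M (\<Union>i<n. ?E i)"
        using As Us Es I(1) by (intro measure_Un_le) auto
      also have "measure M (\<Union>i<n. ?E i) \<le> (\<Sum>i<n. measure M (?E i))"
        using Es by (intro measure_UNION_le) auto
      also have "\<dots> \<le> (\<Sum>i<n. e / (2 * real (Suc n)))" using NQ by (intro sum_mono) (auto intro: less_imp_le)
      also have "\<dots> \<le> e / 2" using e by (simp add: field_simps)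
      finally show "\<exists>N Q. measure M {x. (x \<in> (\<Union>i. A i)) \<noteq> Q (pref N x)} < e"
        using n by (intro exI[of _ N'] exI[of _ Q']) linarith
    qed
  qed
  then show ?thesis using e by blast
qed

text \<open>Total mass of a product of kernels, one for each position; it is applied to kernels of
  mass one.\<close>

lemma sum_prod_words:
  fixes r :: "nat \<Rightarrow> 's \<Rightarrow> real"
  assumes "finite S"
  shows "(\<Sum>v\<in>{v. set v \<subseteq> S \<and> length v = n}. \<Prod>k<n. r k (v ! k)) = (\<Prod>k<n. \<Sum>s\<in>S. r k s)"
proof (induction n arbitrary: r)
  case 0
  have "{v. set v \<subseteq> S \<and> length v = 0} = {[]}" by auto
  then show ?case by simp
next
  case (Suc n)
  have "(\<Sum>v\<in>{v. set v \<subseteq> S \<and> length v = Suc n}. \<Prod>k<Suc n. r k (v ! k)) =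
     (\<Sum>(s, v)\<in>S \<times> {v. set v \<subseteq> S \<and> length v = n}. r 0 s * (\<Prod>k<n. r (Suc k) (v ! k)))"
    by (rule sum.reindex_bij_witness[where i = "\<lambda>(s, v). s # v" and j = "\<lambda>v. (hd v, tl v)"])
      (auto simp: length_Suc_conv prod.lessThan_Suc_shift simp del: prod.lessThan_Suc)
  also have "\<dots> = (\<Sum>s\<in>S. r 0 s) * (\<Prod>k<n. \<Sum>s\<in>S. r (Suc k) s)"
    by (simp add: sum.cartesian_product[symmetric] sum_distrib_left[symmetric] sum_distrib_right[symmetric] Suc[of "\<lambda>k. r (Suc k)"])
  finally show ?case by (simp add: prod.lessThan_Suc_shift del: prod.lessThan_Suc)
qed

section \<open>Itineraries and entropy rates\<close>

definition itinerary :: "((nat \<Rightarrow> 'a) \<Rightarrow> 'b) \<Rightarrow> nat \<Rightarrow> (nat \<Rightarrow> 'a) \<Rightarrow> 'b list" where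
  "itinerary \<xi> n x = map (\<lambda>k. \<xi> ((shift ^^ k) x)) [0..<n]"

lemma range_itinerary: "range (itinerary \<xi> n) \<subseteq> {v. set v \<subseteq> range \<xi> \<and> length v = n}"
  by (auto simp: itinerary_def)

lemma finite_range_itinerary: "finite (range \<xi>) \<Longrightarrow> finite (range (itinerary \<xi> n))"
  by (rule finite_subset[OF range_itinerary finite_lists_length_eq])

lemma nth_itinerary [simp]: "k < n \<Longrightarrow> itinerary \<xi> n x ! k = \<xi> ((shift ^^ k) x)"
  by (simp add: itinerary_def)

lemma length_itinerary [simp]: "length (itinerary \<xi> n x) = n"
  by (simp add: itinerary_def)

lemma itinerary_add: "itinerary \<xi> (m + n) x = itinerary \<xi> m x @ itinerary \<xi> n ((shift ^^ m) x)"
  by (auto simp: list_eq_iff_nth_eq nth_append shift_funpow add.commute add.left_commute)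

lemma measurable_itinerary:
  fixes \<xi> :: "(nat \<Rightarrow> 'a) \<Rightarrow> 'b"
  assumes \<xi>: "\<xi> \<in> measurable shift_space (count_space UNIV)" "finite (range \<xi>)"
  shows "itinerary \<xi> n \<in> measurable shift_space (count_space UNIV)"
proof -
  have "itinerary \<xi> n -` {v} \<in> sets shift_space" for v
  proof (cases "length v = n")
    case True
    have "\<xi> \<circ> (shift ^^ k) \<in> measurable shift_space (count_space UNIV)" for k
      using \<xi>(1) by (intro measurable_comp[OF measurable_shift_funpow])
    then have *: "(\<xi> \<circ> (shift ^^ k)) -` {v ! k} \<in> sets shift_space" for k
      using measurable_sets[of "\<xi> \<circ> (shift ^^ k)" shift_space "count_space UNIV" "{v ! k}"] by simp
    have "itinerary \<xi> n -` {v} = (\<Inter>k\<in>{..<n}. (\<xi> \<circ> (shift ^^ k)) -` {v ! k})"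
      using True by (auto simp: list_eq_iff_nth_eq)
    also have "\<dots> \<in> sets shift_space" by (intro sets.countable_INT'' *) auto
    finally show ?thesis .
  next
    case False
    then have "itinerary \<xi> n -` {v} = {}" by auto
    then show ?thesis by simp
  qed
  then have *: "itinerary \<xi> n -` V \<in> sets shift_space" if "finite V" for V
    using that by (subst UN_singleton[of V, symmetric], subst vimage_UN) (intro sets.finite_UN, auto)
  show ?thesis
  proof (rule measurableI)
    fix A
    have "itinerary \<xi> n -` A = itinerary \<xi> n -` (A \<inter> range (itinerary \<xi> n))" by auto
    also have "\<dots> \<in> sets shift_space" using finite_range_itinerary[OF \<xi>(2), of n] by (intro *) auto
    finally show "itinerary \<xi> n -` A \<inter> space shift_space \<in> sets shift_space" by simp
  qed simp
qed

text \<open>\<open>ks_entropy\<close> is written with \<open>lim\<close>, so convergence must be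
  known first. Subadditivity is Gibbs' inequality against the product of the laws of the first
  \<open>m\<close> and the last \<open>n\<close> symbols; by invariance the latter is the law of
  \<open>itinerary \<xi> n\<close>.\<close>

lemma entropy_rate_convergent:
  assumes M: "invariant_prob M" and \<xi>: "\<xi> \<in> measurable shift_space (count_space UNIV)" "finite (range \<xi>)"
  shows "convergent (\<lambda>n. part_entropy M (itinerary \<xi> n) / real n)"
proof (rule subadditive_LIMSEQ)
  note I = invariant_probD[OF M]
  interpret prob_space M by (rule I)
  fix m n
  let ?X = "itinerary \<xi>"
  have X: "?X k \<in> measurable M (count_space UNIV)" "finite (range (?X k))" for k
    using measurable_itinerary[OF \<xi>, of k] finite_range_itinerary[OF \<xi>(2)] I(1) by (simp_all cong: measurable_cong_sets)
  have vs: "?X k -` V \<in> sets M" for k V using measurable_sets[OF X(1)[of k], of V] I(3) by simp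
  let ?p = "\<lambda>k v. measure M (?X k -` {v})"
  define q where "q = (\<lambda>v. ?p m (take m v) * ?p n (drop m v))"
  have p1: "(\<Sum>v\<in>range (?X k). ?p k v) = 1" for k
    using integral_finite_range[OF I(2,3) X[of k], of "\<lambda>_. 1"] by (simp add: prob_space I(3)[symmetric])
  have pos: "0 < ?p m (take m v) \<and> 0 < ?p n (drop m v)" if v: "0 < ?p (m + n) v" for v
  proof
    have "?p (m + n) v \<le> ?p m (take m v)"
      by (rule finite_measure_mono[OF _ vs]) (auto simp: itinerary_add)
    then show "0 < ?p m (take m v)" using v by linarith
    have "?p (m + n) v \<le> measure M ((shift ^^ m) -` (?X n -` {drop m v}))"
    proof (rule finite_measure_mono)
      have "(shift ^^ m) -` (?X n -` {drop m v}) \<inter> space shift_space \<in> sets shift_space"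
        by (rule measurable_sets[OF measurable_shift_funpow]) (use vs[of n] I(1) in simp)
      then show "(shift ^^ m) -` (?X n -` {drop m v}) \<in> sets M" using I(1) by simp
    qed (auto simp: itinerary_add)
    also have "\<dots> = ?p n (drop m v)"
    proof -
      have s: "?X n -` {drop m v} \<in> sets shift_space" using vs I(1) by simp
      have "(\<integral>x. indicator (?X n -` {drop m v}) ((shift ^^ m) x) \<partial>M) = (\<integral>x. indicator (?X n -` {drop m v}) x \<partial>M :: real)"
        by (rule integral_shift[OF M]) (use s in measurable)
      moreover have "(\<lambda>x. indicator (?X n -` {drop m v}) ((shift ^^ m) x) :: real) = indicator ((shift ^^ m) -` (?X n -` {drop m v}))"
        by (auto simp: indicator_def)
      ultimately show ?thesis using I(3) by simp
    qed
    finally show "0 < ?p n (drop m v)" using v by linarith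
  qed
  have "part_entropy M (?X (m + n)) \<le> - (\<Sum>v\<in>range (?X (m + n)). ?p (m + n) v * ln (q v))"
  proof (rule part_entropy_le_cross[OF I(2,3) X])
    have "(\<Sum>v\<in>range (?X (m + n)). q v) \<le> (\<Sum>v\<in>(\<lambda>(a, b). a @ b) ` (range (?X m) \<times> range (?X n)). q v)"
      using X(2) by (intro sum_mono2) (auto simp: q_def itinerary_add)
    also have "\<dots> = (\<Sum>(a, b)\<in>range (?X m) \<times> range (?X n). ?p m a * ?p n b)"
      by (subst sum.reindex) (auto simp: inj_on_def q_def intro!: sum.cong)
    also have "\<dots> = 1"
      by (simp add: sum.cartesian_product[symmetric] sum_distrib_left[symmetric] p1)
    finally show "(\<Sum>v\<in>range (?X (m + n)). q v) \<le> 1" .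
  qed (use pos in \<open>auto simp: q_def\<close>)
  also have "(\<Sum>v\<in>range (?X (m + n)). ?p (m + n) v * ln (q v)) =
     (\<Sum>v\<in>range (?X (m + n)). ?p (m + n) v * ln (?p m (take m v))) +
     (\<Sum>v\<in>range (?X (m + n)). ?p (m + n) v * ln (?p n (drop m v)))"
    unfolding sum.distrib[symmetric]
  proof (intro sum.cong refl)
    fix v
    show "?p (m + n) v * ln (q v) = ?p (m + n) v * ln (?p m (take m v)) + ?p (m + n) v * ln (?p n (drop m v))"
    proof (cases "?p (m + n) v = 0")
      case False
      then have "0 < ?p (m + n) v" by (simp add: zero_less_measure_iff)
      from pos[OF this] show ?thesis by (simp add: q_def ln_mult distrib_left)
    qed simp
  qed
  \<comment> \<open>Only the marginal of the first \<open>m\<close> symbols enters, so this cross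
    term is the entropy of that marginal.\<close>
  also have "(\<Sum>v\<in>range (?X (m + n)). ?p (m + n) v * ln (?p m (take m v))) = - part_entropy M (?X m)"
    using integral_finite_range[OF I(2,3) X[of "m + n"], of "\<lambda>v. ln (?p m (take m v))"]
      integral_finite_range[OF I(2,3) X[of m], of "\<lambda>v. ln (?p m v)"] I(3)
    by (simp add: part_entropy_UNIV itinerary_add)
  also have "(\<Sum>v\<in>range (?X (m + n)). ?p (m + n) v * ln (?p n (drop m v))) = - part_entropy M (?X n)"
  proof -
    have "(\<integral>x. ln (?p n (?X n ((shift ^^ m) x))) \<partial>M) = (\<integral>x. ln (?p n (?X n x)) \<partial>M)"
      by (rule integral_shift[OF M]) (rule measurable_compose[OF measurable_itinerary[OF \<xi>]], simp)
    then show ?thesis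
      using integral_finite_range[OF I(2,3) X[of "m + n"], of "\<lambda>v. ln (?p n (drop m v))"]
      integral_finite_range[OF I(2,3) X[of n], of "\<lambda>v. ln (?p n v)"] I(3)
      by (simp add: part_entropy_UNIV itinerary_add)
  qed
  finally show "part_entropy M (?X (m + n)) \<le> part_entropy M (?X m) + part_entropy M (?X n)" by simp
next
  fix n
  show "0 * real n \<le> part_entropy M (itinerary \<xi> n)"
    using part_entropy_nonneg[OF invariant_probD(2,3)[OF M] finite_range_itinerary[OF \<xi>(2)]] by simp
qed

lemma measurable_finite_range_Pair:
  assumes X: "X \<in> measurable M (count_space UNIV)" "finite (range X)"
    and W: "W \<in> measurable M (count_space UNIV)" "finite (range W)"
  shows "(\<lambda>x. (X x, W x)) \<in> measurable M (count_space UNIV)" "finite (range (\<lambda>x. (X x, W x)))"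
proof -
  have "range (\<lambda>x. (X x, W x)) \<subseteq> range X \<times> range W" by auto
  then show "finite (range (\<lambda>x. (X x, W x)))" using X(2) W(2) finite_subset by blast
  show "(\<lambda>x. (X x, W x)) \<in> measurable M (count_space UNIV)"
  proof (rule measurableI)
    fix A
    have "(\<lambda>x. (X x, W x)) -` A \<inter> space M =
      (\<Union>(a, b)\<in>A \<inter> range X \<times> range W. (X -` {a} \<inter> space M) \<inter> (W -` {b} \<inter> space M))" by auto
    also have "\<dots> \<in> sets M"
      using measurable_sets[OF X(1)] measurable_sets[OF W(1)] finite_subset[of "A \<inter> range X \<times> range W"] X(2) W(2)
      by (intro sets.finite_UN) auto
    finally show "(\<lambda>x. (X x, W x)) -` A \<inter> space M \<in> sets M" .
  qed simp
qed

lemma finite_range_pref [simp]: "finite (range (pref n :: (nat \<Rightarrow> 'a::finite) \<Rightarrow> _))"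
  by (rule finite_subset[OF _ finite_words[of n]]) auto

text \<open>A strictly positive predictor of \<open>\<xi> x\<close> from \<open>N\<close> letters
  with mean logarithmic loss at most \<open>\<eta>\<close>: the vanishing of the conditional entropy
  given many letters, in the form that Gibbs' inequality consumes. The cells of \<open>\<xi>\<close>
  are approximated by cylinder events, smoothed by \<open>e'\<close> for positivity, then
  normalised.\<close>

lemma approx_conditional:
  fixes \<xi> :: "(nat \<Rightarrow> 'a::finite) \<Rightarrow> 'b"
  assumes M: "invariant_prob M" and \<xi>: "\<xi> \<in> measurable shift_space (count_space UNIV)" "finite (range \<xi>)"
    and \<eta>: "0 < \<eta>"
  obtains N r where "\<And>s u. 0 < r s u" "\<And>u. (\<Sum>s\<in>range \<xi>. r s u) = (1::real)"
    "- (\<integral>x. ln (r (\<xi> x) (pref N x)) \<partial>M) \<le> \<eta>"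
proof -
  note I = invariant_probD[OF M]
  interpret prob_space M by (rule I)
  define S where "S = range \<xi>"
  define s where "s = real (card S)"
  have S: "finite S" "S \<noteq> {}" using \<xi>(2) by (auto simp: S_def)
  have s: "1 \<le> s" using S by (simp add: s_def Suc_le_eq card_gt_0_iff)
  \<comment> \<open>Makes the loss outside the exceptional set at most
    \<open>s * e' = \<eta> / 2\<close>.\<close>
  define e' where "e' = \<eta> / (2 * s)"
  have e': "0 < e'" using \<eta> s by (simp add: e'_def)
  \<comment> \<open>The largest possible loss: a smoothed weight is at least \<open>e'\<close> and
    its normaliser at most \<open>s * (1 + e')\<close>.\<close>
  define G where "G = ln (s * (1 + e') / e')"
  have G: "0 \<le> G"
  proof -
    have "1 * e' \<le> s * (1 + e')" using s e' by (intro mult_mono) auto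
    then show ?thesis unfolding G_def using e' by (intro ln_ge_zero) (simp add: field_simps)
  qed
  \<comment> \<open>The exceptional set has measure at most \<open>s * e\<close>, so its loss
    \<open>G * (s * e)\<close> stays within \<open>\<eta> / 2\<close>.\<close>
  define e where "e = \<eta> / (2 * s * (G + 1))"
  have e: "0 < e" using \<eta> s G by (simp add: e_def)
  have "\<xi> -` {v} \<in> sets shift_space" for v using measurable_sets[OF \<xi>(1), of "{v}"] by simp
  then have "\<forall>v. \<exists>N Q. measure M {x. (x \<in> \<xi> -` {v}) \<noteq> Q (pref N x)} < e"
    using approx_by_cylinders[OF M _ e] by blast
  then obtain N0 Q0 where Q0: "\<And>v. measure M {x. (x \<in> \<xi> -` {v}) \<noteq> Q0 v (pref (N0 v) x)} < e" by metis
  define N where "N = (\<Sum>v\<in>S. N0 v)"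
  define Q where "Q = (\<lambda>v u. Q0 v (take (N0 v) u))"
  have Q: "Q v (pref N x) = Q0 v (pref (N0 v) x)" if "v \<in> S" for v x
  proof -
    have "N0 v \<le> N" using that S by (auto simp: N_def intro: member_le_sum)
    then have "take (N0 v) (pref N x) = pref (N0 v) x" by (simp add: list_eq_iff_nth_eq)
    then show ?thesis by (simp add: Q_def)
  qed
  define d where "d = (\<lambda>u. \<Sum>v\<in>S. of_bool (Q v u) + e')"
  have d: "s * e' \<le> d u" "d u \<le> s * (1 + e')" for u
  proof -
    have "(\<Sum>v\<in>S. e') \<le> d u" unfolding d_def by (intro sum_mono) auto
    then show "s * e' \<le> d u" by (simp add: s_def)
    have "d u \<le> (\<Sum>v\<in>S. 1 + e')" unfolding d_def by (intro sum_mono) auto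
    then show "d u \<le> s * (1 + e')" by (simp add: s_def)
  qed
  have dpos: "0 < d u" for u using d(1)[of u] s e' by (smt (verit) mult_pos_pos)
  define r where "r = (\<lambda>v u. (of_bool (Q v u) + e') / d u)"
  have rpos: "0 < r v u" for v u using dpos e' by (simp add: r_def add_nonneg_pos)
  have r1: "(\<Sum>v\<in>range \<xi>. r v u) = 1" for u
    using dpos[of u] by (simp add: r_def sum_divide_distrib[symmetric] d_def S_def)
  let ?E = "\<lambda>v. {x. (x \<in> \<xi> -` {v}) \<noteq> Q v (pref N x)}"
  define B where "B = (\<Union>v\<in>S. ?E v)"
  have Es: "?E v \<in> sets M" if "v \<in> S" for v
  proof -
    have 1: "\<xi> -` {v} \<in> sets M" using measurable_sets[OF \<xi>(1), of "{v}"] I(1) by simp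
    have 2: "{x. Q v (pref N x)} \<in> sets M"
      using measurable_sets[OF measurable_pref, of "Collect (Q v)" N] I(1) by (simp add: vimage_def)
    have "?E v = (\<xi> -` {v} - {x. Q v (pref N x)}) \<union> ({x. Q v (pref N x)} - \<xi> -` {v})" by auto
    then show ?thesis using 1 2 by simp
  qed
  then have Bs: "B \<in> sets M" unfolding B_def using S by (intro sets.finite_UN) auto
  have "measure M B \<le> (\<Sum>v\<in>S. measure M (?E v))" unfolding B_def using S Es by (intro measure_UNION_le) auto
  also have "\<dots> \<le> (\<Sum>v\<in>S. e)"
  proof (rule sum_mono)
    fix v assume "v \<in> S"
    then show "measure M (?E v) \<le> e" using Q0[of v] Q[of v] by simp
  qed
  also have "\<dots> = \<eta> / (2 * (G + 1))" using s S by (simp add: e_def s_def[symmetric])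
  finally have mB: "measure M B \<le> \<eta> / (2 * (G + 1))" .
  have pw: "- ln (r (\<xi> x) (pref N x)) \<le> s * e' + G * indicator B x" for x
  proof (cases "x \<in> B")
    case True
    have "e' / (s * (1 + e')) \<le> r (\<xi> x) (pref N x)"
      unfolding r_def using d(2) dpos e' s by (intro frac_le) auto
    then have "ln (e' / (s * (1 + e'))) \<le> ln (r (\<xi> x) (pref N x))"
      using e' s rpos by (intro ln_mono) auto
    moreover have "ln (e' / (s * (1 + e'))) = - G"
      unfolding G_def using e' s by (simp add: ln_div)
    moreover have "0 \<le> s * e'" using s e' by simp
    ultimately show ?thesis using True by simp
  next
    case False
    then have Qx: "Q v (pref N x) \<longleftrightarrow> v = \<xi> x" if "v \<in> S" for v using that by (auto simp: B_def)
    have "d (pref N x) = (\<Sum>v\<in>S. (if v = \<xi> x then 1 else 0) + e')"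
      unfolding d_def using Qx by (intro sum.cong) auto
    also have "\<dots> = 1 + s * e'" using S by (simp add: sum.distrib sum.delta S_def s_def)
    finally have "r (\<xi> x) (pref N x) = (1 + e') / (1 + s * e')"
      using Qx[of "\<xi> x"] by (simp add: r_def S_def)
    moreover have "1 / (1 + s * e') \<le> (1 + e') / (1 + s * e')" using e' s by (intro divide_right_mono) auto
    moreover have p0: "0 < 1 + s * e'" using e' s by (intro add_pos_nonneg) auto
    ultimately have "ln (1 / (1 + s * e')) \<le> ln (r (\<xi> x) (pref N x))"
      using rpos[of "\<xi> x" "pref N x"] by (intro ln_mono) auto
    then have "- ln (r (\<xi> x) (pref N x)) \<le> ln (1 + s * e')" using p0 by (simp add: ln_div)
    also have "\<dots> \<le> s * e'" using e' s by (intro ln_add_one_self_le_self) auto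
    finally show ?thesis using False by simp
  qed
  have P: "(\<lambda>x. (\<xi> x, pref N x)) \<in> measurable shift_space (count_space UNIV)" "finite (range (\<lambda>x. (\<xi> x, pref N x)))"
    using measurable_finite_range_Pair[OF \<xi> measurable_pref] by auto
  have int: "integrable M (\<lambda>x. ln (r (\<xi> x) (pref N x)))"
  proof -
    let ?f = "\<lambda>(v, u). ln (r v u)"
    have "bounded ((\<lambda>p. ?f p) ` range (\<lambda>x. (\<xi> x, pref N x)))" using P(2) by (intro finite_imp_bounded) auto
    then obtain b where b: "\<And>x. \<bar>?f (\<xi> x, pref N x)\<bar> \<le> b" by (auto simp: bounded_iff)
    have "(\<lambda>x. ?f (\<xi> x, pref N x)) \<in> borel_measurable shift_space"
      by (rule measurable_compose[OF P(1)]) simp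
    from integrable_bounded[OF M this b] show ?thesis by simp
  qed
  have "(\<integral>x. - ln (r (\<xi> x) (pref N x)) \<partial>M) \<le> (\<integral>x. s * e' + G * indicator B x \<partial>M)"
    using int Bs pw by (intro integral_mono) (auto simp: emeasure_eq_measure)
  also have "\<dots> = s * e' + G * measure M B" using Bs by (simp add: prob_space emeasure_eq_measure)
  also have "\<dots> \<le> \<eta> / 2 + G * (\<eta> / (2 * (G + 1)))"
    using mB G s by (intro add_mono mult_left_mono) (auto simp: e'_def)
  also have "\<dots> \<le> \<eta> / 2 + \<eta> / 2"
    using G \<eta> by (intro add_left_mono) (simp add: field_simps)
  also have "\<dots> = \<eta>" by simp
  finally show thesis using rpos r1 by (intro that[of r N]) auto
qed

text \<open>Absorbs bounded index shifts: the look-ahead of \<open>N\<close> letters here, the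
  \<open>n + 1\<close> letters of \<open>cyl n\<close> later.\<close>

lemma LIMSEQ_shift_ratio:
  fixes a :: "nat \<Rightarrow> real"
  assumes "(\<lambda>n. a n / real n) \<longlonglongrightarrow> l"
  shows "(\<lambda>n. a (n + k) / real n) \<longlonglongrightarrow> l"
proof -
  have "(\<lambda>n. real (n + k) / real n) \<longlonglongrightarrow> 1"
  proof -
    have "(\<lambda>n. 1 + real k / real n) \<longlonglongrightarrow> 1 + 0" by (intro tendsto_intros lim_const_over_n)
    moreover have "\<forall>\<^sub>F n in sequentially. 1 + real k / real n = real (n + k) / real n"
      using eventually_gt_at_top[of 0] by eventually_elim (simp add: field_simps)
    ultimately show ?thesis by (simp add: filterlim_cong)
  qed
  from tendsto_mult[OF LIMSEQ_ignore_initial_segment[OF assms, of k] this]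
  have "(\<lambda>n. a (n + k) / real (n + k) * (real (n + k) / real n)) \<longlonglongrightarrow> l" by simp
  moreover have "\<forall>\<^sub>F n in sequentially. a (n + k) / real (n + k) * (real (n + k) / real n) = a (n + k) / real n"
    using eventually_gt_at_top[of 0] by eventually_elim simp
  ultimately show ?thesis by (rule Lim_transform_eventually)
qed

text \<open>The itinerary is refined by the first \<open>n + N\<close> letters and compared, through
  Gibbs' inequality, with the Gibbs weights of these letters times the predictors of the symbols. In
  the limit this costs, per step, the pressure minus the integral of \<open>g\<close>, plus the loss
  \<open>\<eta>\<close>.\<close>

lemma entropy_rate_upper:
  fixes \<xi> :: "(nat \<Rightarrow> 'a::finite) \<Rightarrow> 'b"
  assumes M: "invariant_prob M" and \<xi>: "\<xi> \<in> measurable shift_space (count_space UNIV)" "finite (range \<xi>)"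
    and g: "holder g"
  shows "lim (\<lambda>n. part_entropy M (itinerary \<xi> n) / real n) \<le> top_pressure g - (\<integral>x. g x \<partial>M)"
proof (rule field_le_epsilon)
  fix \<eta> :: real assume \<eta>: "0 < \<eta>"
  note I = invariant_probD[OF M]
  interpret prob_space M by (rule I)
  let ?h = "lim (\<lambda>n. part_entropy M (itinerary \<xi> n) / real n)"
  obtain N r where r: "\<And>s u. 0 < r s u" "\<And>u. (\<Sum>s\<in>range \<xi>. r s u) = 1"
    "- (\<integral>x. ln (r (\<xi> x) (pref N x)) \<partial>M) \<le> \<eta>"
    using approx_conditional[OF M \<xi> \<eta>] by metis
  obtain C \<theta> where h: "holder_with C \<theta> g" using g unfolding holder_iff by auto
  define K where "K = C / (1 - \<theta>)"
  define y0 where "y0 = (undefined :: nat \<Rightarrow> 'a)"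
  let ?X = "itinerary \<xi>"
  let ?F = "\<lambda>x. ln (r (\<xi> x) (pref N x))"
  let ?I = "\<integral>x. g x \<partial>M"
  have P: "(\<lambda>x. (\<xi> x, pref N x)) \<in> measurable shift_space (count_space UNIV)" "finite (range (\<lambda>x. (\<xi> x, pref N x)))"
    using measurable_finite_range_Pair[OF \<xi> measurable_pref] by auto
  have Fm: "?F \<in> borel_measurable shift_space"
    using measurable_compose[OF P(1), of "\<lambda>(v, u). ln (r v u)" borel] by simp
  obtain b where b: "\<And>x. \<bar>?F x\<bar> \<le> b"
  proof -
    have "bounded ((\<lambda>(v, u). ln (r v u)) ` range (\<lambda>x. (\<xi> x, pref N x)))" using P(2) by (intro finite_imp_bounded) auto
    then show ?thesis using that by (auto simp: bounded_iff)
  qed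
  have Fk: "integrable M (\<lambda>x. ?F ((shift ^^ k) x))" for k
    by (rule integrable_bounded[OF M]) (rule measurable_compose[OF measurable_shift_funpow Fm], rule b)
  have main: "part_entropy M (?X n) \<le> K + ln (Z g (n + N) y0) - real (n + N) * ?I + real n * \<eta>" for n
  proof -
    let ?W = "pref (n + N)"
    \<comment> \<open>Predicting the symbol at time \<open>k < n\<close> takes the \<open>N\<close>
      letters from position \<open>k\<close> on, hence words of length \<open>n + N\<close>.\<close>
    define q where "q = (\<lambda>(v, w). exp (birk g (n + N) (w \<frown> y0)) / Z g (n + N) y0 * (\<Prod>k<n. r (v ! k) (take N (drop k w))))"
    have X: "?X n \<in> measurable M (count_space UNIV)" "finite (range (?X n))"
      using measurable_itinerary[OF \<xi>, of n] finite_range_itinerary[OF \<xi>(2)] I(1) by (simp_all cong: measurable_cong_sets)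
    have W: "?W \<in> measurable M (count_space UNIV)"
      using measurable_pref[of "n + N"] I(1) by (simp cong: measurable_cong_sets)
    note XW = measurable_finite_range_Pair[OF X W finite_range_pref]
    have qpos: "0 < q p" for p by (cases p) (simp add: q_def r(1) prod_pos)
    let ?L = "{v. set v \<subseteq> range \<xi> \<and> length v = n}"
    have "(\<Sum>p\<in>range (\<lambda>x. (?X n x, ?W x)). q p) \<le> (\<Sum>p\<in>?L \<times> words (n + N). q p)"
      using range_itinerary[of \<xi> n] finite_lists_length_eq[OF \<xi>(2), of n] qpos
      by (intro sum_mono2) (auto intro: less_imp_le)
    also have "\<dots> = (\<Sum>w\<in>words (n + N). \<Sum>v\<in>?L. q (v, w))"
      unfolding sum.cartesian_product' by (rule sum.swap)
    also have "\<dots> = (\<Sum>w\<in>words (n + N). exp (birk g (n + N) (w \<frown> y0)) / Z g (n + N) y0)"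
    proof (intro sum.cong refl)
      fix w
      have "(\<Sum>v\<in>?L. \<Prod>k<n. r (v ! k) (take N (drop k w))) = 1"
        using sum_prod_words[OF \<xi>(2), of "\<lambda>k s. r s (take N (drop k w))" n] r(2) by simp
      then show "(\<Sum>v\<in>?L. q (v, w)) = exp (birk g (n + N) (w \<frown> y0)) / Z g (n + N) y0"
        by (simp add: q_def sum_divide_distrib[symmetric] sum_distrib_left[symmetric])
    qed
    also have "\<dots> = 1" by (simp add: sum_divide_distrib[symmetric] Z_def[symmetric])
    finally have qsum: "(\<Sum>p\<in>range (\<lambda>x. (?X n x, ?W x)). q p) \<le> 1" .
    have "part_entropy M (?X n) \<le> part_entropy M (\<lambda>x. (?X n x, ?W x))"
      by (rule part_entropy_pair_mono[OF I(2,3) X XW])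
    also have "\<dots> \<le> - (\<Sum>p\<in>range (\<lambda>x. (?X n x, ?W x)). measure M ((\<lambda>x. (?X n x, ?W x)) -` {p}) * ln (q p))"
      by (rule part_entropy_le_cross[OF I(2,3) XW _ _ qsum]) (use qpos in \<open>auto intro: less_imp_le\<close>)
    also have "\<dots> = - (\<integral>x. ln (q (?X n x, ?W x)) \<partial>M)"
      using integral_finite_range[OF I(2,3) XW, of "\<lambda>p. ln (q p)"] by simp
    also have "\<dots> \<le> - (\<integral>x. birk g (n + N) x - K - ln (Z g (n + N) y0) + (\<Sum>k<n. ?F ((shift ^^ k) x)) \<partial>M)"
    proof (subst neg_le_iff_le, rule integral_mono)
      show "integrable M (\<lambda>x. birk g (n + N) x - K - ln (Z g (n + N) y0) + (\<Sum>k<n. ?F ((shift ^^ k) x)))"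
        using Fk integrable_birk[OF M g] by auto
      have "bounded ((\<lambda>p. ln (q p)) ` range (\<lambda>x. (?X n x, ?W x)))" using XW(2) by (intro finite_imp_bounded) auto
      then obtain b' where b': "\<And>x. \<bar>ln (q (?X n x, ?W x))\<bar> \<le> b'" by (auto simp: bounded_iff)
      have "(\<lambda>x. ln (q (?X n x, ?W x))) \<in> borel_measurable M"
        by (rule measurable_compose[OF XW(1)]) simp
      then show "integrable M (\<lambda>x. ln (q (?X n x, ?W x)))"
        using b' by (intro integrable_const_bound[where B = b']) auto
    next
      fix x :: "nat \<Rightarrow> 'a"
      have take: "take N (drop k (pref (n + N) x)) = pref N ((shift ^^ k) x)" if "k < n" for k
        using that by (auto simp: list_eq_iff_nth_eq shift_funpow add.commute)
      have "ln (q (?X n x, ?W x)) = birk g (n + N) (?W x \<frown> y0) - ln (Z g (n + N) y0) + (\<Sum>k<n. ?F ((shift ^^ k) x))"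
      proof -
        have "r s u \<noteq> 0" for s u using r(1)[of s u] by simp
        then show ?thesis unfolding q_def using r(1) by (simp add: ln_mult ln_div prod_pos ln_prod take)
      qed
      moreover have "birk g (n + N) x - K \<le> birk g (n + N) (?W x \<frown> y0)"
        using birk_distortion_pref[OF h, of "n + N" x y0] by (simp add: K_def abs_le_iff)
      ultimately show "birk g (n + N) x - K - ln (Z g (n + N) y0) + (\<Sum>k<n. ?F ((shift ^^ k) x)) \<le> ln (q (?X n x, ?W x))"
        by simp
    qed
    also have "(\<integral>x. birk g (n + N) x - K - ln (Z g (n + N) y0) + (\<Sum>k<n. ?F ((shift ^^ k) x)) \<partial>M) =
       real (n + N) * ?I - K - ln (Z g (n + N) y0) + real n * (\<integral>x. ?F x \<partial>M)"
      using Fk integrable_birk[OF M g, of "n + N"]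
      by (simp add: integral_birk[OF M g] prob_space integral_shift[OF M Fm] del: of_nat_add)
    finally show ?thesis using mult_left_mono[OF r(3), of "real n"] by simp
  qed
  have "(\<lambda>n. part_entropy M (?X n) / real n) \<longlonglongrightarrow> ?h"
    using entropy_rate_convergent[OF M \<xi>] by (simp add: convergent_LIMSEQ_iff)
  moreover have "(\<lambda>n. K / real n + ln (Z g (n + N) y0) / real n - real (n + N) * ?I / real n + \<eta>) \<longlonglongrightarrow> 0 + top_pressure g - ?I + \<eta>"
  proof (intro tendsto_intros lim_const_over_n)
    show "(\<lambda>n. ln (Z g (n + N) y0) / real n) \<longlonglongrightarrow> top_pressure g"
      by (rule LIMSEQ_shift_ratio[OF top_pressure_LIMSEQ[OF g]])
    have "(\<lambda>n. real n * ?I / real n) \<longlonglongrightarrow> ?I"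
      by (rule tendsto_eventually) (use eventually_gt_at_top[of 0] in eventually_elim, simp)
    then show "(\<lambda>n. real (n + N) * ?I / real n) \<longlonglongrightarrow> ?I" by (rule LIMSEQ_shift_ratio)
  qed
  ultimately have "?h \<le> 0 + top_pressure g - ?I + \<eta>"
  proof (rule LIMSEQ_le, intro exI allI impI)
    fix n :: nat assume n: "1 \<le> n"
    have "part_entropy M (?X n) / real n \<le> (K + ln (Z g (n + N) y0) - real (n + N) * ?I + real n * \<eta>) / real n"
      using main by (intro divide_right_mono) auto
    also have "\<dots> = K / real n + ln (Z g (n + N) y0) / real n - real (n + N) * ?I / real n + \<eta>"
      using n by (simp add: add_divide_distrib diff_divide_distrib)
    finally show "part_entropy M (?X n) / real n \<le> K / real n + ln (Z g (n + N) y0) / real n - real (n + N) * ?I / real n + \<eta>" .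
  qed
  then show "?h \<le> top_pressure g - ?I + \<eta>" by simp
qed

section \<open>Suprema over partitions\<close>

lemma ks_entropy_itinerary:
  "ks_entropy M = (SUP \<xi>\<in>{\<xi>::(nat \<Rightarrow> 'a) \<Rightarrow> nat. \<xi> \<in> measurable shift_space (count_space UNIV) \<and> finite (range \<xi>)}.
      lim (\<lambda>n. part_entropy M (itinerary \<xi> n) / real n))"
  unfolding ks_entropy_def itinerary_def[abs_def] ..

lemma ks_entropy_upper:
  fixes M :: "(nat \<Rightarrow> 'a::finite) measure"
  assumes M: "invariant_prob M" and g: "holder g"
  shows "ks_entropy M + (\<integral>x. g x \<partial>M) \<le> top_pressure g"
proof -
  have "ks_entropy M \<le> top_pressure g - (\<integral>x. g x \<partial>M)"
    unfolding ks_entropy_itinerary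
  proof (rule cSUP_least)
    have "(\<lambda>_. 0) \<in> {\<xi>::(nat \<Rightarrow> 'a) \<Rightarrow> nat. \<xi> \<in> measurable shift_space (count_space UNIV) \<and> finite (range \<xi>)}"
      by (auto simp: image_constant_conv)
    then show "{\<xi>::(nat \<Rightarrow> 'a) \<Rightarrow> nat. \<xi> \<in> measurable shift_space (count_space UNIV) \<and> finite (range \<xi>)} \<noteq> {}"
      by blast
  qed (use entropy_rate_upper[OF M _ _ g] in auto)
  then show ?thesis by simp
qed

lemma entropy_rate_le_ks_entropy:
  fixes M :: "(nat \<Rightarrow> 'a::finite) measure" and \<xi> :: "(nat \<Rightarrow> 'a) \<Rightarrow> nat"
  assumes M: "invariant_prob M" and \<xi>: "\<xi> \<in> measurable shift_space (count_space UNIV)" "finite (range \<xi>)"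
  shows "lim (\<lambda>n. part_entropy M (itinerary \<xi> n) / real n) \<le> ks_entropy M"
  unfolding ks_entropy_itinerary
proof (rule cSUP_upper)
  \<comment> \<open>The zero potential bounds all entropy rates at once; the real supremum says
    nothing about an unbounded family.\<close>
  have 0: "holder (\<lambda>_::nat \<Rightarrow> 'a. 0)" unfolding holder_def by (intro exI[of _ 1] exI[of _ "1/2"]) auto
  show "bdd_above ((\<lambda>\<xi>. lim (\<lambda>n. part_entropy M (itinerary \<xi> n) / real n)) `
     {\<xi>::(nat \<Rightarrow> 'a) \<Rightarrow> nat. \<xi> \<in> measurable shift_space (count_space UNIV) \<and> finite (range \<xi>)})"
    using entropy_rate_upper[OF M _ _ 0] by (intro bdd_aboveI2) auto
qed (use \<xi> in auto)

section \<open>Independent blocks\<close>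

definition block_pmf :: "((nat \<Rightarrow> 'a::finite) \<Rightarrow> real) \<Rightarrow> nat \<Rightarrow> (nat \<Rightarrow> 'a) \<Rightarrow> 'a list pmf" where
  "block_pmf g n y = embed_pmf (\<lambda>w. if w \<in> words n then exp (birk g n (w \<frown> y)) / Z g n y else 0)"

lemma pmf_block_pmf:
  "pmf (block_pmf g n y) w = (if w \<in> words n then exp (birk g n (w \<frown> y)) / Z g n y else 0)"
  unfolding block_pmf_def
proof (rule pmf_embed_pmf)
  let ?f = "\<lambda>w. if w \<in> words n then exp (birk g n (w \<frown> y)) / Z g n y else 0"
  show "0 \<le> ?f w" for w by (auto intro: divide_nonneg_pos)
  have "(\<integral>\<^sup>+ w. ennreal (?f w) \<partial>count_space UNIV) = (\<Sum>w\<in>words n. ennreal (?f w))"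
    by (rule nn_integral_count_space') auto
  also have "\<dots> = ennreal (\<Sum>w\<in>words n. ?f w)"
    by (rule sum_ennreal) (auto intro: divide_nonneg_pos)
  also have "(\<Sum>w\<in>words n. ?f w) = 1" by (simp add: sum_divide_distrib[symmetric] Z_def[symmetric])
  finally show "(\<integral>\<^sup>+ w. ennreal (?f w) \<partial>count_space UNIV) = 1" by simp
qed

definition blocks :: "((nat \<Rightarrow> 'a::finite) \<Rightarrow> real) \<Rightarrow> nat \<Rightarrow> (nat \<Rightarrow> 'a) \<Rightarrow> (nat \<Rightarrow> 'a list) measure" where
  "blocks g n y = Pi\<^sub>M UNIV (\<lambda>_. measure_pmf (block_pmf g n y))"

text \<open>Concatenates the blocks and drops the first \<open>i\<close> letters. Lists of a length
  other than \<open>n\<close> have probability zero, so out-of-range indexing occurs on a null set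
  only.\<close>

definition unblock :: "nat \<Rightarrow> nat \<Rightarrow> (nat \<Rightarrow> 'a list) \<Rightarrow> (nat \<Rightarrow> 'a)" where
  "unblock n i b = (\<lambda>k. b ((i + k) div n) ! ((i + k) mod n))"

text \<open>Concatenated independent blocks are invariant in general only under the
  \<open>n\<close>-th power of the shift; a uniformly random phase \<open>i\<close> restores
  invariance under the shift itself.\<close>

definition block_measure :: "((nat \<Rightarrow> 'a::finite) \<Rightarrow> real) \<Rightarrow> nat \<Rightarrow> (nat \<Rightarrow> 'a) \<Rightarrow> (nat \<Rightarrow> 'a) measure" where
  "block_measure g n y = distr (measure_pmf (pmf_of_set {..<n}) \<Otimes>\<^sub>M blocks g n y) shift_space (\<lambda>(i, b). unblock n i b)"

section \<open>Invariance and cylinder probabilities of the block measure\<close>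

lemma prob_space_blocks: "prob_space (blocks g n y)"
  unfolding blocks_def by (intro prob_space_PiM prob_space_measure_pmf)

lemma space_blocks [simp]: "space (blocks g n y) = UNIV"
  by (simp add: blocks_def space_PiM)

lemma measurable_blocks_component: "(\<lambda>b. b j) \<in> measurable (blocks g n y) (measure_pmf (block_pmf g n y))"
  unfolding blocks_def by (rule measurable_component_singleton) simp

lemma measurable_unblock: "unblock n i \<in> measurable (blocks g n y) shift_space"
proof -
  have "(\<lambda>b. b j ! r) \<in> measurable (blocks g n y) (count_space UNIV)" for j r
  proof -
    show ?thesis by (rule measurable_compose[OF measurable_blocks_component]) simp
  qed
  then show ?thesis
    unfolding shift_space_def unblock_def by (intro measurable_PiM_single') (auto simp: space_PiM)
qed

lemma measurable_unblock_pair: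
  "(\<lambda>(i, b). unblock n i b) \<in> measurable (measure_pmf p \<Otimes>\<^sub>M blocks g n y) shift_space"
proof -
  have "(\<lambda>(i, b). unblock n i b) \<in> measurable (count_space UNIV \<Otimes>\<^sub>M blocks g n y) shift_space"
    by (rule measurable_pair_measure_countable1) (auto intro: measurable_unblock)
  moreover have "sets (measure_pmf p \<Otimes>\<^sub>M blocks g n y) = sets (count_space UNIV \<Otimes>\<^sub>M blocks g n y)"
    by (intro sets_pair_measure_cong) auto
  ultimately show ?thesis by (simp cong: measurable_cong_sets)
qed

lemma prob_space_block_measure: "prob_space (block_measure g n y)"
proof -
  interpret A: prob_space "measure_pmf (pmf_of_set {..<n})" by (rule prob_space_measure_pmf)
  interpret B: prob_space "blocks g n y" by (rule prob_space_blocks)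
  interpret pair_prob_space "measure_pmf (pmf_of_set {..<n})" "blocks g n y" ..
  show ?thesis unfolding block_measure_def by (rule prob_space_distr) (rule measurable_unblock_pair)
qed

lemma measure_block_measure:
  assumes n: "1 \<le> n" and A: "A \<in> sets shift_space"
  shows "measure (block_measure g n y) A = (\<Sum>i<n. measure (blocks g n y) (unblock n i -` A)) / real n"
proof -
  interpret B: prob_space "blocks g n y" by (rule prob_space_blocks)
  interpret M: prob_space "block_measure g n y" by (rule prob_space_block_measure)
  let ?u = "measure_pmf (pmf_of_set {..<n})"
  let ?f = "\<lambda>(i, b). unblock n i b"
  have "0 \<in> {..<n}" using n by simp
  then have ne: "{..<n} \<noteq> {}" by blast
  have s: "?f -` A \<inter> space (?u \<Otimes>\<^sub>M blocks g n y) \<in> sets (?u \<Otimes>\<^sub>M blocks g n y)"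
    by (rule measurable_sets[OF measurable_unblock_pair A])
  have "emeasure (block_measure g n y) A = emeasure (?u \<Otimes>\<^sub>M blocks g n y) (?f -` A \<inter> space (?u \<Otimes>\<^sub>M blocks g n y))"
    unfolding block_measure_def by (rule emeasure_distr[OF measurable_unblock_pair A])
  also have "\<dots> = (\<integral>\<^sup>+ i. emeasure (blocks g n y) (Pair i -` (?f -` A \<inter> space (?u \<Otimes>\<^sub>M blocks g n y))) \<partial>?u)"
    by (rule B.emeasure_pair_measure_alt[OF s])
  also have "\<dots> = (\<integral>\<^sup>+ i. ennreal (measure (blocks g n y) (unblock n i -` A)) \<partial>?u)"
    by (simp add: space_pair_measure B.emeasure_eq_measure vimage_def)
  also have "\<dots> = ennreal (measure_pmf.expectation (pmf_of_set {..<n}) (\<lambda>i. measure (blocks g n y) (unblock n i -` A)))"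
    by (intro nn_integral_eq_integral measure_pmf.integrable_const_bound[where B = 1]) auto
  also have "measure_pmf.expectation (pmf_of_set {..<n}) (\<lambda>i. measure (blocks g n y) (unblock n i -` A)) =
      (\<Sum>i<n. measure (blocks g n y) (unblock n i -` A)) / real n"
    using ne by (simp add: integral_pmf_of_set)
  finally show ?thesis
    by (simp add: M.emeasure_eq_measure sum_nonneg)
qed

lemma shift_unblock: "shift (unblock n i b) = unblock n (Suc i) b"
  by (simp add: shift_def unblock_def)

lemma unblock_full: "1 \<le> n \<Longrightarrow> unblock n n b = unblock n 0 (\<lambda>j. b (Suc j))"
  by (simp add: unblock_def)

lemma blocks_shift: "distr (blocks g n y) (blocks g n y) (\<lambda>b j. b (Suc j)) = blocks g n y"
  using distr_PiM_reindex[of UNIV "\<lambda>_. measure_pmf (block_pmf g n y)" Suc UNIV]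
  by (simp add: blocks_def prob_space_measure_pmf restrict_UNIV)

lemma measurable_blocks_shift: "(\<lambda>b j. b (Suc j)) \<in> measurable (blocks g n y) (blocks g n y)"
  unfolding blocks_def
proof (rule measurable_PiM_single')
  show "(\<lambda>b. b (Suc j)) \<in> measurable (Pi\<^sub>M UNIV (\<lambda>_. measure_pmf (block_pmf g n y))) (measure_pmf (block_pmf g n y))" for j
    by (rule measurable_component_singleton) simp
qed (simp add: space_PiM)

text \<open>The shift raises the phase by one, and phase \<open>n\<close> is phase \<open>0\<close>
  with the first block dropped, which leaves the product law unchanged. Hence the sum over phases is
  merely permuted.\<close>

lemma invariant_block_measure:
  assumes n: "1 \<le> n"
  shows "invariant_prob (block_measure g n y)"
  unfolding invariant_prob_def
proof (intro conjI ballI)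
  show "sets (block_measure g n y) = sets shift_space" by (simp add: block_measure_def)
  show "prob_space (block_measure g n y)" by (rule prob_space_block_measure)
  fix A :: "(nat \<Rightarrow> 'a) set" assume A: "A \<in> sets shift_space"
  have sA: "shift -` A \<in> sets shift_space" using measurable_sets[OF measurable_shift A] by simp
  let ?F = "\<lambda>i. measure (blocks g n y) (unblock n i -` A)"
  have FS: "measure (blocks g n y) (unblock n i -` (shift -` A)) = ?F (Suc i)" for i
    by (simp add: vimage_def shift_unblock)
  have Fn: "?F n = ?F 0"
  proof -
    have u: "unblock n 0 -` A \<in> sets (blocks g n y)"
      using measurable_sets[OF measurable_unblock A, of n 0 g y] by simp
    have "unblock n n -` A = (\<lambda>b j. b (Suc j)) -` (unblock n 0 -` A)"
      by (auto simp: unblock_full[OF n])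
    then have "?F n = measure (distr (blocks g n y) (blocks g n y) (\<lambda>b j. b (Suc j))) (unblock n 0 -` A)"
      using measure_distr[OF measurable_blocks_shift u] by simp
    then show ?thesis unfolding blocks_shift .
  qed
  have "(\<Sum>i<n. ?F (Suc i)) + ?F 0 = (\<Sum>i<n. ?F i) + ?F n"
    using sum.lessThan_Suc_shift[of ?F n] by simp
  then show "measure (block_measure g n y) (shift -` A) = measure (block_measure g n y) A"
    by (simp add: measure_block_measure[OF n] A sA FS Fn)
qed

lemma birk_blocks: "(\<Sum>j<q. birk g n ((shift ^^ (a + j * n)) x)) = birk g (q * n) ((shift ^^ a) x)"
proof (induction q)
  case (Suc q)
  have "Suc q * n = q * n + n" by simp
  then have "birk g (Suc q * n) ((shift ^^ a) x) = birk g (q * n) ((shift ^^ a) x) + birk g n ((shift ^^ (q * n)) ((shift ^^ a) x))"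
    by (simp only: birk_add)
  moreover have "(shift ^^ (q * n)) ((shift ^^ a) x) = (shift ^^ (a + q * n)) x"
    by (simp add: shift_funpow add.commute add.left_commute)
  ultimately show ?case using Suc by simp
qed simp

text \<open>Whatever the phase, a window of \<open>Suc q * n\<close> letters contains
  \<open>q\<close> complete blocks, whose probabilities multiply. The two ends have \<open>n\<close>
  letters together and are paid for by \<open>real n * b\<close>.\<close>

lemma block_measure_cylinder:
  assumes n: "1 \<le> n" and h: "holder_with C \<theta> g" and b: "\<And>x. \<bar>g x\<bar> \<le> b"
  defines "K \<equiv> C / (1 - \<theta>)"
  shows "measure (block_measure g n y) {z. pref (Suc q * n) z = pref (Suc q * n) x}
    \<le> exp (birk g (Suc q * n) x + real n * b + real q * (K - ln (Z g n y)))"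
proof -
  interpret B: prob_space "blocks g n y" by (rule prob_space_blocks)
  interpret P: product_prob_space "\<lambda>_::nat. measure_pmf (block_pmf g n y)" UNIV
    by unfold_locales
  let ?N = "Suc q * n"
  let ?A = "{z. pref ?N z = pref ?N x}"
  define R where "R = exp (birk g ?N x + real n * b + real q * (K - ln (Z g n y)))"
  have one: "measure (blocks g n y) (unblock n i -` ?A) \<le> R" if i: "i < n" for i
  proof -
    \<comment> \<open>The position in the window where block number \<open>1\<close> starts. Block
      \<open>0\<close> is always discarded, even for \<open>i = 0\<close>, when it is
      complete.\<close>
    define a where "a = n - i"
    define bl where "bl = (\<lambda>j. (shift ^^ (a + j * n)) x)"
    define X where "X = (\<lambda>j. {v. \<forall>r<n. v ! r = bl (j - 1) r})"
    have pX: "measure (measure_pmf (block_pmf g n y)) (X j) \<le> exp (birk g n (bl (j - 1)) + (K - ln (Z g n y)))" for j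
    proof -
      \<comment> \<open>On the support all lists have length \<open>n\<close>, so \<open>n\<close>
        letters determine the list.\<close>
      have "X j \<inter> set_pmf (block_pmf g n y) \<subseteq> {pref n (bl (j - 1))}"
        by (auto simp: X_def set_pmf_iff pmf_block_pmf words_def list_eq_iff_nth_eq split: if_splits)
      then have "measure_pmf.prob (block_pmf g n y) (X j \<inter> set_pmf (block_pmf g n y)) \<le> measure_pmf.prob (block_pmf g n y) {pref n (bl (j - 1))}"
        by (intro measure_pmf.finite_measure_mono) auto
      then have "measure_pmf.prob (block_pmf g n y) (X j) \<le> pmf (block_pmf g n y) (pref n (bl (j - 1)))"
        by (simp add: measure_Int_set_pmf measure_pmf_single)
      also have "\<dots> = exp (birk g n (pref n (bl (j - 1)) \<frown> y) - ln (Z g n y))"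
        by (simp add: pmf_block_pmf exp_diff)
      also have "\<dots> \<le> exp (birk g n (bl (j - 1)) + (K - ln (Z g n y)))"
        using birk_distortion_pref[OF h, of n "bl (j - 1)" y] by (simp add: K_def abs_le_iff)
      finally show ?thesis .
    qed
    have sub: "unblock n i -` ?A \<subseteq> {b\<in>space (blocks g n y). \<forall>j\<in>{1..q}. b j \<in> X j}"
    proof (intro subsetI CollectI conjI ballI)
      fix b' j assume "b' \<in> unblock n i -` ?A" and j: "j \<in> {1..q}"
      then have eq: "unblock n i b' k = x k" if "k < ?N" for k
        using that by (auto simp: pref_eq_iff agree_def)
      show "b' j \<in> X j"
        unfolding X_def
      proof (intro CollectI allI impI)
        fix r assume r: "r < n"
        define k where "k = a + (j - 1) * n + r"
        have jn: "j * n = n + (j - 1) * n" using j by (cases j) auto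
        have ik: "i + k = j * n + r" using i jn by (simp add: k_def a_def)
        have "j * n + r < ?N"
        proof -
          have "j * n \<le> q * n" using j by (intro mult_right_mono) auto
          moreover have "?N = n + q * n" by simp
          ultimately show ?thesis using r by linarith
        qed
        then have "k < ?N" using ik by linarith
        moreover have "unblock n i b' k = b' j ! r" using r by (simp add: unblock_def ik)
        moreover have "bl (j - 1) r = x k" by (simp add: bl_def shift_funpow k_def add.commute)
        ultimately show "b' j ! r = bl (j - 1) r" using eq[of k] by simp
      qed
    qed simp
    have em: "emeasure (blocks g n y) {b\<in>space (blocks g n y). \<forall>j\<in>{1..q}. b j \<in> X j} =
       (\<Prod>j\<in>{1..q}. emeasure (measure_pmf (block_pmf g n y)) (X j))"
      unfolding blocks_def by (rule P.emeasure_PiM_Collect) auto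
    have "measure (blocks g n y) (unblock n i -` ?A) \<le> measure (blocks g n y) {b\<in>space (blocks g n y). \<forall>j\<in>{1..q}. b j \<in> X j}"
    proof (rule B.finite_measure_mono[OF sub])
      show "{b\<in>space (blocks g n y). \<forall>j\<in>{1..q}. b j \<in> X j} \<in> sets (blocks g n y)"
      proof (rule sets.sets_Collect_finite_All)
        fix j
        have "(\<lambda>b. b j) -` X j \<inter> space (blocks g n y) \<in> sets (blocks g n y)"
          by (rule measurable_sets[OF measurable_blocks_component]) simp
        then show "{b \<in> space (blocks g n y). b j \<in> X j} \<in> sets (blocks g n y)" by (simp add: vimage_def)
      qed simp
    qed
    also have "\<dots> = (\<Prod>j\<in>{1..q}. measure (measure_pmf (block_pmf g n y)) (X j))"
      using em by (simp add: B.emeasure_eq_measure measure_pmf.emeasure_eq_measure prod_ennreal prod_nonneg)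
    also have "\<dots> \<le> (\<Prod>j\<in>{1..q}. exp (birk g n (bl (j - 1)) + (K - ln (Z g n y))))"
      using pX by (intro prod_mono) auto
    also have "\<dots> = exp (\<Sum>j\<in>{1..q}. birk g n (bl (j - 1)) + (K - ln (Z g n y)))"
      by (simp add: exp_sum)
    also have "(\<Sum>j\<in>{1..q}. birk g n (bl (j - 1)) + (K - ln (Z g n y))) = birk g (q * n) ((shift ^^ a) x) + real q * (K - ln (Z g n y))"
    proof -
      have "(\<Sum>j\<in>{1..q}. birk g n (bl (j - 1))) = (\<Sum>j<q. birk g n (bl j))"
        by (rule sum.reindex_bij_witness[where i = Suc and j = "\<lambda>j. j - 1"]) auto
      then show ?thesis by (simp add: sum.distrib bl_def birk_blocks)
    qed
    also have "exp (birk g (q * n) ((shift ^^ a) x) + real q * (K - ln (Z g n y))) \<le> R"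
    proof -
      have N: "?N = a + (q * n + i)" using i by (simp add: a_def)
      have "birk g ?N x = birk g a x + (birk g (q * n) ((shift ^^ a) x) + birk g i ((shift ^^ (q * n)) ((shift ^^ a) x)))"
        unfolding N birk_add ..
      moreover have "\<bar>birk g a x\<bar> \<le> real a * b" "\<bar>birk g i ((shift ^^ (q * n)) ((shift ^^ a) x))\<bar> \<le> real i * b"
        by (rule birk_bound, rule b)+
      moreover have "real a * b + real i * b = real n * b" using i by (simp add: a_def algebra_simps of_nat_diff)
      ultimately show ?thesis unfolding R_def by (simp add: abs_le_iff)
    qed
    finally show ?thesis .
  qed
  have "measure (block_measure g n y) ?A = (\<Sum>i<n. measure (blocks g n y) (unblock n i -` ?A)) / real n"
    by (rule measure_block_measure[OF n]) (rule sets_pref)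
  also have "\<dots> \<le> (\<Sum>i<n. R) / real n" using one by (intro divide_right_mono sum_mono) auto
  also have "\<dots> = R" using n by simp
  finally show ?thesis by (simp add: R_def)
qed

section \<open>Lower half of the variational principle\<close>

lemma part_entropy_inj:
  assumes "inj f" "space M = UNIV"
  shows "part_entropy M (\<lambda>x. f (X x)) = part_entropy M X"
proof -
  have "range (\<lambda>x. f (X x)) = f ` range X" by auto
  moreover have "(\<lambda>x. f (X x)) -` {f v} = X -` {v}" for v using assms(1) by (auto dest: injD)
  ultimately show ?thesis
    using assms by (simp add: part_entropy_UNIV sum.reindex[OF inj_on_subset[OF assms(1)]])
qed

text \<open>An upper bound on cylinder probabilities is a lower bound on the entropy of the letter
  partition. The Birkhoff sums in it integrate to minus the energy and cancel against the second
  summand, leaving \<open>ln Z\<close> per block.\<close>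

lemma pressure_lower:
  fixes g :: "(nat \<Rightarrow> 'a::finite) \<Rightarrow> real"
  assumes h: "holder_with C \<theta> g" and n: "1 \<le> n"
  shows "(ln (Z g n y) - C / (1 - \<theta>)) / real n
     \<le> ks_entropy (block_measure g n y) + (\<integral>x. g x \<partial>block_measure g n y)"
proof -
  have g: "holder g" using h holder_iff by blast
  obtain b where b: "\<And>x. \<bar>g x\<bar> \<le> b" using holder_bounded[OF g] by metis
  define K where "K = C / (1 - \<theta>)"
  define M where "M = block_measure g n y"
  have M: "invariant_prob M" unfolding M_def by (rule invariant_block_measure[OF n])
  note I = invariant_probD[OF M]
  interpret prob_space M by (rule I)
  let ?I = "\<integral>x. g x \<partial>M"
  \<comment> \<open>\<open>ks_entropy\<close> takes partitions labelled by \<open>nat\<close>, so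
    the letters are encoded.\<close>
  define \<xi> where "\<xi> = (\<lambda>x :: nat \<Rightarrow> 'a. to_nat (x 0))"
  have \<xi>: "\<xi> \<in> measurable shift_space (count_space UNIV)" "finite (range \<xi>)"
  proof -
    show "\<xi> \<in> measurable shift_space (count_space UNIV)"
      unfolding \<xi>_def by (rule measurable_compose[OF measurable_coordinate]) simp
    have "range \<xi> \<subseteq> range (to_nat :: 'a \<Rightarrow> nat)" by (auto simp: \<xi>_def)
    then show "finite (range \<xi>)" by (rule finite_subset) simp
  qed
  have it: "itinerary \<xi> N = (\<lambda>x. map to_nat (pref N x))" for N
    by (auto simp: itinerary_def pref_def \<xi>_def shift_funpow)
  let ?N = "\<lambda>q. Suc q * n"
  have main: "real (?N q) * (- ?I) + real q * (ln (Z g n y) - K) - (2 * K + real n * b) \<le> part_entropy M (itinerary \<xi> (?N q))" for q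
  proof -
    define B where "B = (\<lambda>w. birk g (?N q) (w \<frown> y) + K + real n * b + real q * (K - ln (Z g n y)))"
    have X: "pref (?N q) \<in> measurable M (count_space UNIV)" "finite (range (pref (?N q) :: (nat \<Rightarrow> 'a) \<Rightarrow> _))"
      using measurable_pref[of "?N q"] I(1) by (simp_all cong: measurable_cong_sets)
    have "part_entropy M (itinerary \<xi> (?N q)) = part_entropy M (pref (?N q))"
      unfolding it using I(3) by (intro part_entropy_inj inj_mapI) auto
    also have "\<dots> = - (\<Sum>v\<in>range (pref (?N q)). measure M (pref (?N q) -` {v}) * ln (measure M (pref (?N q) -` {v})))"
      by (rule part_entropy_UNIV[OF I(3)])
    also have "\<dots> \<ge> - (\<Sum>v\<in>range (pref (?N q)). measure M (pref (?N q) -` {v}) * B v)"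
    proof (subst neg_le_iff_le, rule sum_mono)
      fix v :: "'a list" assume "v \<in> range (pref (?N q))"
      then obtain x where v: "v = pref (?N q) x" by auto
      let ?m = "measure M (pref (?N q) -` {v})"
      have "?m \<le> exp (birk g (?N q) x + real n * b + real q * (K - ln (Z g n y)))"
        using block_measure_cylinder[OF n h b, where x = x and q = q and y = y] by (simp add: M_def v K_def vimage_def)
      also have "\<dots> \<le> exp (B v)"
        using birk_distortion_pref[OF h, of "?N q" x y] by (simp add: B_def v K_def abs_le_iff)
      finally have "?m \<le> exp (B v)" .
      then have "ln ?m \<le> B v" if "0 < ?m" using that by (metis ln_exp ln_mono)
      then show "?m * ln ?m \<le> ?m * B v"
        by (cases "?m = 0") (auto intro!: mult_left_mono simp: zero_less_measure_iff)
    qed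
    also have "(\<Sum>v\<in>range (pref (?N q)). measure M (pref (?N q) -` {v}) * B v) = (\<integral>x. B (pref (?N q) x) \<partial>M)"
      using integral_finite_range[OF I(2,3) X, of B] by simp
    finally have lower: "- (\<integral>x. B (pref (?N q) x) \<partial>M) \<le> part_entropy M (itinerary \<xi> (?N q))" .
    have "(\<integral>x. B (pref (?N q) x) \<partial>M) \<le> (\<integral>x. birk g (?N q) x + (2 * K + real n * b + real q * (K - ln (Z g n y))) \<partial>M)"
    proof (rule integral_mono)
      show "integrable M (\<lambda>x. birk g (?N q) x + (2 * K + real n * b + real q * (K - ln (Z g n y))))"
        using integrable_birk[OF M g] by auto
      have "bounded (B ` range (pref (?N q)))" using X(2) by (intro finite_imp_bounded) auto
      then obtain b' where b': "\<And>x. \<bar>B (pref (?N q) x)\<bar> \<le> b'" by (auto simp: bounded_iff)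
      show "integrable M (\<lambda>x. B (pref (?N q) x))"
        by (rule integrable_bounded[OF M], rule borel_measurable_pref, rule b')
      show "B (pref (?N q) x) \<le> birk g (?N q) x + (2 * K + real n * b + real q * (K - ln (Z g n y)))" for x
        using birk_distortion_pref[OF h, of "?N q" x y] by (simp add: B_def K_def abs_le_iff)
    qed
    also have "(\<integral>x. birk g (?N q) x + (2 * K + real n * b + real q * (K - ln (Z g n y))) \<partial>M) =
       real (?N q) * ?I + (2 * K + real n * b + real q * (K - ln (Z g n y)))"
      using integrable_birk[OF M g, of "?N q"] by (simp add: integral_birk[OF M g] prob_space del: mult_Suc)
    finally show ?thesis using lower by (simp add: algebra_simps)
  qed
  have sub: "strict_mono (\<lambda>q. ?N q)" using n by (auto simp: strict_mono_def)
  have "(\<lambda>n. part_entropy M (itinerary \<xi> n) / real n) \<longlonglongrightarrow> lim (\<lambda>n. part_entropy M (itinerary \<xi> n) / real n)"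
    using entropy_rate_convergent[OF M \<xi>] by (simp add: convergent_LIMSEQ_iff)
  from LIMSEQ_subseq_LIMSEQ[OF this sub]
  have L: "(\<lambda>q. part_entropy M (itinerary \<xi> (?N q)) / real (?N q)) \<longlonglongrightarrow> lim (\<lambda>n. part_entropy M (itinerary \<xi> n) / real n)"
    by (simp add: o_def)
  let ?d = "ln (Z g n y) - K"
  \<comment> \<open>Collects what does not grow with \<open>q\<close>: distortion, end pieces, and
    the one block lost in passing from \<open>Suc q\<close> to \<open>q\<close>.\<close>
  let ?e = "?d + (2 * K + real n * b)"
  have R: "(\<lambda>q. - ?I + ?d / real n - ?e / real n / real (Suc q)) \<longlonglongrightarrow> - ?I + ?d / real n - 0"
    by (intro tendsto_diff tendsto_const LIMSEQ_Suc[OF lim_const_over_n])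
  have "- ?I + ?d / real n - 0 \<le> lim (\<lambda>n. part_entropy M (itinerary \<xi> n) / real n)"
  proof (rule LIMSEQ_le[OF R L], intro exI allI impI)
    fix q
    have pos: "0 < real (?N q)" using n by (subst of_nat_0_less_iff) simp
    have "(- ?I + ?d / real n - ?e / real n / real (Suc q)) * real (?N q) =
       real (?N q) * (- ?I) + real q * ?d - (2 * K + real n * b)"
    proof -
      have "?d / real n * real (?N q) = ?d * real (Suc q)"
        unfolding of_nat_mult using n by (simp del: of_nat_Suc)
      moreover have "?e / real n / real (Suc q) * real (?N q) = ?e"
        unfolding of_nat_mult using n by (simp del: of_nat_Suc)
      ultimately show ?thesis unfolding left_diff_distrib distrib_right by (simp add: algebra_simps)
    qed
    then show "- ?I + ?d / real n - ?e / real n / real (Suc q) \<le> part_entropy M (itinerary \<xi> (?N q)) / real (?N q)"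
      using main[of q] by (subst pos_le_divide_eq[OF pos]) linarith
  qed
  also have "\<dots> \<le> ks_entropy M" by (rule entropy_rate_le_ks_entropy[OF M \<xi>])
  finally show ?thesis by (simp add: M_def K_def)
qed

theorem variational_principle:
  fixes g :: "(nat \<Rightarrow> 'a::finite) \<Rightarrow> real"
  assumes g: "holder g"
  shows "pressure g = top_pressure g"
    and "invariant_prob M \<Longrightarrow> ks_entropy M + (\<integral>x. g x \<partial>M) \<le> pressure g"
proof -
  obtain C \<theta> where h: "holder_with C \<theta> g" using g unfolding holder_iff by auto
  define y where "y = (undefined :: nat \<Rightarrow> 'a)"
  let ?S = "{M :: (nat \<Rightarrow> 'a) measure. invariant_prob M}"
  let ?P = "\<lambda>M. ks_entropy M + (\<integral>x. g x \<partial>M)"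
  have bdd: "bdd_above (?P ` ?S)" using ks_entropy_upper[OF _ g] by (intro bdd_aboveI2) auto
  have ne: "block_measure g 1 y \<in> ?S" using invariant_block_measure by auto
  show le: "ks_entropy M + (\<integral>x. g x \<partial>M) \<le> pressure g" if "invariant_prob M" for M
    unfolding pressure_def using bdd that by (intro cSUP_upper) auto
  have "pressure g \<le> top_pressure g"
    unfolding pressure_def using ne ks_entropy_upper[OF _ g] by (intro cSUP_least) auto
  moreover have "top_pressure g \<le> pressure g"
  proof (rule LIMSEQ_le_const2)
    have "(\<lambda>n. ln (Z g n y) / real n - C / (1 - \<theta>) / real n) \<longlonglongrightarrow> top_pressure g - 0"
      by (intro tendsto_diff top_pressure_LIMSEQ[OF g] lim_const_over_n)
    then show "(\<lambda>n. (ln (Z g n y) - C / (1 - \<theta>)) / real n) \<longlonglongrightarrow> top_pressure g"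
      by (simp add: diff_divide_distrib)
    show "\<exists>N. \<forall>n\<ge>N. (ln (Z g n y) - C / (1 - \<theta>)) / real n \<le> pressure g"
      using pressure_lower[OF h] le[OF invariant_block_measure] by (meson order_trans)
  qed
  ultimately show "pressure g = top_pressure g" by simp
qed

section \<open>Gibbs measures of Jacobians\<close>

text \<open>Koenig's lemma: along the branch of prefixes on which \<open>J\<close> comes arbitrarily close to \<open>0\<close>,
continuity would force \<open>J\<close> to vanish.\<close>
lemma holder_bounded_below:
  fixes J :: "(nat \<Rightarrow> 'a::finite) \<Rightarrow> real"
  assumes J: "holder J" and pos: "\<And>x. 0 < J x"
  obtains \<delta> where "0 < \<delta>" "\<And>x. \<delta> \<le> J x"
proof -
  obtain C \<theta> where h: "holder_with C \<theta> J" using J unfolding holder_iff by auto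
  note H = holder_withD[OF h]
  define bad where "bad = (\<lambda>w. \<forall>\<delta>>0. \<exists>x. pref (length w) x = w \<and> J x < \<delta>)"
  have step: "\<exists>a. bad (w @ [a])" if bw: "bad w" for w
  proof (rule ccontr)
    assume "\<not> ?thesis"
    then have "\<forall>a. \<exists>\<delta>>0. \<forall>x. pref (length (w @ [a])) x = w @ [a] \<longrightarrow> \<delta> \<le> J x"
      unfolding bad_def by (meson not_less)
    then obtain \<delta> where \<delta>: "\<And>a. 0 < \<delta> a" "\<And>a x. pref (length (w @ [a])) x = w @ [a] \<Longrightarrow> \<delta> a \<le> J x" by metis
    define d where "d = Min (range \<delta>)"
    have "0 < d" using \<delta>(1) by (simp add: d_def)
    then obtain x where x: "pref (length w) x = w" "J x < d" using bw unfolding bad_def by blast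
    have "pref (length (w @ [x (length w)])) x = w @ [x (length w)]"
      using x(1) by (simp add: pref_def)
    then have "\<delta> (x (length w)) \<le> J x" by (rule \<delta>(2))
    moreover have "d \<le> \<delta> (x (length w))" by (simp add: d_def)
    ultimately show False using x(2) by linarith
  qed
  have "\<not> bad []"
  proof
    assume b0: "bad []"
    have "\<exists>f. \<forall>n. (length (f n) = n \<and> bad (f n)) \<and> (\<exists>a. f (Suc n) = f n @ [a])"
    proof (rule dependent_nat_choice)
      show "\<exists>w. length w = 0 \<and> bad w" using b0 by auto
      fix w n assume "length w = n \<and> bad w"
      then show "\<exists>w'. (length w' = Suc n \<and> bad w') \<and> (\<exists>a. w' = w @ [a])"
        using step[of w] by (metis length_append_singleton)
    qed
    then obtain f where f: "\<And>n. length (f n) = n" "\<And>n. bad (f n)" "\<And>n. \<exists>a. f (Suc n) = f n @ [a]" by blast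
    define x where "x = (\<lambda>k. f (Suc k) ! k)"
    have fx: "pref n x = f n" for n
    proof (induction n)
      case 0
      then show ?case using f(1)[of 0] by (simp add: pref_def)
    next
      case (Suc n)
      obtain a where a: "f (Suc n) = f n @ [a]" using f(3) by blast
      then have "x n = a" using f(1)[of n] by (simp add: x_def nth_append)
      then show ?case using Suc a by (simp add: pref_def)
    qed
    have "(\<lambda>n. C * \<theta> ^ n) \<longlonglongrightarrow> 0"
      using H by (intro tendsto_mult_right_zero LIMSEQ_realpow_zero) auto
    then obtain n where n: "C * \<theta> ^ n < J x / 2"
      using pos[of x] by (metis (no_types, lifting) eventually_sequentially half_gt_zero order_refl order_tendstoD(2))
    obtain z where z: "pref (length (f n)) z = f n" "J z < J x / 2"
      using f(2)[of n] pos[of x] unfolding bad_def by (meson half_gt_zero)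
    have "agree n x z" using z(1) fx[of n] f(1)[of n] by (simp add: pref_eq_iff[symmetric])
    then have "\<bar>J x - J z\<bar> \<le> C * \<theta> ^ n" by (rule H(4))
    then show False using n z(2) by (simp add: abs_le_iff)
  qed
  then show thesis using that unfolding bad_def by (force simp: pref_def not_less)
qed

section \<open>Normalised potentials\<close>

lemma holder_ln_jacobian:
  fixes J :: "(nat \<Rightarrow> 'a::finite) \<Rightarrow> real"
  assumes "jacobian J"
  shows "holder (\<lambda>x. ln (J x))"
proof -
  have J: "holder J" "\<And>x. 0 < J x" using assms by (auto simp: jacobian_def)
  obtain \<delta> where \<delta>: "0 < \<delta>" "\<And>x. \<delta> \<le> J x" by (rule holder_bounded_below[OF J]) blast+
  obtain C \<theta> where h: "holder_with C \<theta> J" using J(1) unfolding holder_iff by auto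
  have one: "ln (J x) - ln (J y) \<le> \<bar>J x - J y\<bar> / \<delta>" for x y
  proof -
    have "ln (J x / J y) \<le> J x / J y - 1" using J(2) by (intro ln_le_minus_one) auto
    also have "\<dots> = (J x - J y) / J y" using J(2)[of y] by (simp add: field_simps)
    also have "\<dots> \<le> \<bar>J x - J y\<bar> / \<delta>" using \<delta> by (intro frac_le) auto
    finally show ?thesis using J(2)[of x] J(2)[of y] by (simp add: ln_div)
  qed
  have "holder_with (C / \<delta>) \<theta> (\<lambda>x. ln (J x))"
    unfolding holder_with_def
  proof (intro conjI allI impI)
    fix n x y assume "agree n x (y :: nat \<Rightarrow> 'a)"
    then have "\<bar>J x - J y\<bar> / \<delta> \<le> C * \<theta> ^ n / \<delta>" using holder_withD(4)[OF h] \<delta> by (intro divide_right_mono) auto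
    then show "\<bar>ln (J x) - ln (J y)\<bar> \<le> C / \<delta> * \<theta> ^ n"
      using one[of x y] one[of y x] by (simp add: abs_le_iff abs_minus_commute)
  qed (use holder_withD[OF h] in auto)
  then show ?thesis using holder_iff by blast
qed

lemma words_1: "words 1 = range (\<lambda>a. [a])"
  by (auto simp: words_def length_Suc_conv)

text \<open>The preimages of \<open>y\<close> arise by prepending one letter, so the Jacobian
  identity says that the one-step transfer operator fixes the constant \<open>1\<close>;
  iterate.\<close>

lemma Z_jacobian:
  fixes J :: "(nat \<Rightarrow> 'a::finite) \<Rightarrow> real"
  assumes "jacobian J"
  shows "Z (\<lambda>x. ln (J x)) n y = 1"
proof (induction n arbitrary: y)
  case (Suc n)
  have J: "\<And>x. 0 < J x" "\<And>x. (\<Sum>z | shift z = x. J z) = 1" using assms by (auto simp: jacobian_def)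
  have 1: "(\<Sum>w\<in>words 1. exp (birk (\<lambda>x. ln (J x)) 1 (w \<frown> y))) = 1" for y
  proof -
    have "{z. shift z = y} = (\<lambda>a. [a] \<frown> y) ` UNIV"
    proof
      show "{z. shift z = y} \<subseteq> (\<lambda>a. [a] \<frown> y) ` UNIV"
      proof
        fix z assume "z \<in> {z. shift z = y}"
        then have y: "y = shift z" by simp
        have "z k = ([z 0] \<frown> y) k" for k by (cases k) (auto simp: y shift_def conc_def)
        then have "z = [z 0] \<frown> y" by blast
        then show "z \<in> (\<lambda>a. [a] \<frown> y) ` UNIV" by blast
      qed
    qed (auto simp: shift_def conc_def)
    moreover have "inj (\<lambda>a. [a] \<frown> y)" by (rule injI) (metis conc_def length_Cons zero_less_Suc nth_Cons_0)
    ultimately have "(\<Sum>a\<in>UNIV. J ([a] \<frown> y)) = 1" using J(2)[of y] by (simp add: sum.reindex)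
    then show ?thesis
      unfolding words_1 by (subst sum.reindex) (auto simp: inj_on_def birk_def J(1))
  qed
  then show ?case using Z_add[of "\<lambda>x. ln (J x)" n 1 y] Suc by simp
qed simp

lemma top_pressure_jacobian:
  fixes J :: "(nat \<Rightarrow> 'a::finite) \<Rightarrow> real"
  assumes "jacobian J"
  shows "top_pressure (\<lambda>x. ln (J x)) = 0"
  by (simp add: top_pressure_def Z_jacobian[OF assms])

text \<open>Divide by \<open>e\<close> and let it tend to zero. Applied to a quantity and to its
  negative, this extracts slopes from quadratic bounds.\<close>

lemma le_of_quadratic_error:
  fixes a v B :: real
  assumes "\<And>e. 0 < e \<Longrightarrow> e \<le> 1 \<Longrightarrow> e * a \<le> e * v + B * e\<^sup>2"
  shows "a \<le> v"
proof (rule LIMSEQ_le_const)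
  show "\<exists>N. \<forall>n\<ge>N. a \<le> v + B * (1 / real (Suc n))"
  proof (intro exI allI impI)
    fix n
    let ?e = "1 / real (Suc n)"
    have "?e * a \<le> ?e * (v + B * ?e)" using assms[of ?e] by (simp add: power2_eq_square algebra_simps)
    then show "a \<le> v + B * ?e" by (rule mult_left_le_imp_le) simp
  qed
  have "(\<lambda>n. v + B * (1 / real (Suc n))) \<longlonglongrightarrow> v + B * 0"
    by (intro tendsto_intros LIMSEQ_Suc[OF lim_const_over_n])
  then show "(\<lambda>n. v + B * (1 / real (Suc n))) \<longlonglongrightarrow> v" by simp
qed

text \<open>The variational inequality for \<open>g + e f\<close> minus the equality for
  \<open>g\<close>. Both signs of \<open>e\<close> are allowed, which pins the integral to the slope
  of the pressure.\<close>

lemma equilibrium_tangent: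
  fixes g f :: "(nat \<Rightarrow> 'a::finite) \<Rightarrow> real"
  assumes "equilibrium g \<mu>" "holder g" "holder f"
  shows "e * (\<integral>x. f x \<partial>\<mu>) \<le> top_pressure (\<lambda>x. g x + e * f x) - top_pressure g"
proof -
  have inv: "invariant_prob \<mu>" and eq: "ks_entropy \<mu> + (\<integral>x. g x \<partial>\<mu>) = top_pressure g"
    using assms variational_principle(1)[of g] by (auto simp: equilibrium_def)
  have "ks_entropy \<mu> + (\<integral>x. g x + e * f x \<partial>\<mu>) \<le> top_pressure (\<lambda>x. g x + e * f x)"
    using ks_entropy_upper[OF inv holder_lin[OF assms(2,3)]] .
  then show ?thesis
    using eq integrable_holder[OF inv assms(2)] integrable_holder[OF inv assms(3)] by simp
qed

text \<open>Makes cylinder indicators admissible perturbations of the potential. The bound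
  \<open>2 ^ n * (1/2) ^ k\<close> is at least one while \<open>k < n\<close>; from
  \<open>k = n\<close> on the two values coincide.\<close>

lemma holder_cylinder: "holder (\<lambda>x. of_bool (pref n x = w))"
proof -
  have "holder_with (2 ^ n) (1/2) (\<lambda>x. of_bool (pref n x = w))"
    unfolding holder_with_def
  proof (intro conjI allI impI)
    fix k x y assume a: "agree k x (y :: nat \<Rightarrow> 'a)"
    show "\<bar>of_bool (pref n x = w) - of_bool (pref n y = w)\<bar> \<le> 2 ^ n * (1/2::real) ^ k"
    proof (cases "n \<le> k")
      case True
      then have "agree n x y" using a by (auto simp: agree_def)
      then have "pref n x = pref n y" by (simp add: pref_eq_iff)
      then show ?thesis by simp
    next
      case False
      then have "(2::real) ^ k \<le> 2 ^ n" by (intro power_increasing) auto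
      then have "1 \<le> 2 ^ n * (1/2::real) ^ k" by (simp add: power_divide)
      then show ?thesis by (simp add: of_bool_def)
    qed
  qed auto
  then show ?thesis using holder_iff by blast
qed

lemma measure_cylinder_integral:
  fixes w :: "'a::finite list"
  assumes "invariant_prob \<mu>"
  shows "(\<integral>x. of_bool (pref n x = w) \<partial>\<mu>) = measure \<mu> {x. pref n x = w}"
proof -
  have "(\<lambda>x. of_bool (pref n x = w)) = (indicator {x. pref n x = w} :: _ \<Rightarrow> real)"
    by (auto simp: indicator_def)
  then show ?thesis using invariant_probD[OF assms] sets_pref[of n w] by simp
qed

definition transfer :: "((nat \<Rightarrow> 'a::finite) \<Rightarrow> real) \<Rightarrow> nat \<Rightarrow> ((nat \<Rightarrow> 'a) \<Rightarrow> real) \<Rightarrow> (nat \<Rightarrow> 'a) \<Rightarrow> real" where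
  "transfer g n f y = (\<Sum>u\<in>words n. exp (birk g n (u \<frown> y)) * f (u \<frown> y))"

lemma transfer_add:
  "transfer g (n + k) f y = (\<Sum>v\<in>words k. exp (birk g k (v \<frown> y)) * transfer g n f (v \<frown> y))"
  unfolding transfer_def sum_words_add sum_distrib_left
proof (intro sum.cong refl)
  fix v u :: "'a list" assume "u \<in> words n"
  then have "birk g (n + k) ((u @ v) \<frown> y) = birk g n (u \<frown> v \<frown> y) + birk g k (v \<frown> y)"
    by (intro birk_append) (simp add: words_def)
  then show "exp (birk g (n + k) ((u @ v) \<frown> y)) * f ((u @ v) \<frown> y) =
      exp (birk g k (v \<frown> y)) * (exp (birk g n (u \<frown> v \<frown> y)) * f (u \<frown> v \<frown> y))"
    by (simp only: exp_add conc_append) (simp add: mult_ac)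
qed

text \<open>For normalised weights the letters before position \<open>j\<close> sum out, so the
  expectation of \<open>f\<close> at time \<open>j\<close> is the transfer iterate of order
  \<open>N - j\<close>; reindexing gives the sum.\<close>

lemma mean_eq_sum_transfer:
  assumes Z1: "\<And>n y. Z g n y = 1"
  shows "mean g f N y = (\<Sum>k<N. transfer g (Suc k) f y)"
proof (induction N)
  case (Suc N)
  have "mean g f (Suc N) y = (\<Sum>x\<in>words (1 + N). exp (birk g (1 + N) (x \<frown> y)) * birk f (1 + N) (x \<frown> y))"
    by (simp add: mean_def Z1)
  also have "\<dots> = (\<Sum>w\<in>words N. \<Sum>a\<in>words 1. exp (birk g 1 (a \<frown> w \<frown> y)) * (exp (birk g N (w \<frown> y)) * birk f N (w \<frown> y)) +
      exp (birk g (1 + N) ((a @ w) \<frown> y)) * f ((a @ w) \<frown> y))"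
    unfolding sum_words_add
  proof (intro sum.cong refl)
    fix w a :: "'a list" assume "a \<in> words 1"
    then have "birk h (1 + N) ((a @ w) \<frown> y) = birk h 1 (a \<frown> w \<frown> y) + birk h N (w \<frown> y)" for h
      by (intro birk_append) (simp add: words_def)
    moreover have "birk f 1 (a \<frown> w \<frown> y) = f ((a @ w) \<frown> y)" by (simp add: birk_def conc_append)
    ultimately show "exp (birk g (1 + N) ((a @ w) \<frown> y)) * birk f (1 + N) ((a @ w) \<frown> y) =
      exp (birk g 1 (a \<frown> w \<frown> y)) * (exp (birk g N (w \<frown> y)) * birk f N (w \<frown> y)) +
      exp (birk g (1 + N) ((a @ w) \<frown> y)) * f ((a @ w) \<frown> y)"
      by (simp only: exp_add distrib_left; simp add: mult_ac)
  qed
  also have "\<dots> = (\<Sum>w\<in>words N. Z g 1 (w \<frown> y) * (exp (birk g N (w \<frown> y)) * birk f N (w \<frown> y))) + transfer g (1 + N) f y"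
    unfolding transfer_def sum_words_add sum.distrib Z_def sum_distrib_right ..
  also have "\<dots> = mean g f N y + transfer g (Suc N) f y"
    by (simp add: Z1 mean_def)
  finally show ?case using Suc by simp
qed simp

lemma sum_exp_bounds:
  assumes "Z g k y = 1" "\<And>v. v \<in> words k \<Longrightarrow> lo \<le> F v \<and> F v \<le> hi"
  shows "lo \<le> (\<Sum>v\<in>words k. exp (birk g k (v \<frown> y)) * F v) \<and> (\<Sum>v\<in>words k. exp (birk g k (v \<frown> y)) * F v) \<le> hi"
proof -
  have "(\<Sum>v\<in>words k. exp (birk g k (v \<frown> y)) * c) = c" for c
    using assms(1) by (simp add: sum_distrib_right[symmetric] Z_def)
  moreover have "(\<Sum>v\<in>words k. exp (birk g k (v \<frown> y)) * lo) \<le> (\<Sum>v\<in>words k. exp (birk g k (v \<frown> y)) * F v)"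
    "(\<Sum>v\<in>words k. exp (birk g k (v \<frown> y)) * F v) \<le> (\<Sum>v\<in>words k. exp (birk g k (v \<frown> y)) * hi)"
    using assms(2) by (intro sum_mono mult_left_mono; simp)+
  ultimately show ?thesis by simp
qed

text \<open>The test function is a cylinder indicator \<open>f\<close>. Its means per letter are
  asymptotically between \<open>lo\<close> and \<open>hi\<close>, which bounds the pressure of
  \<open>g + e f\<close> from above to first order with a quadratic error. Since the measure is
  tangent to the pressure, its value on the cylinder lies between the same numbers. Convergence of
  the means is never invoked.\<close>

lemma gibbs_cylinder_bounds:
  fixes J :: "(nat \<Rightarrow> 'a::finite) \<Rightarrow> real"
  assumes J: "jacobian J" and \<mu>: "gibbs J \<mu>"
  obtains K where "0 \<le> K"
    "\<And>n x. exp (birk (\<lambda>x. ln (J x)) n x - K) \<le> measure \<mu> {z. pref n z = pref n x}"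
    "\<And>n x. measure \<mu> {z. pref n z = pref n x} \<le> exp (birk (\<lambda>x. ln (J x)) n x + K)"
proof -
  define g where "g = (\<lambda>x. ln (J x))"
  have g: "holder g" unfolding g_def by (rule holder_ln_jacobian[OF J])
  have Z1: "Z g n y = 1" for n y unfolding g_def by (rule Z_jacobian[OF J])
  have P0: "top_pressure g = 0" unfolding g_def by (rule top_pressure_jacobian[OF J])
  have eq: "equilibrium g \<mu>" using \<mu> by (simp add: gibbs_def g_def)
  have inv: "invariant_prob \<mu>" using eq by (simp add: equilibrium_def)
  obtain C \<theta> where h: "holder_with C \<theta> g" using g unfolding holder_iff by auto
  define K where "K = C / (1 - \<theta>)"
  have K: "0 \<le> K" using holder_withD[OF h] by (simp add: K_def)
  define y where "y = (undefined :: nat \<Rightarrow> 'a)"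
  have both: "exp (birk g n x - K) \<le> measure \<mu> {z. pref n z = pref n x} \<and> measure \<mu> {z. pref n z = pref n x} \<le> exp (birk g n x + K)" for n x
  proof -
    define w where "w = pref n x"
    define f where "f = (\<lambda>z. of_bool (pref n z = w) :: real)"
    have f: "holder f" unfolding f_def by (rule holder_cylinder)
    define lo where "lo = exp (birk g n x - K)"
    define hi where "hi = exp (birk g n x + K)"
    have Tn: "transfer g n f z = exp (birk g n (w \<frown> z))" for z
    proof -
      have "transfer g n f z = (\<Sum>u\<in>words n. if u = w then exp (birk g n (w \<frown> z)) else 0)"
        unfolding transfer_def f_def by (intro sum.cong refl) (auto simp: words_def pref_conc)
      then show ?thesis by (simp add: w_def)
    qed
    \<comment> \<open>Once the cylinder is covered, further letters only average over boundaries, on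
      which the weight depends up to distortion.\<close>
    have Tlohi: "lo \<le> transfer g (n + k) f y \<and> transfer g (n + k) f y \<le> hi" for k
      unfolding transfer_add
    proof (rule sum_exp_bounds[OF Z1])
      fix v :: "'a list"
      show "lo \<le> transfer g n f (v \<frown> y) \<and> transfer g n f (v \<frown> y) \<le> hi"
        using birk_distortion_pref[OF h, of n x "v \<frown> y"] by (simp add: Tn lo_def hi_def w_def K_def abs_le_iff)
    qed
    have T01: "0 \<le> transfer g k f y \<and> transfer g k f y \<le> 1" for k
      unfolding transfer_def by (rule sum_exp_bounds[OF Z1]) (simp add: f_def)
    \<comment> \<open>The first \<open>n\<close> iterates are bounded by \<open>1\<close>; their
      contribution \<open>real n\<close> vanishes after division by \<open>N\<close>.\<close>
    have mean_le: "mean g f N y \<le> real n + real N * hi" for N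
    proof -
      have "mean g f N y \<le> (\<Sum>k<N. (if k < n then 1 else 0) + hi)"
        unfolding mean_eq_sum_transfer[OF Z1]
      proof (rule sum_mono)
        fix k
        show "transfer g (Suc k) f y \<le> (if k < n then 1 else 0) + hi"
          using T01[of "Suc k"] Tlohi[of "Suc k - n"] by (auto simp: hi_def intro: order_trans[OF _ less_imp_le[OF less_add_same_cancel1[THEN iffD2]]])
      qed
      also have "\<dots> = real (card {k\<in>{..<N}. k < n}) + real N * hi"
        by (simp add: sum.distrib sum.If_cases Int_def)
      also have "card {k\<in>{..<N}. k < n} \<le> card {..<n}" by (intro card_mono) auto
      finally show ?thesis by simp
    qed
    have mean_ge: "real N * lo - real n * lo \<le> mean g f N y" for N
    proof -
      have "(\<Sum>k<N. lo - (if k < n then lo else 0)) \<le> mean g f N y"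
        unfolding mean_eq_sum_transfer[OF Z1]
      proof (rule sum_mono)
        fix k
        show "lo - (if k < n then lo else 0) \<le> transfer g (Suc k) f y"
          using T01[of "Suc k"] Tlohi[of "Suc k - n"] by auto
      qed
      moreover have "(\<Sum>k<N. lo - (if k < n then lo else 0)) = real N * lo - real (card {k\<in>{..<N}. k < n}) * lo"
        by (simp add: sum_subtractf sum.If_cases Int_def)
      moreover have "real (card {k\<in>{..<N}. k < n}) * lo \<le> real n * lo"
      proof -
        have "card {k\<in>{..<N}. k < n} \<le> card {..<n}" by (intro card_mono) auto
        then show ?thesis by (intro mult_right_mono) (auto simp: lo_def)
      qed
      ultimately show ?thesis by linarith
    qed
    define m where "m = measure \<mu> {z. pref n z = w}"
    have int: "(\<integral>x. f x \<partial>\<mu>) = m" unfolding f_def m_def by (rule measure_cylinder_integral[OF inv])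
    obtain B \<delta> where B: "0 \<le> B" and taylor: "\<And>N y s t. \<bar>s\<bar> \<le> 1 \<Longrightarrow> \<bar>t\<bar> \<le> 1 \<Longrightarrow> ln (Z (\<lambda>x. g x + s * f x) N y)
        \<le> ln (Z (\<lambda>x. g x + t * f x) N y) + (s - t) * mean (\<lambda>x. g x + t * f x) f N y + real N * (B * (s - t)\<^sup>2)"
      by (rule top_pressure_second_order[OF g f, of 1]) blast
    \<comment> \<open>Positive \<open>e\<close> bounds the measure from above by \<open>hi\<close>,
      negative \<open>e\<close> from below by \<open>lo\<close>. The constant \<open>d\<close>
      disappears in the limit.\<close>
    have key: "e * m \<le> e * c + B * e\<^sup>2" if e: "\<bar>e\<bar> \<le> 1" and c: "\<And>N. e * mean g f N y \<le> d + real N * (e * c)" for e c d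
    proof -
      have "top_pressure (\<lambda>x. g x + e * f x) \<le> e * c + B * e\<^sup>2"
      proof (rule LIMSEQ_le)
        show "(\<lambda>N. ln (Z (\<lambda>x. g x + e * f x) N y) / real N) \<longlonglongrightarrow> top_pressure (\<lambda>x. g x + e * f x)"
          by (rule top_pressure_LIMSEQ[OF holder_lin[OF g f]])
        have "(\<lambda>N. d / real N + (e * c + B * e\<^sup>2)) \<longlonglongrightarrow> 0 + (e * c + B * e\<^sup>2)"
          by (intro tendsto_intros lim_const_over_n)
        then show "(\<lambda>N. d / real N + (e * c + B * e\<^sup>2)) \<longlonglongrightarrow> e * c + B * e\<^sup>2" by simp
        show "\<exists>N0. \<forall>N\<ge>N0. ln (Z (\<lambda>x. g x + e * f x) N y) / real N \<le> d / real N + (e * c + B * e\<^sup>2)"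
        proof (intro exI allI impI)
          fix N :: nat assume N: "1 \<le> N"
          have "ln (Z (\<lambda>x. g x + e * f x) N y) \<le> e * mean g f N y + real N * (B * e\<^sup>2)"
            using taylor[of e 0 N y] e by (simp add: Z1)
          also have "\<dots> \<le> d + real N * (e * c + B * e\<^sup>2)" using c[of N] by (simp add: algebra_simps)
          finally show "ln (Z (\<lambda>x. g x + e * f x) N y) / real N \<le> d / real N + (e * c + B * e\<^sup>2)"
            using N by (simp add: field_simps)
        qed
      qed
      then show ?thesis using equilibrium_tangent[OF eq g f, of e] by (simp add: int P0)
    qed
    have "m \<le> hi"
    proof (rule le_of_quadratic_error)
      fix e :: real assume e: "0 < e" "e \<le> 1"
      have "e * mean g f N y \<le> e * real n + real N * (e * hi)" for N
        using mult_left_mono[OF mean_le[of N], of e] e by (simp add: algebra_simps)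
      then show "e * m \<le> e * hi + B * e\<^sup>2" using e by (intro key) auto
    qed
    moreover have "- m \<le> - lo"
    proof (rule le_of_quadratic_error)
      fix e :: real assume e: "0 < e" "e \<le> 1"
      have "- e * mean g f N y \<le> e * (real n * lo) + real N * (- e * lo)" for N
        using mult_left_mono[OF mean_ge[of N], of e] e by (simp add: algebra_simps)
      then have "- e * m \<le> - e * lo + B * (- e)\<^sup>2" using e by (intro key) auto
      then show "e * - m \<le> e * - lo + B * e\<^sup>2" by simp
    qed
    ultimately show ?thesis by (simp add: m_def lo_def hi_def w_def)
  qed
  show thesis using both K by (intro that[of K]) (auto simp: g_def)
qed

section \<open>Bounded Birkhoff differences and uniqueness of the Gibbs measure\<close>

lemma top_pressure_birk_bounded:
  fixes g D :: "(nat \<Rightarrow> 'a::finite) \<Rightarrow> real"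
  assumes g: "holder g" and D: "holder D" and b: "\<And>n x. \<bar>birk D n x\<bar> \<le> b"
  shows "top_pressure (\<lambda>x. g x + D x) = top_pressure g"
proof -
  define y where "y = (undefined :: nat \<Rightarrow> 'a)"
  have gD: "holder (\<lambda>x. g x + D x)" using holder_lin[OF g D, of 1] by simp
  have le: "ln (Z h n y) \<le> b + ln (Z h' n y)" if "\<And>x. birk h n x \<le> b + birk h' n x" for h h' n
  proof -
    have "Z h n y \<le> (\<Sum>w\<in>words n. exp b * exp (birk h' n (w \<frown> y)))"
      unfolding Z_def exp_add[symmetric] using that by (intro sum_mono) simp
    also have "\<dots> = exp b * Z h' n y" by (simp add: Z_def sum_distrib_left)
    finally have "ln (Z h n y) \<le> ln (exp b * Z h' n y)" by (subst ln_le_cancel_iff) auto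
    then show ?thesis by (simp add: ln_mult)
  qed
  have add: "birk (\<lambda>x. g x + D x) n x = birk g n x + birk D n x" for n x
    using birk_lin[of g 1 D] by simp
  have "ln (Z (\<lambda>x. g x + D x) n y) \<le> b + ln (Z g n y)" "ln (Z g n y) \<le> b + ln (Z (\<lambda>x. g x + D x) n y)" for n
  proof -
    fix n
    have 1: "birk D n x \<le> b" "- birk D n x \<le> b" for x using b[of n x] by (auto simp: abs_le_iff)
    show "ln (Z (\<lambda>x. g x + D x) n y) \<le> b + ln (Z g n y)"
      by (rule le) (use 1(1) add in simp)
    show "ln (Z g n y) \<le> b + ln (Z (\<lambda>x. g x + D x) n y)"
    proof (rule le)
      fix x show "birk g n x \<le> b + birk (\<lambda>x. g x + D x) n x" using 1(2)[of x] add[of n x] by linarith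
    qed
  qed
  then have d: "\<bar>ln (Z (\<lambda>x. g x + D x) n y) - ln (Z g n y)\<bar> \<le> b" for n
    by (simp add: abs_le_iff algebra_simps)
  have "(\<lambda>n. ln (Z (\<lambda>x. g x + D x) n y) / real n - ln (Z g n y) / real n) \<longlonglongrightarrow> 0"
  proof (rule Lim_null_comparison)
    show "\<forall>\<^sub>F n in sequentially. norm (ln (Z (\<lambda>x. g x + D x) n y) / real n - ln (Z g n y) / real n) \<le> b / real n"
    proof (intro always_eventually allI)
      fix n
      show "norm (ln (Z (\<lambda>x. g x + D x) n y) / real n - ln (Z g n y) / real n) \<le> b / real n"
        using divide_right_mono[OF d[of n], of "real n"] by (simp add: diff_divide_distrib[symmetric])
    qed
  qed (rule lim_const_over_n)
  moreover have "(\<lambda>n. ln (Z (\<lambda>x. g x + D x) n y) / real n - ln (Z g n y) / real n) \<longlonglongrightarrow> top_pressure (\<lambda>x. g x + D x) - top_pressure g"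
    by (intro tendsto_diff top_pressure_LIMSEQ g gD)
  ultimately show ?thesis using LIMSEQ_unique by fastforce
qed

lemma invariant_prob_eqI:
  fixes \<mu> \<nu> :: "(nat \<Rightarrow> 'a::finite) measure"
  assumes "invariant_prob \<mu>" "invariant_prob \<nu>"
    and eq: "\<And>n w. measure \<mu> {x. pref n x = w} = measure \<nu> {x. pref n x = w}"
  shows "\<mu> = \<nu>"
proof -
  note I = invariant_probD[OF assms(1)] and I' = invariant_probD[OF assms(2)]
  interpret M: prob_space \<mu> by (rule I)
  interpret N: prob_space \<nu> by (rule I')
  \<comment> \<open>Unions of cylinders of one length are closed under intersection, by refining to
    the larger length; single cylinders determine them by finite additivity.\<close>
  define E where "E = (\<Union>n. range (\<lambda>W. {x :: nat \<Rightarrow> 'a. pref n x \<in> W}))"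
  have Es: "E \<subseteq> sets shift_space"
    using measurable_sets[OF measurable_pref] by (auto simp: E_def vimage_def)
  have pref_take: "pref n x = take n (pref m x)" if "n \<le> m" for n m and x :: "nat \<Rightarrow> 'a"
    using that by (simp add: list_eq_iff_nth_eq)
  have Qsum: "measure \<rho> {x. pref n x \<in> W} = (\<Sum>w\<in>W \<inter> words n. measure \<rho> {x. pref n x = w})"
    if "invariant_prob \<rho>" for \<rho> :: "(nat \<Rightarrow> 'a) measure" and n W
  proof -
    interpret R: prob_space \<rho> using that by (rule invariant_probD)
    have "{x. pref n x \<in> W} = (\<Union>w\<in>W \<inter> words n. {x. pref n x = w})" by auto
    then show ?thesis
      using sets_pref[of n] invariant_probD(1)[OF that]
      by (simp only:) (rule R.finite_measure_finite_Union, auto simp: disjoint_family_on_def finite_subset[OF Int_lower2 finite_words])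
  qed
  show ?thesis
  proof (rule measure_eqI_generator_eq[where E = E and \<Omega> = UNIV and A = "\<lambda>_. UNIV"])
    show "Int_stable E"
    proof (rule Int_stableI)
      fix a b assume "a \<in> E" "b \<in> E"
      then obtain n W m V where ab: "a = {x. pref n x \<in> W}" "b = {x. pref m x \<in> V}" by (auto simp: E_def)
      have "a \<inter> b = {x. pref (max n m) x \<in> {u. take n u \<in> W \<and> take m u \<in> V}}"
        using pref_take[of n "max n m"] pref_take[of m "max n m"] by (auto simp: ab)
      then show "a \<inter> b \<in> E" unfolding E_def by blast
    qed
    show "E \<subseteq> Pow UNIV" by simp
    have gen: "sets (shift_space :: (nat \<Rightarrow> 'a) measure) = sigma_sets UNIV E"
    proof
      show "sigma_sets UNIV E \<subseteq> sets shift_space"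
        using sets.sigma_sets_subset[OF Es] by simp
      show "sets (shift_space :: (nat \<Rightarrow> 'a) measure) \<subseteq> sigma_sets UNIV E"
        unfolding sets_shift_space
      proof (rule sigma_sets_mono', safe)
        fix k and B :: "'a set"
        have "(\<lambda>x. x k) -` B = {x :: nat \<Rightarrow> 'a. pref (Suc k) x \<in> {u. u ! k \<in> B}}" by auto
        then show "(\<lambda>x. x k) -` B \<in> E" unfolding E_def by blast
      qed
    qed
    show "sets \<mu> = sigma_sets UNIV E" "sets \<nu> = sigma_sets UNIV E" using I I' gen by auto
    show "emeasure \<mu> X = emeasure \<nu> X" if "X \<in> E" for X
      using that Qsum[OF assms(1)] Qsum[OF assms(2)] eq
      by (auto simp: E_def M.emeasure_eq_measure N.emeasure_eq_measure)
    have "(UNIV :: (nat \<Rightarrow> 'a) set) = {x. pref 0 x \<in> UNIV}" by simp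
    then show "range (\<lambda>_. UNIV) \<subseteq> E" unfolding E_def by blast
  qed (auto simp: M.emeasure_eq_measure)
qed

text \<open>Some common continuation brings the two prefixes within \<open>M\<close>; distortion
  then passes to the continuations of \<open>x\<close> and \<open>y\<close>.\<close>

lemma not_oscillates_bounded:
  fixes D :: "(nat \<Rightarrow> 'a::finite) \<Rightarrow> real"
  assumes D: "holder D" and no: "\<not> oscillates D"
  obtains M where "\<And>n x y. birk D n x - birk D n y \<le> M"
proof -
  obtain C \<theta> where h: "holder_with C \<theta> D" using D unfolding holder_iff by auto
  define K where "K = C / (1 - \<theta>)"
  obtain M where M: "\<And>l u v. length u = l \<Longrightarrow> length v = l \<Longrightarrow> \<not> (\<forall>y. birk D l (u \<frown> y) - birk D l (v \<frown> y) \<ge> M)"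
    using no unfolding oscillates_def by blast
  have "birk D n x - birk D n y \<le> M + 2 * K" for n x y
  proof -
    obtain z where "birk D n (pref n x \<frown> z) - birk D n (pref n y \<frown> z) < M" using M[of "pref n x" n "pref n y"] by (auto simp: not_le)
    then show ?thesis
      using birk_distortion_pref[OF h, of n x z] birk_distortion_pref[OF h, of n y z] by (simp add: K_def abs_le_iff)
  qed
  then show thesis by (rule that)
qed

text \<open>When the Birkhoff sums of the difference are bounded, both potentials have the same
  pressure under every perturbation. Both measures are then tangent to one functional with a unique
  slope in each direction, so they agree on cylinders.\<close>

lemma gibbs_unique_up_to_coboundary:
  fixes J0 J1 :: "(nat \<Rightarrow> 'a::finite) \<Rightarrow> real"
  assumes J0: "jacobian J0" and J1: "jacobian J1" and g0: "gibbs J0 \<mu>0" and g1: "gibbs J1 \<mu>1"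
    and no: "\<not> oscillates (\<lambda>x. ln (J1 x) - ln (J0 x))"
  shows "\<mu>0 = \<mu>1"
proof -
  let ?g0 = "\<lambda>x. ln (J0 x)" and ?g1 = "\<lambda>x. ln (J1 x)"
  let ?D = "\<lambda>x. ?g1 x - ?g0 x"
  have h: "holder ?g0" "holder ?g1" using holder_ln_jacobian J0 J1 by auto
  have D: "holder ?D" using holder_lin[OF h(2,1), of "-1"] by simp
  obtain M where M: "\<And>n x y. birk ?D n x - birk ?D n y \<le> M" using not_oscillates_bounded[OF D no] by blast
  have M0: "0 \<le> M" using M[of 0] by simp
  \<comment> \<open>So far only differences of Birkhoff sums are bounded. Normalisation of both
    Jacobians makes the weighted average of their exponentials equal to one, which bounds the sums
    themselves.\<close>
  have bd: "\<bar>birk ?D n x\<bar> \<le> M" for n x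
  proof -
    have eq: "birk ?g1 n z = birk ?g0 n z + birk ?D n z" for z by (simp add: birk_diff)
    have "(\<Sum>w\<in>words n. exp (birk ?g0 n (w \<frown> x)) * exp (birk ?D n (w \<frown> x))) = 1"
      using Z_jacobian[OF J1, of n x] by (simp add: Z_def eq exp_add)
    moreover have "exp (birk ?D n x - M) \<le> (\<Sum>w\<in>words n. exp (birk ?g0 n (w \<frown> x)) * exp (birk ?D n (w \<frown> x))) \<and>
       (\<Sum>w\<in>words n. exp (birk ?g0 n (w \<frown> x)) * exp (birk ?D n (w \<frown> x))) \<le> exp (birk ?D n x + M)"
    proof (rule sum_exp_bounds[OF Z_jacobian[OF J0]])
      fix v :: "'a list"
      show "exp (birk ?D n x - M) \<le> exp (birk ?D n (v \<frown> x)) \<and> exp (birk ?D n (v \<frown> x)) \<le> exp (birk ?D n x + M)"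
        using M[of n x "v \<frown> x"] M[of n "v \<frown> x" x] by simp
    qed
    ultimately show ?thesis by (simp add: abs_le_iff)
  qed
  have inv: "invariant_prob \<mu>0" "invariant_prob \<mu>1" using g0 g1 by (auto simp: gibbs_def equilibrium_def)
  show ?thesis
  proof (rule invariant_prob_eqI[OF inv])
    fix n and w :: "'a list"
    define f where "f = (\<lambda>z. of_bool (pref n z = w) :: real)"
    have f: "holder f" unfolding f_def by (rule holder_cylinder)
    have P: "top_pressure (\<lambda>x. ?g1 x + e * f x) = top_pressure (\<lambda>x. ?g0 x + e * f x)" for e
    proof -
      have "(\<lambda>x. ?g1 x + e * f x) = (\<lambda>x. (?g0 x + e * f x) + ?D x)" by auto
      then show ?thesis using top_pressure_birk_bounded[OF holder_lin[OF h(1) f] D bd] by simp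
    qed
    obtain B v where B: "\<And>s. \<bar>s\<bar> \<le> 1 \<Longrightarrow> top_pressure (\<lambda>x. ?g0 x + s * f x) - top_pressure (\<lambda>x. ?g0 x + 0 * f x) - (s - 0) * v \<le> B * (s - 0)\<^sup>2"
    proof (rule top_pressure_second_order[OF h(1) f, of 1])
      fix B \<delta>
      assume "\<And>t. \<bar>t\<bar> \<le> 1 \<Longrightarrow> \<exists>v. \<forall>s. \<bar>s\<bar> \<le> 1 \<longrightarrow>
        \<delta> * (s - t)\<^sup>2 \<le> top_pressure (\<lambda>x. ?g0 x + s * f x) - top_pressure (\<lambda>x. ?g0 x + t * f x) - (s - t) * v \<and>
        top_pressure (\<lambda>x. ?g0 x + s * f x) - top_pressure (\<lambda>x. ?g0 x + t * f x) - (s - t) * v \<le> B * (s - t)\<^sup>2"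
      from this[of 0] show thesis using that by auto
    qed
    have eq: "(\<integral>x. f x \<partial>\<mu>) = v" if e: "\<And>s. s * (\<integral>x. f x \<partial>\<mu>) \<le> top_pressure (\<lambda>x. ?g0 x + s * f x) - top_pressure ?g0" for \<mu>
    proof (rule antisym)
      show "(\<integral>x. f x \<partial>\<mu>) \<le> v"
      proof (rule le_of_quadratic_error)
        fix s :: real assume "0 < s" "s \<le> 1"
        then show "s * (\<integral>x. f x \<partial>\<mu>) \<le> s * v + B * s\<^sup>2" using e[of s] B[of s] by simp
      qed
      have "- (\<integral>x. f x \<partial>\<mu>) \<le> - v"
      proof (rule le_of_quadratic_error)
        fix s :: real assume "0 < s" "s \<le> 1"
        then show "s * - (\<integral>x. f x \<partial>\<mu>) \<le> s * - v + B * s\<^sup>2" using e[of "- s"] B[of "- s"] by simp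
      qed
      then show "v \<le> (\<integral>x. f x \<partial>\<mu>)" by simp
    qed
    have "(\<integral>x. f x \<partial>\<mu>0) = v"
      using equilibrium_tangent[OF g0[unfolded gibbs_def] h(1) f] by (rule eq)
    moreover have "(\<integral>x. f x \<partial>\<mu>1) = v"
    proof (rule eq)
      fix s
      show "s * (\<integral>x. f x \<partial>\<mu>1) \<le> top_pressure (\<lambda>x. ?g0 x + s * f x) - top_pressure ?g0"
        using equilibrium_tangent[OF g1[unfolded gibbs_def] h(2) f, of s] P[of s] P[of 0] by simp
    qed
    ultimately show "measure \<mu>0 {x. pref n x = w} = measure \<mu>1 {x. pref n x = w}"
      using measure_cylinder_integral[OF inv(1), of n w] measure_cylinder_integral[OF inv(2), of n w] by (simp add: f_def)
  qed
qed

section \<open>Exponential rates\<close>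

lemma eventually_le_exp:
  assumes "(\<lambda>n. ln (A n) / real n) \<longlonglongrightarrow> \<alpha>" "\<And>n. 0 < A n" "\<alpha> < \<beta>"
  shows "\<forall>\<^sub>F n in sequentially. A n \<le> exp (real n * \<beta>)"
  using order_tendstoD(2)[OF assms(1,3)] eventually_gt_at_top[of 0]
proof eventually_elim
  case (elim n)
  then have "ln (A n) \<le> real n * \<beta>" by (simp add: field_simps)
  then show ?case using assms(2)[of n] by (metis exp_le_cancel_iff exp_ln)
qed

lemma eventually_ge_exp:
  assumes "(\<lambda>n. ln (A n) / real n) \<longlonglongrightarrow> \<alpha>" "\<And>n. 0 < A n" "\<beta> < \<alpha>"
  shows "\<forall>\<^sub>F n in sequentially. exp (real n * \<beta>) \<le> A n"
  using order_tendstoD(1)[OF assms(1,3)] eventually_gt_at_top[of 0]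
proof eventually_elim
  case (elim n)
  then have "real n * \<beta> \<le> ln (A n)" by (simp add: field_simps)
  then show ?case using assms(2)[of n] by (metis exp_le_cancel_iff exp_ln)
qed

lemma sum_union_le:
  fixes f :: "'b \<Rightarrow> real"
  assumes "finite A" "finite B" "\<And>x. x \<in> A \<inter> B \<Longrightarrow> 0 \<le> f x"
  shows "sum f (A \<union> B) \<le> sum f A + sum f B"
  using sum.union_inter[OF assms(1,2), of f] sum_nonneg[of "A \<inter> B" f] assms(3) by simp

text \<open>A Gaertner-Ellis setting on finite index sets: \<open>P\<close> is the limiting cumulant
  function of \<open>r\<close> under the weights \<open>a\<close>. Smoothness enters each estimate
  as a quadratic bound at the tilt in question.\<close>

locale exponential_rate =
  fixes I :: "nat \<Rightarrow> 'i set" and a r :: "nat \<Rightarrow> 'i \<Rightarrow> real" and P :: "real \<Rightarrow> real"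
  assumes fin: "finite (I n)" and ne: "I n \<noteq> {}" and a_pos: "w \<in> I n \<Longrightarrow> 0 < a n w"
    and rate: "(\<lambda>n. ln (\<Sum>w\<in>I n. a n w * exp (t * r n w)) / real n) \<longlonglongrightarrow> P t"
begin

definition mgf :: "nat \<Rightarrow> real \<Rightarrow> real" where
  "mgf n t = (\<Sum>w\<in>I n. a n w * exp (t * r n w))"

lemma mgf_pos: "0 < mgf n t"
  unfolding mgf_def using fin ne a_pos by (intro sum_pos) auto

lemma rate_mgf: "(\<lambda>n. ln (mgf n t) / real n) \<longlonglongrightarrow> P t"
  unfolding mgf_def by (rule rate)

lemma chernoff:
  assumes "0 \<le> h"
  shows "(\<Sum>w\<in>{w\<in>I n. \<sigma> \<le> r n w}. a n w * exp (t * r n w)) \<le> exp (- h * \<sigma>) * mgf n (t + h)"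
proof -
  have "(\<Sum>w\<in>{w\<in>I n. \<sigma> \<le> r n w}. a n w * exp (t * r n w)) \<le>
     (\<Sum>w\<in>{w\<in>I n. \<sigma> \<le> r n w}. exp (- h * \<sigma>) * (a n w * exp ((t + h) * r n w)))"
  proof (rule sum_mono)
    fix w assume w: "w \<in> {w\<in>I n. \<sigma> \<le> r n w}"
    then have "h * \<sigma> \<le> h * r n w" using assms by (intro mult_left_mono) auto
    then have "exp (t * r n w) \<le> exp (- h * \<sigma>) * exp ((t + h) * r n w)"
      by (simp add: exp_add[symmetric] algebra_simps)
    then have "a n w * exp (t * r n w) \<le> a n w * (exp (- h * \<sigma>) * exp ((t + h) * r n w))"
      using a_pos[of w n] w by (intro mult_left_mono) auto
    then show "a n w * exp (t * r n w) \<le> exp (- h * \<sigma>) * (a n w * exp ((t + h) * r n w))"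
      by (simp add: mult_ac)
  qed
  also have "\<dots> \<le> exp (- h * \<sigma>) * mgf n (t + h)"
    unfolding mgf_def sum_distrib_left[symmetric] using fin[of n] a_pos
    by (intro mult_left_mono sum_mono2) (auto intro!: mult_nonneg_nonneg less_imp_le)
  finally show ?thesis .
qed

text \<open>Under weights tilted by \<open>t\<close>, values of \<open>r\<close> beyond a slope
  larger than \<open>v\<close> carry negligible mass: a further tilt by a small \<open>h\<close>
  gains \<open>h * u\<close> and costs about \<open>h * v\<close> in the cumulant.\<close>

lemma upper_tail:
  assumes quad: "\<And>s. \<bar>s - t\<bar> \<le> 1 \<Longrightarrow> P s \<le> P t + (s - t) * v + B * (s - t)\<^sup>2"
    and \<sigma>: "(\<lambda>n. \<sigma> n / real n) \<longlonglongrightarrow> u" and vu: "v < u" and e: "0 < e"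
  shows "\<forall>\<^sub>F n in sequentially. (\<Sum>w\<in>{w\<in>I n. \<sigma> n \<le> r n w}. a n w * exp (t * r n w)) \<le> e * mgf n t"
proof -
  \<comment> \<open>Small enough for the quadratic error to consume at most half of the gap
    \<open>u - v\<close>, and at most \<open>1\<close> to stay where \<open>quad\<close>
    applies.\<close>
  define h where "h = min 1 ((u - v) / (2 * (\<bar>B\<bar> + 1)))"
  have h: "0 < h" "h \<le> 1" using vu by (auto simp: h_def)
  have "B * h \<le> (\<bar>B\<bar> + 1) * h" using h by (intro mult_right_mono) auto
  also have "\<dots> \<le> (\<bar>B\<bar> + 1) * ((u - v) / (2 * (\<bar>B\<bar> + 1)))" by (intro mult_left_mono) (auto simp: h_def)
  also have "\<dots> = (u - v) / 2"
  proof -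
    have "\<bar>B\<bar> + 1 \<noteq> 0" by linarith
    then show ?thesis by (simp add: field_simps)
  qed
  finally have Bh: "B * h \<le> (u - v) / 2" .
  \<comment> \<open>The exponent gained. Three quarters of it are spent on the rate at
    \<open>t + h\<close>, the rate at \<open>t\<close> and the threshold; the last quarter remains
    as decay.\<close>
  define \<kappa> where "\<kappa> = h * ((u - v) / 2)"
  have \<kappa>: "0 < \<kappa>" using h vu by (simp add: \<kappa>_def)
  have "P (t + h) \<le> P t + h * v + h * (B * h)" using quad[of "t + h"] h by (simp add: power2_eq_square mult_ac)
  also have "\<dots> \<le> P t + h * v + h * ((u - v) / 2)" using Bh h by (intro add_left_mono mult_left_mono) auto
  finally have gap: "P (t + h) - h * u \<le> P t - \<kappa>" by (simp add: \<kappa>_def field_simps)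
  have "(\<lambda>n. exp (- (\<kappa> / 4) * real n)) \<longlonglongrightarrow> 0"
  proof -
    have "(\<lambda>n. exp (- (\<kappa> / 4)) ^ n) \<longlonglongrightarrow> 0" using \<kappa> by (intro LIMSEQ_realpow_zero) auto
    then show ?thesis by (simp only: exp_of_nat2_mult)
  qed
  then have small: "\<forall>\<^sub>F n in sequentially. exp (- (\<kappa> / 4) * real n) < e" using e by (rule order_tendstoD)
  have 1: "\<forall>\<^sub>F n in sequentially. mgf n (t + h) \<le> exp (real n * (P (t + h) + \<kappa> / 4))"
    by (rule eventually_le_exp[OF rate_mgf mgf_pos]) (use \<kappa> in simp)
  have 2: "\<forall>\<^sub>F n in sequentially. exp (real n * (P t - \<kappa> / 4)) \<le> mgf n t"
    by (rule eventually_ge_exp[OF rate_mgf mgf_pos]) (use \<kappa> in simp)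
  have "u - \<kappa> / (4 * h) < u" using \<kappa> h by simp
  from order_tendstoD(1)[OF \<sigma> this]
  have 3: "\<forall>\<^sub>F n in sequentially. u - \<kappa> / (4 * h) < \<sigma> n / real n" .
  show ?thesis using small 1 2 3 eventually_gt_at_top[of 0]
  proof eventually_elim
    case (elim n)
    have "real n * (u - \<kappa> / (4 * h)) \<le> \<sigma> n" using elim(4,5) by (simp add: field_simps)
    then have "h * (real n * (u - \<kappa> / (4 * h))) \<le> h * \<sigma> n" using h by (intro mult_left_mono) auto
    then have hs: "real n * (h * u) - real n * (\<kappa> / 4) \<le> h * \<sigma> n" using h by (simp add: algebra_simps)
    have "(\<Sum>w\<in>{w\<in>I n. \<sigma> n \<le> r n w}. a n w * exp (t * r n w)) \<le> exp (- h * \<sigma> n) * mgf n (t + h)"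
      using h by (intro chernoff) auto
    also have "\<dots> \<le> exp (- h * \<sigma> n) * exp (real n * (P (t + h) + \<kappa> / 4))"
      using elim(2) by (intro mult_left_mono) auto
    also have "\<dots> = exp (- h * \<sigma> n + real n * (P (t + h) + \<kappa> / 4))" by (rule exp_add[symmetric])
    also have "\<dots> \<le> exp (- (\<kappa> / 4) * real n + real n * (P t - \<kappa> / 4))"
    proof -
      have "real n * (P (t + h) - h * u) \<le> real n * (P t - \<kappa>)" using gap by (intro mult_left_mono) auto
      then show ?thesis using hs by (simp add: algebra_simps)
    qed
    also have "\<dots> = exp (- (\<kappa> / 4) * real n) * exp (real n * (P t - \<kappa> / 4))" by (rule exp_add)
    also have "\<dots> \<le> e * mgf n t"
      using elim(1,3) e by (intro mult_mono) auto
    finally show ?case .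
  qed
qed

end

text \<open>Reflection: replace \<open>r\<close> by its negative and \<open>t\<close> by
  \<open>- t\<close>.\<close>

lemma (in exponential_rate) lower_tail:
  assumes quad: "\<And>s. \<bar>s - t\<bar> \<le> 1 \<Longrightarrow> P s \<le> P t + (s - t) * v + B * (s - t)\<^sup>2"
    and \<sigma>: "(\<lambda>n. \<sigma> n / real n) \<longlonglongrightarrow> u" and uv: "u < v" and e: "0 < e"
  shows "\<forall>\<^sub>F n in sequentially. (\<Sum>w\<in>{w\<in>I n. r n w \<le> \<sigma> n}. a n w * exp (t * r n w)) \<le> e * mgf n t"
proof -
  interpret neg: exponential_rate I a "\<lambda>n w. - r n w" "\<lambda>t. P (- t)"
    using fin ne a_pos rate[of "- _"] by unfold_locales auto
  have "\<forall>\<^sub>F n in sequentially. (\<Sum>w\<in>{w\<in>I n. - \<sigma> n \<le> - r n w}. a n w * exp (- t * - r n w)) \<le> e * neg.mgf n (- t)"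
  proof (rule neg.upper_tail[where v = "- v" and B = B and u = "- u"])
    fix s assume "\<bar>s - - t\<bar> \<le> 1"
    then have "\<bar>- s - t\<bar> \<le> 1" by linarith
    from quad[OF this] show "P (- s) \<le> P (- (- t)) + (s - - t) * (- v) + B * (s - - t)\<^sup>2"
      by (simp add: power2_eq_square algebra_simps)
  next
    show "(\<lambda>n. - \<sigma> n / real n) \<longlonglongrightarrow> - u" using tendsto_minus[OF \<sigma>] by simp
  qed (use uv e in auto)
  then show ?thesis by (simp add: neg.mgf_def mgf_def)
qed

context exponential_rate begin

text \<open>Cramer's change of measure: under the tilt, at least half of the mass eventually has
  \<open>r n w\<close> between \<open>\<sigma> n\<close> and \<open>(v + d) * n\<close>. Removing
  the tilt there costs a factor no worse than \<open>exp (- t * (v + d) * n)\<close>.\<close>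

lemma lower_bound:
  assumes quad: "\<And>s. \<bar>s - t\<bar> \<le> 1 \<Longrightarrow> P s \<le> P t + (s - t) * v + B * (s - t)\<^sup>2"
    and \<sigma>: "(\<lambda>n. \<sigma> n / real n) \<longlonglongrightarrow> c" and cv: "c < v" and t: "0 \<le> t" and e: "0 < \<eta>"
  shows "\<forall>\<^sub>F n in sequentially. exp (real n * (P t - t * v - \<eta>)) \<le> (\<Sum>w\<in>{w\<in>I n. \<sigma> n < r n w}. a n w)"
proof -
  \<comment> \<open>Keeps the loss \<open>t * d\<close> within \<open>\<eta> / 2\<close>. The rest
    of \<open>\<eta>\<close> pays for the rate at \<open>t\<close> and for the factor one
    half.\<close>
  define d where "d = \<eta> / (2 * (t + 1))"
  have d: "0 < d" using e t by (simp add: d_def)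
  have td: "t * d \<le> \<eta> / 2" using e t by (simp add: d_def field_simps)
  define u where "u = v + d"
  have lim_u: "(\<lambda>n. (u * real n) / real n) \<longlonglongrightarrow> u"
    by (rule tendsto_eventually) (use eventually_gt_at_top[of 0] in eventually_elim, simp)
  have 1: "\<forall>\<^sub>F n in sequentially. (\<Sum>w\<in>{w\<in>I n. u * real n \<le> r n w}. a n w * exp (t * r n w)) \<le> 1/4 * mgf n t"
    by (rule upper_tail[OF quad lim_u]) (use d in \<open>auto simp: u_def\<close>)
  have 2: "\<forall>\<^sub>F n in sequentially. (\<Sum>w\<in>{w\<in>I n. r n w \<le> \<sigma> n}. a n w * exp (t * r n w)) \<le> 1/4 * mgf n t"
    by (rule lower_tail[OF quad \<sigma> cv]) auto
  have 3: "\<forall>\<^sub>F n in sequentially. exp (real n * (P t - \<eta> / 4)) \<le> mgf n t"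
    by (rule eventually_ge_exp[OF rate_mgf mgf_pos]) (use e in simp)
  obtain n0 where n0: "4 * ln 2 / \<eta> < real n0" using reals_Archimedean2 by blast
  show ?thesis using 1 2 3 eventually_ge_at_top[of n0]
  proof eventually_elim
    case (elim n)
    let ?U = "{w\<in>I n. u * real n \<le> r n w}" and ?L = "{w\<in>I n. r n w \<le> \<sigma> n}" and ?M = "{w\<in>I n. \<sigma> n < r n w \<and> r n w < u * real n}"
    let ?f = "\<lambda>w. a n w * exp (t * r n w)"
    have fpos: "0 \<le> ?f w" if "w \<in> I n" for w using a_pos[OF that] by simp
    have "mgf n t \<le> sum ?f (?U \<union> ?L \<union> ?M)"
      unfolding mgf_def using fin[of n] fpos by (intro sum_mono2) auto
    also have "\<dots> \<le> sum ?f (?U \<union> ?L) + sum ?f ?M"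
      using fin[of n] fpos by (intro sum_union_le) auto
    also have "sum ?f (?U \<union> ?L) \<le> sum ?f ?U + sum ?f ?L"
      using fin[of n] fpos by (intro sum_union_le) auto
    finally have half: "mgf n t / 2 \<le> sum ?f ?M" using elim(1,2) by simp
    have "4 * ln 2 < \<eta> * real n0" using n0 e by (simp add: field_simps)
    also have "\<dots> \<le> \<eta> * real n" using elim(4) e by (intro mult_left_mono) auto
    finally have l2: "ln 2 \<le> real n * (\<eta> / 4)" by (simp add: mult.commute)
    have "exp (real n * (P t - t * v - \<eta>)) \<le> exp (real n * (P t - \<eta> / 4) - ln 2 - t * (u * real n))"
    proof -
      have "real n * (t * d) \<le> real n * (\<eta> / 2)" using td by (intro mult_left_mono) auto
      then show ?thesis using l2 by (simp add: u_def algebra_simps)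
    qed
    also have "\<dots> = exp (real n * (P t - \<eta> / 4)) / 2 * exp (- t * (u * real n))"
    proof -
      have eq: "exp (A - ln 2 - C) = exp A / 2 * exp (- C)" for A C :: real
      proof -
        have "A - ln 2 - C = A + (- ln 2) + (- C)" by simp
        then have "exp (A - ln 2 - C) = exp A * exp (- ln 2) * exp (- C)" by (simp only: exp_add)
        moreover have "exp (- ln 2) = (1 / 2 :: real)" by (simp add: exp_minus)
        ultimately show ?thesis by simp
      qed
      show ?thesis unfolding mult_minus_left by (rule eq)
    qed
    also have "\<dots> \<le> mgf n t / 2 * exp (- t * (u * real n))"
      using elim(3) by (intro mult_right_mono) auto
    also have "\<dots> \<le> sum ?f ?M * exp (- t * (u * real n))" using half by (intro mult_right_mono) auto
    also have "\<dots> = (\<Sum>w\<in>?M. ?f w * exp (- t * (u * real n)))" by (rule sum_distrib_right)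
    also have "\<dots> \<le> (\<Sum>w\<in>?M. a n w)"
    proof (rule sum_mono)
      fix w assume w: "w \<in> ?M"
      then have "t * r n w \<le> t * (u * real n)" using t by (intro mult_left_mono) auto
      then have "exp (t * r n w) * exp (- t * (u * real n)) \<le> 1" by (simp add: exp_add[symmetric])
      then have "a n w * (exp (t * r n w) * exp (- t * (u * real n))) \<le> a n w * 1"
        using a_pos[of w n] w by (intro mult_left_mono) auto
      then show "?f w * exp (- t * (u * real n)) \<le> a n w" by (simp add: mult.assoc)
    qed
    also have "\<dots> \<le> (\<Sum>w\<in>{w\<in>I n. \<sigma> n < r n w}. a n w)"
      using fin[of n] a_pos by (intro sum_mono2) (auto intro: less_imp_le)
    finally show ?case .
  qed
qed

end

section \<open>Error exponents\<close>

text \<open>Every cylinder has positive mass, so essential supremum and supremum of the Birkhoff sum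
  differ by at most its distortion on a cylinder. \<open>Sn D n\<close> has \<open>n + 1\<close>
  terms but is divided by \<open>n\<close>, hence the shifted index.\<close>

lemma Aval_LIMSEQ:
  fixes J J' :: "(nat \<Rightarrow> 'a::finite) \<Rightarrow> real"
  defines "D \<equiv> \<lambda>x. ln (J' x) - ln (J x)"
  assumes inv: "invariant_prob \<mu>" and D: "holder D" and supp: "\<And>n x. 0 < measure \<mu> {z. pref n z = pref n x}"
  shows "(\<lambda>n. (SUP x. birk D (Suc n) x) / real n) \<longlonglongrightarrow> Aval \<mu> J J'"
proof -
  note I = invariant_probD[OF inv]
  interpret prob_space \<mu> by (rule I)
  obtain b where b: "0 \<le> b" "\<And>x. \<bar>D x\<bar> \<le> b" using holder_bounded[OF D] by metis
  obtain C \<theta> where h: "holder_with C \<theta> D" using D unfolding holder_iff by auto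
  \<comment> \<open>Two distortions: from \<open>x\<close> to its prefix with a fixed tail, and from
    there to another point of the cylinder.\<close>
  define K where "K = 2 * (C / (1 - \<theta>))"
  define m where "m = (\<lambda>n. SUP x. birk D n x)"
  have bdd: "bdd_above (range (birk D n))" for n
    using birk_bound[of D b n, OF b(2)] by (intro bdd_aboveI2[where M = "real n * b"]) (simp add: abs_le_iff)
  have m_ge: "birk D n x \<le> m n" for n x unfolding m_def using bdd by (intro cSUP_upper) auto
  have "convergent (\<lambda>n. m n / real n)"
  proof (rule subadditive_LIMSEQ)
    fix i j
    have "(SUP x. birk D (i + j) x) \<le> m i + m j"
      by (rule cSUP_least) (auto simp: birk_add intro: add_mono m_ge)
    then show "m (i + j) \<le> m i + m j" by (subst m_def)
    show "- b * real i \<le> m i"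
      using m_ge[of i undefined] birk_bound[of D b i undefined, OF b(2)] by (simp add: abs_le_iff algebra_simps)
  qed
  then obtain l where "(\<lambda>n. m n / real n) \<longlonglongrightarrow> l" by (auto simp: convergent_def)
  from LIMSEQ_shift_ratio[OF this, of 1] have ml: "(\<lambda>n. m (Suc n) / real n) \<longlonglongrightarrow> l" by simp
  define E where "E = (\<lambda>n. esssup \<mu> (\<lambda>\<omega>. ereal (Sn D n \<omega> / real n)))"
  have bounds: "(m (Suc n) - K) / real n \<le> real_of_ereal (E n) \<and> real_of_ereal (E n) \<le> m (Suc n) / real n" if n: "1 \<le> n" for n
  proof -
    have up: "E n \<le> ereal (m (Suc n) / real n)"
      unfolding E_def
    proof (rule esssup_I)
      have "birk D (Suc n) \<in> borel_measurable \<mu>" using integrable_birk[OF inv D] by (rule borel_measurable_integrable)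
      then show "(\<lambda>\<omega>. ereal (Sn D n \<omega> / real n)) \<in> borel_measurable \<mu>"
        unfolding Sn_eq_birk by measurable
      show "AE \<omega> in \<mu>. ereal (Sn D n \<omega> / real n) \<le> ereal (m (Suc n) / real n)"
        using m_ge by (intro AE_I2) (simp add: Sn_eq_birk divide_right_mono)
    qed
    have lo: "ereal ((birk D (Suc n) x - K) / real n) \<le> E n" for x
    proof (rule ccontr)
      assume not: "\<not> ?thesis"
      have "AE \<omega> in \<mu>. ereal (Sn D n \<omega> / real n) \<le> E n" unfolding E_def by (rule esssup_AE)
      then have "AE \<omega> in \<mu>. \<omega> \<notin> {z. pref (Suc n) z = pref (Suc n) x}"
      proof eventually_elim
        case (elim \<omega>)
        show ?case
        proof
          assume "\<omega> \<in> {z. pref (Suc n) z = pref (Suc n) x}"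
          then have eq: "pref (Suc n) \<omega> = pref (Suc n) x" by simp
          have "birk D (Suc n) x - K \<le> birk D (Suc n) \<omega>"
            using birk_distortion_pref[OF h, of "Suc n" x undefined] birk_distortion_pref[OF h, of "Suc n" \<omega> undefined]
            unfolding eq K_def by (simp add: abs_le_iff)
          then have "ereal ((birk D (Suc n) x - K) / real n) \<le> ereal (Sn D n \<omega> / real n)"
            by (simp add: Sn_eq_birk divide_right_mono)
          then show False using elim not by (meson order_trans)
        qed
      qed
      then have "measure \<mu> {z. pref (Suc n) z = pref (Suc n) x} = 0"
        using I(1,3) sets_pref[of "Suc n" "pref (Suc n) x"] by (subst (asm) AE_iff_measurable[OF _ refl]) (auto simp: emeasure_eq_measure)
      then show False using supp[of "Suc n" x] by simp
    qed
    have "\<bar>E n\<bar> \<noteq> \<infinity>" using up lo[of undefined] by (cases "E n") auto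
    then obtain e where e: "E n = ereal e" by auto
    have "birk D (Suc n) x \<le> e * real n + K" for x
      using lo[of x] n by (simp add: e field_simps)
    then have "m (Suc n) \<le> e * real n + K" unfolding m_def by (intro cSUP_least) auto
    then show ?thesis using up n by (simp add: e field_simps)
  qed
  have "(\<lambda>n. real_of_ereal (E n)) \<longlonglongrightarrow> l"
  proof (rule tendsto_sandwich)
    have "(\<lambda>n. m (Suc n) / real n - K / real n) \<longlonglongrightarrow> l - 0" by (intro tendsto_diff ml lim_const_over_n)
    then show "(\<lambda>n. (m (Suc n) - K) / real n) \<longlonglongrightarrow> l" by (simp add: diff_divide_distrib)
    show "\<forall>\<^sub>F n in sequentially. (m (Suc n) - K) / real n \<le> real_of_ereal (E n)"
      "\<forall>\<^sub>F n in sequentially. real_of_ereal (E n) \<le> m (Suc n) / real n"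
      by (rule eventually_mono[OF eventually_ge_at_top[of 1]], use bounds in blast)+
  qed (rule ml)
  then have "Aval \<mu> J J' = l" unfolding Aval_def E_def D_def by (rule limI)
  then show ?thesis using ml by (simp add: m_def)
qed

lemma elog_LIMSEQ:
  assumes "\<forall>\<^sub>F n in sequentially. 0 < A n" and "(\<lambda>n. ln (A n) / real n) \<longlonglongrightarrow> L"
  shows "(\<lambda>n. elog (A n) / ereal (real n)) \<longlonglongrightarrow> ereal L"
proof (rule Lim_transform_eventually)
  show "(\<lambda>n. ereal (ln (A n) / real n)) \<longlonglongrightarrow> ereal L" using assms(2) by simp
  show "\<forall>\<^sub>F n in sequentially. ereal (ln (A n) / real n) = elog (A n) / ereal (real n)"
    using assms(1) eventually_gt_at_top[of 0] by eventually_elim (simp add: elog_def)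
qed

text \<open>A slope that satisfies both quadratic bounds is the derivative, so \<open>deriv\<close>
  can take its place. \<open>t\<close> stays strictly inside the window because differentiability
  needs a neighbourhood.\<close>

lemma fP_regular:
  fixes J0 J1 :: "(nat \<Rightarrow> 'a::finite) \<Rightarrow> real"
  assumes J0: "jacobian J0" and J1: "jacobian J1" and osc: "oscillates (\<lambda>x. ln (J1 x) - ln (J0 x))" and T: "0 < T"
  obtains B \<delta> where "0 \<le> B" "0 < \<delta>"
    "\<And>s t. \<bar>s\<bar> \<le> T \<Longrightarrow> \<bar>t\<bar> < T \<Longrightarrow> \<delta> * (s - t)\<^sup>2 \<le> fP J0 J1 s - fP J0 J1 t - (s - t) * deriv (fP J0 J1) t"
    "\<And>s t. \<bar>s\<bar> \<le> T \<Longrightarrow> \<bar>t\<bar> < T \<Longrightarrow> fP J0 J1 s - fP J0 J1 t - (s - t) * deriv (fP J0 J1) t \<le> B * (s - t)\<^sup>2"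
proof -
  let ?g = "\<lambda>x. ln (J0 x)" and ?D = "\<lambda>x. ln (J1 x) - ln (J0 x)"
  have h: "holder ?g" "holder (\<lambda>x. ln (J1 x))" using holder_ln_jacobian J0 J1 by auto
  have D: "holder ?D" using holder_lin[OF h(2,1), of "-1"] by simp
  have P: "fP J0 J1 t = top_pressure (\<lambda>x. ?g x + t * ?D x)" for t
    unfolding fP_def by (rule variational_principle(1)[OF holder_lin[OF h(1) D]])
  show thesis
  proof (rule top_pressure_second_order[OF h(1) D, of T], goal_cases)
    case (1 B \<delta>)
    have "\<delta> * (s - t)\<^sup>2 \<le> fP J0 J1 s - fP J0 J1 t - (s - t) * deriv (fP J0 J1) t \<and>
        fP J0 J1 s - fP J0 J1 t - (s - t) * deriv (fP J0 J1) t \<le> B * (s - t)\<^sup>2"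
      if s: "\<bar>s\<bar> \<le> T" and t: "\<bar>t\<bar> < T" for s t
    proof -
      from 1(5)[of t] t obtain v where v: "\<And>s. \<bar>s\<bar> \<le> T \<Longrightarrow> \<delta> * (s - t)\<^sup>2 \<le> fP J0 J1 s - fP J0 J1 t - (s - t) * v"
        "\<And>s. \<bar>s\<bar> \<le> T \<Longrightarrow> fP J0 J1 s - fP J0 J1 t - (s - t) * v \<le> B * (s - t)\<^sup>2"
        unfolding P[symmetric] by auto
      have "(fP J0 J1 has_real_derivative v) (at t)"
        unfolding has_field_derivative_iff
      proof (rule LIM_zero_cancel, rule Lim_null_comparison)
        have "\<forall>\<^sub>F s in at t. s \<in> {-T<..<T} - {t}"
          by (intro eventually_at_in_open) (use t in \<open>auto simp: abs_less_iff\<close>)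
        then show "\<forall>\<^sub>F s in at t. norm ((fP J0 J1 s - fP J0 J1 t) / (s - t) - v) \<le> B * \<bar>s - t\<bar>"
        proof eventually_elim
          case (elim s)
          then have s: "\<bar>s\<bar> \<le> T" "s \<noteq> t" by auto
          have "0 \<le> \<delta> * (s - t)\<^sup>2" using 1(2) by simp
          then have "\<bar>fP J0 J1 s - fP J0 J1 t - (s - t) * v\<bar> \<le> B * (s - t)\<^sup>2"
            using v[OF s(1)] by (simp add: abs_le_iff)
          moreover have "(fP J0 J1 s - fP J0 J1 t) / (s - t) - v = (fP J0 J1 s - fP J0 J1 t - (s - t) * v) / (s - t)"
            using s(2) by (simp add: field_simps)
          ultimately show ?case
            using s(2) by (simp add: abs_divide pos_divide_le_eq power2_eq_square abs_mult[symmetric] mult.assoc)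
        qed
        have "((\<lambda>s. B * \<bar>s - t\<bar>) \<longlongrightarrow> B * \<bar>t - t\<bar>) (at t)" by (intro tendsto_intros)
        then show "((\<lambda>s. B * \<bar>s - t\<bar>) \<longlongrightarrow> 0) (at t)" by simp
      qed
      then have "deriv (fP J0 J1) t = v" by (rule DERIV_imp_deriv)
      then show ?thesis using v[OF s] by simp
    qed
    then show ?case using 1(1,3) osc by (intro that[of B \<delta>]) auto
  qed
qed

lemma cyl_eq: "cyl n \<omega> = {z. pref (Suc n) z = pref (Suc n) \<omega>}"
  by (auto simp: cyl_def pref_eq_iff agree_def less_Suc_eq_le)

lemma range_pref: "range (pref n) = (words n :: 'a list set)"
proof
  show "(words n :: 'a list set) \<subseteq> range (pref n)"
  proof
    fix w :: "'a list" assume "w \<in> words n"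
    then have "w = pref n (w \<frown> undefined)" by (simp add: words_def pref_conc)
    then show "w \<in> range (pref n)" by blast
  qed
qed auto

text \<open>Ties carry no condition: the test integral is squeezed between the weights of strict and
  of weak exceedance of the threshold. In this form the lemma also applies to
  \<open>1 - \<phi> n\<close> with the measures exchanged.\<close>

lemma type_one_errors:
  fixes J0 J1 :: "(nat \<Rightarrow> 'a::finite) \<Rightarrow> real"
  assumes J0: "jacobian J0" and J1: "jacobian J1" and g0: "gibbs J0 \<mu>0" and g1: "gibbs J1 \<mu>1" and ne: "\<mu>0 \<noteq> \<mu>1"
    and cs: "\<And>n. 1 \<le> n \<Longrightarrow> 0 < cs n" and c: "(\<lambda>n. ln (cs n) / real n) \<longlonglongrightarrow> c"
    and \<phi>: "\<And>n. 1 \<le> n \<Longrightarrow> \<phi> n \<in> tests n"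
    and test1: "\<And>n \<omega>. 1 \<le> n \<Longrightarrow> cs n * measure \<mu>0 (cyl n \<omega>) < measure \<mu>1 (cyl n \<omega>) \<Longrightarrow> \<phi> n \<omega> = 1"
    and test0: "\<And>n \<omega>. 1 \<le> n \<Longrightarrow> measure \<mu>1 (cyl n \<omega>) < cs n * measure \<mu>0 (cyl n \<omega>) \<Longrightarrow> \<phi> n \<omega> = 0"
  shows "t > 0 \<Longrightarrow> c = deriv (fP J0 J1) t \<Longrightarrow>
        (\<lambda>n. elog (integral\<^sup>L \<mu>0 (\<phi> n)) / ereal (real n)) \<longlonglongrightarrow> ereal (fP J0 J1 t - t * deriv (fP J0 J1) t)" (is "_ \<Longrightarrow> _ \<Longrightarrow> ?A")
    and "c > Aval \<mu>0 J0 J1 \<Longrightarrow> (\<lambda>n. elog (integral\<^sup>L \<mu>0 (\<phi> n)) / ereal (real n)) \<longlonglongrightarrow> -\<infinity>" (is "_ \<Longrightarrow> ?B")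
    and "c < deriv (fP J0 J1) 0 \<Longrightarrow> (\<lambda>n. elog (integral\<^sup>L \<mu>0 (\<phi> n)) / ereal (real n)) \<longlonglongrightarrow> 0" (is "_ \<Longrightarrow> ?C")
proof -
  let ?g0 = "\<lambda>x. ln (J0 x)" and ?g1 = "\<lambda>x. ln (J1 x)" and ?D = "\<lambda>x. ln (J1 x) - ln (J0 x)"
  have h: "holder ?g0" "holder ?g1" using holder_ln_jacobian J0 J1 by auto
  have D: "holder ?D" using holder_lin[OF h(2,1), of "-1"] by simp
  have osc: "oscillates ?D" using gibbs_unique_up_to_coboundary[OF J0 J1 g0 g1] ne by blast
  have inv: "invariant_prob \<mu>0" using g0 by (simp add: gibbs_def equilibrium_def)
  note I0 = invariant_probD[OF inv]
  interpret M0: prob_space \<mu>0 by (rule I0)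
  let ?P = "fP J0 J1"
  have P: "?P t = top_pressure (\<lambda>x. ?g0 x + t * ?D x)" for t
    unfolding fP_def by (rule variational_principle(1)[OF holder_lin[OF h(1) D]])
  obtain K0 where K0: "0 \<le> K0"
    "\<And>n x. exp (birk ?g0 n x - K0) \<le> measure \<mu>0 {z. pref n z = pref n x}"
    "\<And>n x. measure \<mu>0 {z. pref n z = pref n x} \<le> exp (birk ?g0 n x + K0)"
    using gibbs_cylinder_bounds[OF J0 g0] by blast
  obtain K1 where K1: "0 \<le> K1"
    "\<And>n x. exp (birk ?g1 n x - K1) \<le> measure \<mu>1 {z. pref n z = pref n x}"
    "\<And>n x. measure \<mu>1 {z. pref n z = pref n x} \<le> exp (birk ?g1 n x + K1)"
    using gibbs_cylinder_bounds[OF J1 g1] by blast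
  \<comment> \<open>\<open>cyl n\<close> fixes the letters \<open>0\<close> to \<open>n\<close>,
    hence words of length \<open>Suc n\<close>, while rates are normalised by
    \<open>n\<close>.\<close>
  define I where "I = (\<lambda>n. words (Suc n) :: 'a list set)"
  define a where "a = (\<lambda>n w. measure \<mu>0 {z. pref (Suc n) z = w})"
  define b where "b = (\<lambda>n w. measure \<mu>1 {z. pref (Suc n) z = w})"
  define r where "r = (\<lambda>n w. ln (b n w) - ln (a n w))"
  define y where "y = (undefined :: nat \<Rightarrow> 'a)"
  have wy: "pref (Suc n) (w \<frown> y) = w" if "w \<in> I n" for n w
    using that by (intro pref_conc) (simp add: I_def words_def)
  have apos: "0 < a n (pref (Suc n) x)" for n x
    unfolding a_def by (rule less_le_trans[OF exp_gt_zero K0(2)])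
  have bpos: "0 < b n (pref (Suc n) x)" for n x
    unfolding b_def by (rule less_le_trans[OF exp_gt_zero K1(2)])
  have abpos: "0 < a n w" "0 < b n w" if "w \<in> I n" for n w
    using apos[of n "w \<frown> y"] bpos[of n "w \<frown> y"] wy[OF that] by auto
  have ln_a: "\<bar>ln (a n (pref (Suc n) x)) - birk ?g0 (Suc n) x\<bar> \<le> K0" for n x
  proof -
    have "ln (exp (birk ?g0 (Suc n) x - K0)) \<le> ln (a n (pref (Suc n) x))"
      using K0(2)[of "Suc n" x] by (intro ln_mono) (simp_all add: a_def)
    moreover have "ln (a n (pref (Suc n) x)) \<le> ln (exp (birk ?g0 (Suc n) x + K0))"
      using K0(3)[of "Suc n" x] apos[of n x] by (intro ln_mono) (simp_all add: a_def)
    ultimately show ?thesis unfolding ln_exp by (simp only: abs_le_iff) linarith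
  qed
  have ln_b: "\<bar>ln (b n (pref (Suc n) x)) - birk ?g1 (Suc n) x\<bar> \<le> K1" for n x
  proof -
    have "ln (exp (birk ?g1 (Suc n) x - K1)) \<le> ln (b n (pref (Suc n) x))"
      using K1(2)[of "Suc n" x] by (intro ln_mono) (simp_all add: b_def)
    moreover have "ln (b n (pref (Suc n) x)) \<le> ln (exp (birk ?g1 (Suc n) x + K1))"
      using K1(3)[of "Suc n" x] bpos[of n x] by (intro ln_mono) (simp_all add: b_def)
    ultimately show ?thesis unfolding ln_exp by (simp only: abs_le_iff) linarith
  qed
  have ln_r: "\<bar>r n (pref (Suc n) x) - birk ?D (Suc n) x\<bar> \<le> K0 + K1" for n x
    unfolding r_def birk_diff[of ?g1 ?g0] using ln_a[of n x] ln_b[of n x] by (simp only: abs_le_iff) linarith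
  \<comment> \<open>By the cylinder bounds, \<open>ln (a n w) + t * r n w\<close> is a Birkhoff sum
    of the tilted potential up to a constant, so these sums grow like its partition
    function.\<close>
  interpret E: exponential_rate I a r ?P
  proof
    show "finite (I n)" "I n \<noteq> {}" for n by (simp_all add: I_def)
    show "0 < a n w" if "w \<in> I n" for n w by (rule abpos[OF that])
    fix t
    let ?gt = "\<lambda>x. ?g0 x + t * ?D x"
    let ?m = "\<lambda>n. \<Sum>w\<in>I n. a n w * exp (t * r n w)"
    define K where "K = K0 + \<bar>t\<bar> * (K0 + K1)"
    have dist: "\<bar>(ln (a n w) + t * r n w) - birk ?gt (Suc n) (w \<frown> y)\<bar> \<le> K" if w: "w \<in> I n" for n w
    proof -
      have "\<bar>t * (r n w - birk ?D (Suc n) (w \<frown> y))\<bar> \<le> \<bar>t\<bar> * (K0 + K1)"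
        unfolding abs_mult using ln_r[of n "w \<frown> y"] wy[OF w] by (intro mult_left_mono) auto
      moreover have "\<bar>ln (a n w) - birk ?g0 (Suc n) (w \<frown> y)\<bar> \<le> K0"
        using ln_a[of n "w \<frown> y"] wy[OF w] by simp
      moreover have "(ln (a n w) + t * r n w) - birk ?gt (Suc n) (w \<frown> y) =
         (ln (a n w) - birk ?g0 (Suc n) (w \<frown> y)) + t * (r n w - birk ?D (Suc n) (w \<frown> y))"
        unfolding birk_lin[of ?g0 t ?D] by (simp add: algebra_simps)
      ultimately show ?thesis unfolding K_def by linarith
    qed
    have near: "\<bar>ln (?m n) - ln (Z ?gt (Suc n) y)\<bar> \<le> K" for n
    proof -
      have eq: "a n w * exp (t * r n w) = exp (ln (a n w) + t * r n w)" if "w \<in> I n" for w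
        using abpos[OF that] by (simp add: exp_add)
      have mpos: "0 < ?m n" using abpos(1) by (intro sum_pos) (auto simp: I_def)
      have "?m n \<le> (\<Sum>w\<in>I n. exp K * exp (birk ?gt (Suc n) (w \<frown> y)))"
        unfolding exp_add[symmetric]
      proof (rule sum_mono)
        fix w assume w: "w \<in> I n"
        show "a n w * exp (t * r n w) \<le> exp (K + birk ?gt (Suc n) (w \<frown> y))"
          unfolding eq[OF w] using dist[OF w] by (simp only: exp_le_cancel_iff abs_le_iff) linarith
      qed
      then have 1: "?m n \<le> exp K * Z ?gt (Suc n) y" by (simp add: Z_def I_def sum_distrib_left)
      have "(\<Sum>w\<in>I n. exp (- K) * exp (birk ?gt (Suc n) (w \<frown> y))) \<le> ?m n"
        unfolding exp_add[symmetric]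
      proof (rule sum_mono)
        fix w assume w: "w \<in> I n"
        show "exp (- K + birk ?gt (Suc n) (w \<frown> y)) \<le> a n w * exp (t * r n w)"
          unfolding eq[OF w] using dist[OF w] by (simp only: exp_le_cancel_iff abs_le_iff) linarith
      qed
      then have 2: "exp (- K) * Z ?gt (Suc n) y \<le> ?m n" by (simp add: Z_def I_def sum_distrib_left)
      have "ln (?m n) \<le> ln (exp K * Z ?gt (Suc n) y)" using 1 mpos by (intro ln_mono) auto
      moreover have "ln (exp (- K) * Z ?gt (Suc n) y) \<le> ln (?m n)" using 2 by (intro ln_mono) auto
      moreover have "ln (exp k * Z ?gt (Suc n) y) = k + ln (Z ?gt (Suc n) y)" for k by (subst ln_mult) auto
      ultimately show ?thesis by (simp only: abs_le_iff) linarith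
    qed
    have "(\<lambda>n. (ln (?m n) - ln (Z ?gt (Suc n) y)) / real n) \<longlonglongrightarrow> 0"
    proof (rule Lim_null_comparison)
      show "\<forall>\<^sub>F n in sequentially. norm ((ln (?m n) - ln (Z ?gt (Suc n) y)) / real n) \<le> K / real n"
        using near by (intro always_eventually allI) (simp add: divide_right_mono)
    qed (rule lim_const_over_n)
    moreover have "(\<lambda>n. ln (Z ?gt (Suc n) y) / real n) \<longlonglongrightarrow> ?P t"
    proof -
      have "(\<lambda>n. ln (Z ?gt n y) / real n) \<longlonglongrightarrow> ?P t"
        unfolding P by (rule top_pressure_LIMSEQ[OF holder_lin[OF h(1) D]])
      from LIMSEQ_shift_ratio[OF this, of 1] show ?thesis by simp
    qed
    ultimately have "(\<lambda>n. (ln (?m n) - ln (Z ?gt (Suc n) y)) / real n + ln (Z ?gt (Suc n) y) / real n) \<longlonglongrightarrow> 0 + ?P t"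
      by (rule tendsto_add)
    then show "(\<lambda>n. ln (?m n) / real n) \<longlonglongrightarrow> ?P t" by (simp add: diff_divide_distrib)
  qed
  define \<Phi> where "\<Phi> = (\<lambda>n. integral\<^sup>L \<mu>0 (\<phi> n))"
  define \<tau> where "\<tau> = (\<lambda>n. ln (cs n))"
  have \<tau>: "(\<lambda>n. \<tau> n / real n) \<longlonglongrightarrow> c" using c by (simp add: \<tau>_def)
  have range01: "0 \<le> \<phi> n x \<and> \<phi> n x \<le> 1" if "1 \<le> n" for n x using \<phi>[OF that] by (auto simp: tests_def)
  have cmp: "\<tau> n < r n w \<longleftrightarrow> cs n * a n w < b n w" "r n w < \<tau> n \<longleftrightarrow> b n w < cs n * a n w" if "w \<in> I n" "1 \<le> n" for n w
  proof -
    have ab: "0 < a n w" "0 < b n w" "0 < cs n" using abpos[OF that(1)] cs[OF that(2)] by auto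
    then have "ln (cs n * a n w) = \<tau> n + ln (a n w)" by (simp add: \<tau>_def ln_mult)
    moreover have "cs n * a n w < b n w \<longleftrightarrow> ln (cs n * a n w) < ln (b n w)" "b n w < cs n * a n w \<longleftrightarrow> ln (b n w) < ln (cs n * a n w)"
      using ab by simp_all
    ultimately show "\<tau> n < r n w \<longleftrightarrow> cs n * a n w < b n w" "r n w < \<tau> n \<longleftrightarrow> b n w < cs n * a n w"
      by (auto simp: r_def)
  qed
  have tests: "\<tau> n < r n w \<Longrightarrow> \<phi> n (w \<frown> y) = 1" "r n w < \<tau> n \<Longrightarrow> \<phi> n (w \<frown> y) = 0" if "w \<in> I n" "1 \<le> n" for n w
  proof -
    have ma: "measure \<mu>0 (cyl n (w \<frown> y)) = a n w" "measure \<mu>1 (cyl n (w \<frown> y)) = b n w"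
      unfolding cyl_eq wy[OF that(1)] by (simp_all add: a_def b_def)
    show "\<tau> n < r n w \<Longrightarrow> \<phi> n (w \<frown> y) = 1"
      using cmp(1)[OF that] by (intro test1[OF that(2)]) (simp add: ma)
    show "r n w < \<tau> n \<Longrightarrow> \<phi> n (w \<frown> y) = 0"
      using cmp(2)[OF that] by (intro test0[OF that(2)]) (simp add: ma)
  qed
  have \<Phi>_sum: "\<Phi> n = (\<Sum>w\<in>I n. a n w * \<phi> n (w \<frown> y))" if n: "1 \<le> n" for n
  proof -
    have "\<phi> n x = \<phi> n (pref (Suc n) x \<frown> y)" for x
    proof -
      have "\<forall>k\<le>n. x k = (pref (Suc n) x \<frown> y) k" by (simp add: conc_def)
      then show ?thesis using \<phi>[OF n] unfolding tests_def by blast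
    qed
    then have "\<Phi> n = (\<integral>x. \<phi> n (pref (Suc n) x \<frown> y) \<partial>\<mu>0)" unfolding \<Phi>_def by (intro Bochner_Integration.integral_cong) auto
    also have "\<dots> = (\<Sum>w\<in>range (pref (Suc n)). measure \<mu>0 (pref (Suc n) -` {w}) * \<phi> n (w \<frown> y))"
      using measurable_pref[of "Suc n"] I0(1)
      by (intro integral_finite_range[OF I0(2,3), where F = "\<lambda>w. \<phi> n (w \<frown> y)"]) (simp_all cong: measurable_cong_sets)
    finally show ?thesis by (simp add: range_pref a_def I_def vimage_def)
  qed
  have \<Phi>_ge: "(\<Sum>w\<in>{w\<in>I n. \<tau> n < r n w}. a n w) \<le> \<Phi> n" if n: "1 \<le> n" for n
  proof -
    have "(\<Sum>w\<in>{w\<in>I n. \<tau> n < r n w}. a n w) = (\<Sum>w\<in>{w\<in>I n. \<tau> n < r n w}. a n w * \<phi> n (w \<frown> y))"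
      using tests(1) n by (intro sum.cong) auto
    also have "\<dots> \<le> \<Phi> n"
      unfolding \<Phi>_sum[OF n] using abpos(1) range01[OF n] by (intro sum_mono2) (auto simp: I_def less_imp_le)
    finally show ?thesis .
  qed
  have \<Phi>_le: "\<Phi> n \<le> (\<Sum>w\<in>{w\<in>I n. \<tau> n \<le> r n w}. a n w)" if n: "1 \<le> n" for n
  proof -
    have "\<Phi> n = (\<Sum>w\<in>{w\<in>I n. \<tau> n \<le> r n w}. a n w * \<phi> n (w \<frown> y))"
      unfolding \<Phi>_sum[OF n] using tests(2) n by (intro sum.mono_neutral_right) (auto simp: I_def not_le)
    also have "\<dots> \<le> (\<Sum>w\<in>{w\<in>I n. \<tau> n \<le> r n w}. a n w)"
      using abpos(1) range01[OF n] by (intro sum_mono mult_left_le) (auto intro: less_imp_le)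
    finally show ?thesis .
  qed
  have mgf0: "E.mgf n 0 = 1" for n
  proof -
    have "(\<integral>x. (1::real) \<partial>\<mu>0) = (\<Sum>w\<in>range (pref (Suc n)). measure \<mu>0 (pref (Suc n) -` {w}) * 1)"
      using measurable_pref[of "Suc n"] I0(1)
      by (intro integral_finite_range[OF I0(2,3), where F = "\<lambda>w. 1"]) (simp_all cong: measurable_cong_sets)
    moreover have "(\<integral>x. (1::real) \<partial>\<mu>0) = 1" by (simp add: M0.prob_space)
    ultimately have "(\<Sum>w\<in>I n. a n w) = 1" by (simp add: range_pref a_def I_def vimage_def)
    then show ?thesis by (simp add: E.mgf_def)
  qed
  have \<Phi>_le1: "\<Phi> n \<le> 1" if "1 \<le> n" for n
  proof -
    have "\<Phi> n \<le> (\<Sum>w\<in>I n. a n w)"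
      unfolding \<Phi>_sum[OF that] using abpos(1) range01[OF that] by (intro sum_mono mult_left_le) (auto intro: less_imp_le)
    then show ?thesis using mgf0[of n] by (simp add: E.mgf_def)
  qed
  have quad: "\<exists>B. \<forall>s. \<bar>s - t\<bar> \<le> 1 \<longrightarrow> ?P s \<le> ?P t + (s - t) * deriv ?P t + B * (s - t)\<^sup>2" for t
  proof -
    have T: "0 < \<bar>t\<bar> + 1" by simp
    obtain B \<delta> where "\<And>s t'. \<bar>s\<bar> \<le> \<bar>t\<bar> + 1 \<Longrightarrow> \<bar>t'\<bar> < \<bar>t\<bar> + 1 \<Longrightarrow> ?P s - ?P t' - (s - t') * deriv ?P t' \<le> B * (s - t')\<^sup>2"
      by (rule fP_regular[OF J0 J1 osc T]) blast
    from this[of _ t] have B: "?P s - ?P t - (s - t) * deriv ?P t \<le> B * (s - t)\<^sup>2" if "\<bar>s\<bar> \<le> \<bar>t\<bar> + 1" for s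
      using that by simp
    show ?thesis
    proof (intro exI allI impI)
      fix s assume "\<bar>s - t\<bar> \<le> 1"
      then have "\<bar>s\<bar> \<le> \<bar>t\<bar> + 1" by linarith
      from B[OF this] show "?P s \<le> ?P t + (s - t) * deriv ?P t + B * (s - t)\<^sup>2" by linarith
    qed
  qed
  show ?A if t: "0 < t" and ct: "c = deriv ?P t"
  proof -
    define L where "L = ?P t - t * deriv ?P t"
    have T: "0 < t + 1" using t by simp
    obtain B \<delta> where B: "0 \<le> B" and \<delta>: "0 < \<delta>"
      and lo: "\<And>s t'. \<bar>s\<bar> \<le> t + 1 \<Longrightarrow> \<bar>t'\<bar> < t + 1 \<Longrightarrow> \<delta> * (s - t')\<^sup>2 \<le> ?P s - ?P t' - (s - t') * deriv ?P t'"
      and up: "\<And>s t'. \<bar>s\<bar> \<le> t + 1 \<Longrightarrow> \<bar>t'\<bar> < t + 1 \<Longrightarrow> ?P s - ?P t' - (s - t') * deriv ?P t' \<le> B * (s - t')\<^sup>2"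
      by (rule fP_regular[OF J0 J1 osc T]) blast
    \<comment> \<open>\<open>E.lower_bound\<close> needs the threshold strictly below the slope, but
      \<open>c\<close> is exactly the slope at \<open>t\<close>. Strict convexity puts it strictly
      below the slope at \<open>t' = t + d\<close>, and a small \<open>d\<close> keeps the loss
      within \<open>\<eta>\<close>.\<close>
    have lower: "\<forall>\<^sub>F n in sequentially. exp (real n * (L - \<eta>)) \<le> \<Phi> n" if \<eta>: "0 < \<eta>" for \<eta>
    proof -
      \<comment> \<open>The two upper bounds let the slope grow by at most \<open>2 * B * d\<close>;
        this \<open>d\<close> makes \<open>t'\<close> times the growth at most
        \<open>\<eta> / 2\<close>. The other half of \<open>\<eta>\<close> is spent in
        \<open>E.lower_bound\<close>.\<close>
      define d where "d = min (1/2) (\<eta> / (4 * (B + 1) * (t + 1)))"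
      have d: "0 < d" "d < 1" using \<eta> B t by (auto simp: d_def)
      define t' where "t' = t + d"
      have b1: "\<bar>t\<bar> \<le> t + 1" "\<bar>t\<bar> < t + 1" "\<bar>t'\<bar> \<le> t + 1" "\<bar>t'\<bar> < t + 1" using t d by (auto simp: t'_def)
      have lo1: "0 \<le> ?P t' - ?P t - d * deriv ?P t"
      proof -
        have "0 \<le> \<delta> * (t' - t)\<^sup>2" using \<delta> by simp
        then show ?thesis using lo[OF b1(3,2)] by (simp add: t'_def)
      qed
      have lo2: "\<delta> * d\<^sup>2 \<le> ?P t - ?P t' + d * deriv ?P t'"
        using lo[OF b1(1,4)] by (simp add: t'_def)
      have up1: "?P t' - ?P t - d * deriv ?P t \<le> B * d\<^sup>2" using up[OF b1(3,2)] by (simp add: t'_def)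
      have up2: "?P t - ?P t' + d * deriv ?P t' \<le> B * d\<^sup>2" using up[OF b1(1,4)] by (simp add: t'_def)
      have "0 < \<delta> * d\<^sup>2" using \<delta> d by simp
      then have "0 < d * (deriv ?P t' - deriv ?P t)" using lo1 lo2 by (simp add: algebra_simps)
      then have cv: "c < deriv ?P t'" using d ct by (simp add: zero_less_mult_iff)
      have "d * (deriv ?P t' - deriv ?P t) \<le> d * (2 * B * d)"
        using up1 up2 by (simp add: algebra_simps power2_eq_square)
      then have slope: "deriv ?P t' - deriv ?P t \<le> 2 * B * d" using d by simp
      have "t' * (deriv ?P t' - deriv ?P t) \<le> (t + 1) * (2 * (B + 1) * d)"
      proof (rule mult_mono)
        show "deriv ?P t' - deriv ?P t \<le> 2 * (B + 1) * d" using slope d by (simp add: algebra_simps)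
      qed (use t d cv ct B in \<open>auto simp: t'_def\<close>)
      also have "\<dots> \<le> (t + 1) * (2 * (B + 1) * (\<eta> / (4 * (B + 1) * (t + 1))))"
        using t B by (intro mult_left_mono) (auto simp: d_def)
      also have "\<dots> = \<eta> / 2"
      proof -
        have eq: "q * (2 * p * (\<eta> / (4 * p * q))) = \<eta> / 2" if "p \<noteq> 0" "q \<noteq> 0" for p q :: real
          using that by (simp add: field_simps)
        show ?thesis by (rule eq) (use B t in linarith)+
      qed
      finally have "t' * (deriv ?P t' - deriv ?P t) \<le> \<eta> / 2" .
      moreover have "t' * deriv ?P t = t * deriv ?P t + d * deriv ?P t" by (simp add: t'_def algebra_simps)
      ultimately have gap: "L - \<eta> \<le> ?P t' - t' * deriv ?P t' - \<eta> / 2"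
        using lo1 unfolding L_def right_diff_distrib by linarith
      obtain B' where B': "\<And>s. \<bar>s - t'\<bar> \<le> 1 \<Longrightarrow> ?P s \<le> ?P t' + (s - t') * deriv ?P t' + B' * (s - t')\<^sup>2"
        using quad[of t'] by blast
      have "\<forall>\<^sub>F n in sequentially. exp (real n * (?P t' - t' * deriv ?P t' - \<eta> / 2)) \<le> (\<Sum>w\<in>{w\<in>I n. \<tau> n < r n w}. a n w)"
        by (rule E.lower_bound[OF B' \<tau> cv]) (use t d \<eta> in \<open>auto simp: t'_def\<close>)
      then show ?thesis using eventually_ge_at_top[of 1]
      proof eventually_elim
        case (elim n)
        have "exp (real n * (L - \<eta>)) \<le> exp (real n * (?P t' - t' * deriv ?P t' - \<eta> / 2))"
          using gap by (simp add: mult_left_mono)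
        then show ?case using elim(1) \<Phi>_ge[OF elim(2)] by linarith
      qed
    qed
    have pos: "\<forall>\<^sub>F n in sequentially. 0 < \<Phi> n"
      using lower[of 1] by (auto elim!: eventually_mono intro: less_le_trans[OF exp_gt_zero])
    \<comment> \<open>Chernoff's bound at \<open>t\<close> itself, whose limit
      \<open>?P t - t * c\<close> is the claimed exponent.\<close>
    have upper: "\<forall>\<^sub>F n in sequentially. ln (\<Phi> n) / real n \<le> - t * (\<tau> n / real n) + ln (E.mgf n t) / real n"
      using pos eventually_ge_at_top[of 1]
    proof eventually_elim
      case (elim n)
      have "\<Phi> n \<le> exp (- t * \<tau> n) * E.mgf n (0 + t)"
        using \<Phi>_le[OF elim(2)] E.chernoff[where h = t and n = n and \<sigma> = "\<tau> n" and t = 0] t by simp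
      then have "ln (\<Phi> n) \<le> ln (exp (- t * \<tau> n) * E.mgf n t)" using elim(1) by (intro ln_mono) auto
      also have "\<dots> = - t * \<tau> n + ln (E.mgf n t)" using E.mgf_pos[of n t] by (subst ln_mult) auto
      finally have "ln (\<Phi> n) / real n \<le> (- t * \<tau> n + ln (E.mgf n t)) / real n" by (intro divide_right_mono) auto
      then show ?case by (simp add: diff_divide_distrib)
    qed
    have up_lim: "(\<lambda>n. - t * (\<tau> n / real n) + ln (E.mgf n t) / real n) \<longlonglongrightarrow> - t * c + ?P t"
      by (intro tendsto_intros \<tau> E.rate_mgf)
    have "(\<lambda>n. ln (\<Phi> n) / real n) \<longlonglongrightarrow> L"
    proof (rule order_tendstoI)
      fix x assume x: "L < x"
      have "\<forall>\<^sub>F n in sequentially. - t * (\<tau> n / real n) + ln (E.mgf n t) / real n < x"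
        by (rule order_tendstoD(2)[OF up_lim]) (use x in \<open>simp add: L_def ct\<close>)
      then show "\<forall>\<^sub>F n in sequentially. ln (\<Phi> n) / real n < x" using upper by eventually_elim simp
    next
      fix x assume x: "x < L"
      define \<eta> where "\<eta> = (L - x) / 2"
      have \<eta>: "0 < \<eta>" using x by (simp add: \<eta>_def)
      show "\<forall>\<^sub>F n in sequentially. x < ln (\<Phi> n) / real n"
        using lower[OF \<eta>] eventually_gt_at_top[of 0]
      proof eventually_elim
        case (elim n)
        then have "ln (exp (real n * (L - \<eta>))) \<le> ln (\<Phi> n)" by (intro ln_mono) auto
        then have "L - \<eta> \<le> ln (\<Phi> n) / real n" using elim(2) by (simp add: field_simps)
        moreover have "x < L - \<eta>" using x by (simp add: \<eta>_def field_simps)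
        ultimately show ?case by linarith
      qed
    qed
    from elog_LIMSEQ[OF pos this] show ?thesis by (simp add: \<Phi>_def L_def)
  qed
  \<comment> \<open>The log-likelihood ratio never exceeds the maximal Birkhoff sum plus a constant.
    For \<open>c\<close> beyond \<open>Aval\<close> the region where the test can be positive is
    therefore eventually empty, and \<open>elog\<close> takes its value at zero.\<close>
  show ?B if cA: "Aval \<mu>0 J0 J1 < c"
  proof -
    have supp: "0 < measure \<mu>0 {z. pref n z = pref n x}" for n x
      by (rule less_le_trans[OF exp_gt_zero K0(2)])
    define m where "m = (\<lambda>n. SUP x. birk ?D (Suc n) x)"
    obtain bd where bd: "\<And>x. \<bar>?D x\<bar> \<le> bd" using holder_bounded[OF D] by metis
    have "bdd_above (range (birk ?D n))" for n
      using birk_bound[of ?D bd n, OF bd] by (intro bdd_aboveI2[where M = "real n * bd"]) (simp add: abs_le_iff)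
    then have m_ge: "birk ?D (Suc n) x \<le> m n" for n x unfolding m_def by (intro cSUP_upper) auto
    have "(\<lambda>n. m n / real n) \<longlonglongrightarrow> Aval \<mu>0 J0 J1"
      unfolding m_def by (rule Aval_LIMSEQ[OF inv D supp])
    then have "(\<lambda>n. \<tau> n / real n - (m n / real n + (K0 + K1) / real n)) \<longlonglongrightarrow> c - (Aval \<mu>0 J0 J1 + 0)"
      by (intro tendsto_diff tendsto_add \<tau> lim_const_over_n)
    then have "\<forall>\<^sub>F n in sequentially. 0 < \<tau> n / real n - (m n / real n + (K0 + K1) / real n)"
      by (rule order_tendstoD(1)) (use cA in simp)
    then have "\<forall>\<^sub>F n in sequentially. -\<infinity> = elog (integral\<^sup>L \<mu>0 (\<phi> n)) / ereal (real n)"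
      using eventually_ge_at_top[of 1]
    proof eventually_elim
      case (elim n)
      then have "m n + (K0 + K1) < \<tau> n" by (simp add: field_simps)
      then have "r n w < \<tau> n" if "w \<in> I n" for w
        using ln_r[of n "w \<frown> y"] m_ge[of n "w \<frown> y"] wy[OF that] by (simp add: abs_le_iff)
      then have empty: "{w\<in>I n. \<tau> n \<le> r n w} = {}" by (auto simp: not_le)
      have "\<Phi> n \<le> 0" using \<Phi>_le[OF elim(2)] unfolding empty by simp
      then show ?case using elim(2) by (simp add: elog_def \<Phi>_def)
    qed
    then show ?thesis by (rule Lim_transform_eventually[OF tendsto_const])
  qed
  \<comment> \<open>Without tilt the ratio concentrates at the slope for \<open>0\<close>, so a
    threshold of smaller slope is eventually exceeded with probability at least one half.\<close>
  show ?C if c0: "c < deriv ?P 0"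
  proof -
    obtain B where B: "\<And>s. \<bar>s - 0\<bar> \<le> 1 \<Longrightarrow> ?P s \<le> ?P 0 + (s - 0) * deriv ?P 0 + B * (s - 0)\<^sup>2" using quad[of 0] by blast
    have "\<forall>\<^sub>F n in sequentially. (\<Sum>w\<in>{w\<in>I n. r n w \<le> \<tau> n}. a n w * exp (0 * r n w)) \<le> 1/2 * E.mgf n 0"
      by (rule E.lower_tail[OF B \<tau> c0]) auto
    then have half: "\<forall>\<^sub>F n in sequentially. 1/2 \<le> \<Phi> n" using eventually_ge_at_top[of 1]
    proof eventually_elim
      case (elim n)
      have "(\<Sum>w\<in>I n. a n w) = (\<Sum>w\<in>{w\<in>I n. r n w \<le> \<tau> n}. a n w) + (\<Sum>w\<in>{w\<in>I n. \<tau> n < r n w}. a n w)"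
        by (subst sum.union_disjoint[symmetric]) (auto simp: I_def intro!: sum.cong)
      then show ?case using elim(1) \<Phi>_ge[OF elim(2)] mgf0[of n] by (simp add: E.mgf_def)
    qed
    have "(\<lambda>n. ln (\<Phi> n) / real n) \<longlonglongrightarrow> 0"
    proof (rule tendsto_sandwich)
      show "\<forall>\<^sub>F n in sequentially. ln (1/2) / real n \<le> ln (\<Phi> n) / real n"
        using half by eventually_elim (intro divide_right_mono ln_mono, auto)
      show "\<forall>\<^sub>F n in sequentially. ln (\<Phi> n) / real n \<le> 0"
        using half eventually_ge_at_top[of 1]
      proof eventually_elim
        case (elim n)
        then have "ln (\<Phi> n) \<le> 0" using \<Phi>_le1[OF elim(2)] ln_mono[of "\<Phi> n" 1] by simp
        then show ?case by (simp add: divide_nonpos_nonneg)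
      qed
      show "(\<lambda>n. ln (1/2) / real n) \<longlonglongrightarrow> 0" by (rule lim_const_over_n)
    qed simp
    moreover have "\<forall>\<^sub>F n in sequentially. 0 < \<Phi> n" using half by eventually_elim simp
    ultimately show ?thesis using elog_LIMSEQ[of \<Phi> 0] by (simp add: \<Phi>_def zero_ereal_def)
  qed
qed

theorem theorem3p3:
  fixes J0 J1 :: "(nat \<Rightarrow> 'a::finite) \<Rightarrow> real"
    and \<mu>0 \<mu>1 :: "(nat \<Rightarrow> 'a) measure"
    and cs :: "nat \<Rightarrow> real" and c :: real
    and \<phi> :: "nat \<Rightarrow> (nat \<Rightarrow> 'a) \<Rightarrow> real" and chi :: "nat \<Rightarrow> real"
  assumes "CARD('a) \<ge> 2"
    and "jacobian J0" and "jacobian J1"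
    and "gibbs J0 \<mu>0" and "gibbs J1 \<mu>1" and "\<mu>0 \<noteq> \<mu>1"
    and "\<forall>n\<ge>1. 0 < cs n"
    and "(\<lambda>n. ln (cs n) / real n) \<longlonglongrightarrow> c"
    and "\<forall>n\<ge>1. \<phi> n \<in> tests n"
    and "\<forall>n\<ge>1. 0 \<le> chi n \<and> chi n \<le> 1"
    and "\<forall>n\<ge>1. \<forall>\<omega>.
           (measure \<mu>1 (cyl n \<omega>) > cs n * measure \<mu>0 (cyl n \<omega>) \<longrightarrow> \<phi> n \<omega> = 1) \<and>
           (measure \<mu>1 (cyl n \<omega>) < cs n * measure \<mu>0 (cyl n \<omega>) \<longrightarrow> \<phi> n \<omega> = 0) \<and>
           (measure \<mu>1 (cyl n \<omega>) = cs n * measure \<mu>0 (cyl n \<omega>) \<longrightarrow> \<phi> n \<omega> = chi n)"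
  shows
    "(\<forall>t>0. c = deriv (fP J0 J1) t \<longrightarrow>
        (\<lambda>n. elog (integral\<^sup>L \<mu>0 (\<phi> n)) / ereal (real n))
          \<longlonglongrightarrow> ereal (fP J0 J1 t - t * deriv (fP J0 J1) t)) \<and>
     (c > Aval \<mu>0 J0 J1 \<longrightarrow>
        (\<lambda>n. elog (integral\<^sup>L \<mu>0 (\<phi> n)) / ereal (real n)) \<longlonglongrightarrow> -\<infinity>) \<and>
     (c < deriv (fP J0 J1) 0 \<longrightarrow>
        (\<lambda>n. elog (integral\<^sup>L \<mu>0 (\<phi> n)) / ereal (real n)) \<longlonglongrightarrow> 0) \<and>
     (\<forall>s>0. c = - deriv (fP J1 J0) s \<longrightarrow>
        (\<lambda>n. elog (integral\<^sup>L \<mu>1 (\<lambda>\<omega>. 1 - \<phi> n \<omega>)) / ereal (real n))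
          \<longlonglongrightarrow> ereal (fP J1 J0 s - s * deriv (fP J1 J0) s)) \<and>
     (c < - Aval \<mu>1 J1 J0 \<longrightarrow>
        (\<lambda>n. elog (integral\<^sup>L \<mu>1 (\<lambda>\<omega>. 1 - \<phi> n \<omega>)) / ereal (real n)) \<longlonglongrightarrow> -\<infinity>) \<and>
     (c > - deriv (fP J1 J0) 0 \<longrightarrow>
        (\<lambda>n. elog (integral\<^sup>L \<mu>1 (\<lambda>\<omega>. 1 - \<phi> n \<omega>)) / ereal (real n)) \<longlonglongrightarrow> 0)"
proof -
  note A = assms
  have t1: "\<phi> n \<omega> = 1" if "1 \<le> n" "cs n * measure \<mu>0 (cyl n \<omega>) < measure \<mu>1 (cyl n \<omega>)" for n \<omega>
    using A(11) that by blast
  have t0: "\<phi> n \<omega> = 0" if "1 \<le> n" "measure \<mu>1 (cyl n \<omega>) < cs n * measure \<mu>0 (cyl n \<omega>)" for n \<omega>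
    using A(11) that by blast
  have csp: "0 < cs n" if "1 \<le> n" for n using A(7) that by blast
  have tst: "\<phi> n \<in> tests n" if "1 \<le> n" for n using A(9) that by blast
  note one = type_one_errors[OF A(2-6) csp A(8) tst t1 t0]
  \<comment> \<open>Exchanging the hypotheses makes \<open>1 - \<phi> n\<close> a test with
    threshold \<open>inverse (cs n)\<close>, whose rate is \<open>- c\<close>.\<close>
  have csp': "0 < inverse (cs n)" if "1 \<le> n" for n using csp[OF that] by simp
  have lim': "(\<lambda>n. ln (inverse (cs n)) / real n) \<longlonglongrightarrow> - c"
  proof (rule Lim_transform_eventually[OF tendsto_minus[OF A(8)]])
    show "\<forall>\<^sub>F n in sequentially. - (ln (cs n) / real n) = ln (inverse (cs n)) / real n"
      using eventually_ge_at_top[of 1] by eventually_elim (use csp in \<open>simp add: ln_inverse\<close>)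
  qed
  have tst': "(\<lambda>\<omega>. 1 - \<phi> n \<omega>) \<in> tests n" if "1 \<le> n" for n
    using tst[OF that] unfolding tests_def by (auto intro!: borel_measurable_diff)
  have t1': "1 - \<phi> n \<omega> = 1" if "1 \<le> n" "inverse (cs n) * measure \<mu>1 (cyl n \<omega>) < measure \<mu>0 (cyl n \<omega>)" for n \<omega>
    using t0[OF that(1)] that(2) csp[OF that(1)] by (simp add: field_simps)
  have t0': "1 - \<phi> n \<omega> = 0" if "1 \<le> n" "measure \<mu>0 (cyl n \<omega>) < inverse (cs n) * measure \<mu>1 (cyl n \<omega>)" for n \<omega>
    using t1[OF that(1)] that(2) csp[OF that(1)] by (simp add: field_simps)
  note two = type_one_errors[OF A(3,2,5,4) A(6)[symmetric] csp' lim' tst' t1' t0']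
  show ?thesis
  proof (intro conjI allI impI)
    fix s :: real assume "0 < s" "c = - deriv (fP J1 J0) s"
    then show "(\<lambda>n. elog (integral\<^sup>L \<mu>1 (\<lambda>\<omega>. 1 - \<phi> n \<omega>)) / ereal (real n))
          \<longlonglongrightarrow> ereal (fP J1 J0 s - s * deriv (fP J1 J0) s)"
      by (intro two(1)) auto
  next
    assume "c < - Aval \<mu>1 J1 J0"
    then have "Aval \<mu>1 J1 J0 < - c" by (rule less_minus_iff[THEN iffD1])
    then show "(\<lambda>n. elog (integral\<^sup>L \<mu>1 (\<lambda>\<omega>. 1 - \<phi> n \<omega>)) / ereal (real n)) \<longlonglongrightarrow> -\<infinity>"
      by (intro two(2)) auto
  next
    assume "c > - deriv (fP J1 J0) 0"
    then have "- c < deriv (fP J1 J0) 0" by (rule minus_less_iff[THEN iffD1])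
    then show "(\<lambda>n. elog (integral\<^sup>L \<mu>1 (\<lambda>\<omega>. 1 - \<phi> n \<omega>)) / ereal (real n)) \<longlonglongrightarrow> 0"
      by (intro two(3)) auto
  qed (use one in auto)
qed

end
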